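(* Let $k\geq 1$ be an integer and let $M_{k,0}=G/\Lambda_{k,0}$, $M_{k,\pi}=G/\Lambda_{k,\pi}$, $M_{k,\pi/2}=G/\Lambda_{k,\pi/2}$ be the compact $4$-dimensional solvmanifolds obtained from the oscillator group $G$ and its lattices $\Lambda_{k,0},\Lambda_{k,\pi},\Lambda_{k,\pi/2}$. (1) Their Betti numbers $b_j=\dim_{\mathbb R}H^j_{dR}$ are: - for $M_{k,0}$: $b_0=1$, $b_1=3$, $b_2=4$; - for $M_{k,\pi}$: $b_0=1$, $b_1=1$, $b_2=0$; - for $M_{k,\pi/2}$: $b_0=1$, $b_1=1$, $b_2=0$; and $b_3=b_1$, $b_4=b_0$ in all cases. (2) A minimal model of $M_{k,0}$ is the free graded-commutative differential graded algebra $\mathcal M_{k,0}=(\Lambda(x_1,y_1,z_1,t_1),d)$ whose four generators all have degree one, with $dx_1=dy_1=dt_1=0$ and $dz_1=-x_1y_1$. (3) A minimal model of $M_{k,\pi}$, and also of $M_{k,\pi/2}$, is the free graded-commutative differential graded algebra $(\Lambda(t_1,w_3),d=0)$ with generators $t_1$ of degree $1$ and $w_3$ of degree $3$ and zero differential.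
   Context: The oscillator group $G=\mathbb R\ltimes_\alpha \mathrm H_3(\mathbb R)$ is $\mathbb R^4$ with coordinates $(t,x,y,z)$ and product $$(t,x,y,z)(t',x',y',z')=\bigl(t+t',\;x+u,\;y+v,\;z+z'+\tfrac12(xv-uy)\bigr),$$ where $u=x'\cos t+y'\sin t$ and $v=-x'\sin t+y'\cos t$. Here $\mathrm H_3(\mathbb R)$ is the Heisenberg group, i.e. $\mathbb R^3$ with product $(x,y,z)(x',y',z')=(x+x',y+y',z+z'+\frac12(xy'-x'y))$. For an integer $k\ge 1$ put $\Gamma_k=\mathbb Z\times\mathbb Z\times\frac1{2k}\mathbb Z\subset \mathrm H_3(\mathbb R)$ and define the lattices (discrete co-compact subgroups) of $G$ $$\Lambda_{k,0}=2\pi\mathbb Z\times\Gamma_k,\qquad \Lambda_{k,\pi}=\pi\mathbb Z\times\Gamma_k,\qquad \Lambda_{k,\pi/2}=\tfrac{\pi}{2}\mathbb Z\times\Gamma_k$$ (as subsets of $\mathbb R\times\mathbb R^3$, with the product of $G$). A minimal model of a manifold $M$ is a minimal Sullivan algebra over $\mathbb R$ together with a quasi-isomorphism of commutative differential graded algebras from it to the de Rham algebra of $M$. $\Lambda(\dots)$ denotes the free graded-commutative algebra over $\mathbb R$ on the listed generators, and the subscript of each generator is its degree. *)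

theory Defs
  imports
    "HOL-Analysis.Analysis"
    "HOL-Library.Function_Algebras"
    "HOL-Algebra.Left_Coset"
begin

section \<open>Real vector spaces of functions\<close>

instantiation "fun" :: (type, real_vector) real_vector
begin

definition scaleR_fun :: "real \<Rightarrow> ('a \<Rightarrow> 'b) \<Rightarrow> 'a \<Rightarrow> 'b"
  where "scaleR_fun c f = (\<lambda>x. c *\<^sub>R f x)"

instance
  by standard (simp_all add: scaleR_fun_def fun_eq_iff scaleR_add_right scaleR_add_left)

end

lemma scaleR_fun_apply [simp]: "(c *\<^sub>R f) x = c *\<^sub>R f x"
  by (simp add: scaleR_fun_def)


section \<open>Differential graded algebras and their cohomology\<close>

text \<open>A graded algebra is given by its homogeneous components, all living in one ambient real
  vector space; addition and scalar multiplication are those of the ambient space.\<close>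

record 'a dga =
  component :: "nat \<Rightarrow> 'a set"
  gmult :: "'a \<Rightarrow> 'a \<Rightarrow> 'a"
  gone :: 'a
  gdiff :: "'a \<Rightarrow> 'a"

definition cocycles :: "('a::real_vector) dga \<Rightarrow> nat \<Rightarrow> 'a set"
  where "cocycles A j = {a \<in> component A j. gdiff A a = 0}"

definition coboundaries :: "('a::real_vector) dga \<Rightarrow> nat \<Rightarrow> 'a set"
  where "coboundaries A j = (case j of 0 \<Rightarrow> {0} | Suc i \<Rightarrow> gdiff A ` component A i)"

definition cohomologous :: "('a::real_vector) dga \<Rightarrow> nat \<Rightarrow> ('a \<times> 'a) set"
  where "cohomologous A j =
    {(a, b). a \<in> cocycles A j \<and> b \<in> cocycles A j \<and> a - b \<in> coboundaries A j}"

definition cohomology :: "('a::real_vector) dga \<Rightarrow> nat \<Rightarrow> 'a set set"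
  where "cohomology A j = cocycles A j // cohomologous A j"

definition coh_class :: "('a::real_vector) dga \<Rightarrow> nat \<Rightarrow> 'a \<Rightarrow> 'a set"
  where "coh_class A j a = cohomologous A j `` {a}"

text \<open>The quotient \<open>H\<^sup>j\<close> has dimension \<open>n\<close> if there are \<open>n\<close> classes
  \<open>[h 0], \<dots>, [h (n - 1)]\<close> of which every class is a unique linear combination
  \<open>c 0 [h 0] + \<dots> + c (n - 1) [h (n - 1)] = [c 0 h 0 + \<dots> + c (n - 1) h (n - 1)]\<close>.
  In particular \<open>H\<^sup>j\<close> is then finite-dimensional.\<close>

definition cohomology_dim :: "('a::real_vector) dga \<Rightarrow> nat \<Rightarrow> nat \<Rightarrow> bool"
  where "cohomology_dim A j n \<longleftrightarrow>
    (\<exists>h :: nat \<Rightarrow> 'a. (\<forall>i<n. h i \<in> cocycles A j) \<and>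
      (\<forall>\<xi>\<in>cohomology A j. \<exists>!c :: nat \<Rightarrow> real.
         (\<forall>i\<ge>n. c i = 0) \<and> \<xi> = coh_class A j (\<Sum>i<n. c i *\<^sub>R h i)))"

definition dga_hom :: "('a::real_vector) dga \<Rightarrow> ('b::real_vector) dga \<Rightarrow> ('a \<Rightarrow> 'b) \<Rightarrow> bool"
  where "dga_hom A B \<phi> \<longleftrightarrow>
    (\<forall>n. \<forall>a\<in>component A n. \<phi> a \<in> component B n) \<and>
    (\<forall>n. \<forall>a\<in>component A n. \<forall>b\<in>component A n. \<phi> (a + b) = \<phi> a + \<phi> b) \<and>
    (\<forall>n. \<forall>a\<in>component A n. \<forall>c. \<phi> (c *\<^sub>R a) = c *\<^sub>R \<phi> a) \<and>
    (\<forall>m n. \<forall>a\<in>component A m. \<forall>b\<in>component A n. \<phi> (gmult A a b) = gmult B (\<phi> a) (\<phi> b)) \<and>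
    \<phi> (gone A) = gone B \<and>
    (\<forall>n. \<forall>a\<in>component A n. \<phi> (gdiff A a) = gdiff B (\<phi> a))"

definition cohomology_map :: "('b::real_vector) dga \<Rightarrow> nat \<Rightarrow> ('a \<Rightarrow> 'b) \<Rightarrow> 'a set \<Rightarrow> 'b set"
  where "cohomology_map B j \<phi> \<xi> = cohomologous B j `` (\<phi> ` \<xi>)"

definition quasi_isomorphism ::
    "('a::real_vector) dga \<Rightarrow> ('b::real_vector) dga \<Rightarrow> ('a \<Rightarrow> 'b) \<Rightarrow> bool"
  where "quasi_isomorphism A B \<phi> \<longleftrightarrow>
    dga_hom A B \<phi> \<and>
    (\<forall>j. bij_betw (cohomology_map B j \<phi>) (cohomology A j) (cohomology B j))"


section \<open>Free graded-commutative algebras and minimal Sullivan algebras\<close>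

text \<open>The algebra \<open>\<Lambda>V\<close>, where \<open>V\<close> has the basis \<open>X\<close> and \<open>g \<in> X\<close> has degree \<open>deg g\<close>.  Its basis
  consists of the monomials \<open>g\<^sub>1 \<cdots> g\<^sub>r\<close> with \<open>g\<^sub>1 \<le> \<dots> \<le> g\<^sub>r\<close> in which no generator of odd degree
  is repeated; such a monomial is encoded as a sorted list, and an element of \<open>\<Lambda>V\<close> as its
  finitely supported coefficient function.\<close>

definition monomials :: "'g::linorder set \<Rightarrow> ('g \<Rightarrow> nat) \<Rightarrow> 'g list set"
  where "monomials X deg =
    {w. set w \<subseteq> X \<and> sorted w \<and> (\<forall>g\<in>set w. odd (deg g) \<longrightarrow> count_list w g = 1)}"

definition monomial :: "'g list \<Rightarrow> 'g list \<Rightarrow> real"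
  where "monomial w = (\<lambda>u. if u = w then 1 else 0)"

definition supp :: "('g list \<Rightarrow> real) \<Rightarrow> 'g list set"
  where "supp a = {w. a w \<noteq> 0}"

definition free_component ::
    "'g::linorder set \<Rightarrow> ('g \<Rightarrow> nat) \<Rightarrow> nat \<Rightarrow> ('g list \<Rightarrow> real) set"
  where "free_component X deg n =
    {a. finite (supp a) \<and> (\<forall>w\<in>supp a. w \<in> monomials X deg \<and> sum_list (map deg w) = n)}"

text \<open>The Koszul sign for sorting \<open>u @ v\<close>, where \<open>u\<close> and \<open>v\<close> are sorted: each transposition of two
  generators of odd degree contributes a factor \<open>-1\<close>.\<close>

definition koszul_sign :: "('g::linorder \<Rightarrow> nat) \<Rightarrow> 'g list \<Rightarrow> 'g list \<Rightarrow> real"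
  where "koszul_sign deg u v =
    (-1) ^ card {(i, j). i < length u \<and> j < length v \<and> v ! j < u ! i \<and>
                         odd (deg (u ! i)) \<and> odd (deg (v ! j))}"

definition mono_mult :: "('g::linorder \<Rightarrow> nat) \<Rightarrow> 'g list \<Rightarrow> 'g list \<Rightarrow> 'g list \<Rightarrow> real"
  where "mono_mult deg u v =
    (if \<exists>g \<in> set u \<inter> set v. odd (deg g) then 0
     else koszul_sign deg u v *\<^sub>R monomial (sort (u @ v)))"

definition free_mult ::
    "('g::linorder \<Rightarrow> nat) \<Rightarrow> ('g list \<Rightarrow> real) \<Rightarrow> ('g list \<Rightarrow> real) \<Rightarrow> 'g list \<Rightarrow> real"
  where "free_mult deg a b = (\<Sum>u\<in>supp a. \<Sum>v\<in>supp b. (a u * b v) *\<^sub>R mono_mult deg u v)"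

text \<open>The derivation of degree \<open>1\<close> of \<open>\<Lambda>V\<close> with prescribed values \<open>dg\<close> on the generators,
  given on monomials by the graded Leibniz rule \<open>d(g w) = (dg) w + (-1)\<^bsup>deg g\<^esup> g (dw)\<close>.\<close>

fun mono_diff ::
    "('g::linorder \<Rightarrow> nat) \<Rightarrow> ('g \<Rightarrow> 'g list \<Rightarrow> real) \<Rightarrow> 'g list \<Rightarrow> 'g list \<Rightarrow> real"
  where
    "mono_diff deg dg [] = 0"
  | "mono_diff deg dg (g # w) =
       free_mult deg (dg g) (monomial w)
       + (-1) ^ deg g *\<^sub>R free_mult deg (monomial [g]) (mono_diff deg dg w)"

definition free_diff ::
    "('g::linorder \<Rightarrow> nat) \<Rightarrow> ('g \<Rightarrow> 'g list \<Rightarrow> real) \<Rightarrow> ('g list \<Rightarrow> real) \<Rightarrow> 'g list \<Rightarrow> real"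
  where "free_diff deg dg a = (\<Sum>w\<in>supp a. a w *\<^sub>R mono_diff deg dg w)"

definition free_dga ::
    "'g::linorder set \<Rightarrow> ('g \<Rightarrow> nat) \<Rightarrow> ('g \<Rightarrow> 'g list \<Rightarrow> real) \<Rightarrow> ('g list \<Rightarrow> real) dga"
  where "free_dga X deg dg =
    \<lparr>component = free_component X deg, gmult = free_mult deg, gone = monomial [],
     gdiff = free_diff deg dg\<rparr>"

text \<open>The generators are indexed by a well-ordered type, and the differential of a generator is a
  polynomial in strictly smaller generators (nilpotence condition).  Minimality means that
  the image of \<open>d\<close> lies in \<open>\<Lambda>\<^sup>+V \<cdot> \<Lambda>\<^sup>+V\<close>, which is spanned by the monomials of word length at
  least \<open>2\<close>.\<close>

definition minimal_sullivan ::
    "'g::wellorder set \<Rightarrow> ('g \<Rightarrow> nat) \<Rightarrow> ('g \<Rightarrow> 'g list \<Rightarrow> real) \<Rightarrow> bool"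
  where "minimal_sullivan X deg dg \<longleftrightarrow>
    (\<forall>g\<in>X. deg g \<ge> 1) \<and>
    (\<forall>g\<in>X. dg g \<in> free_component X deg (Suc (deg g))) \<and>
    (\<forall>g\<in>X. \<forall>w\<in>supp (dg g). set w \<subseteq> {..<g}) \<and>
    (\<forall>n. \<forall>a\<in>free_component X deg n. free_diff deg dg (free_diff deg dg a) = 0) \<and>
    (\<forall>n. \<forall>a\<in>free_component X deg n. \<forall>w\<in>supp (free_diff deg dg a). length w \<ge> 2)"


section \<open>The de Rham algebra of a manifold\<close>

text \<open>Smooth functions on an open set, by iterated directional derivatives.\<close>

primrec Ck_on :: "nat \<Rightarrow> 'e::real_normed_vector set \<Rightarrow> ('e \<Rightarrow> real) \<Rightarrow> bool"
  where
    "Ck_on 0 U f \<longleftrightarrow> continuous_on U f"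
  | "Ck_on (Suc k) U f \<longleftrightarrow>
       (\<forall>p\<in>U. f differentiable (at p)) \<and>
       (\<forall>v. Ck_on k U (\<lambda>p. frechet_derivative f (at p) v))"

definition smooth_fun_on :: "'e::real_normed_vector set \<Rightarrow> ('e \<Rightarrow> real) \<Rightarrow> bool"
  where "smooth_fun_on U f \<longleftrightarrow> (\<forall>k. Ck_on k U f)"

text \<open>A manifold is given by an atlas of local parametrizations: a pair \<open>(U, f)\<close> consists of an open
  subset \<open>U\<close> of the model space and an injective map \<open>f\<close> from \<open>U\<close> onto a patch of the manifold,
  i.e. the inverse of a chart.\<close>

type_synonym ('e, 'm) parametrization = "'e set \<times> ('e \<Rightarrow> 'm)"

text \<open>A differential form is given by its local expressions.  The value of the local expression
  in the parametrization \<open>c = (U, f)\<close> at \<open>p \<in> U\<close> on the tangent vectors \<open>v\<^sub>1, \<dots>, v\<^sub>n\<close> is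
  \<open>\<omega> c p [v\<^sub>1, \<dots>, v\<^sub>n]\<close>; a form of degree \<open>n\<close> vanishes on lists of any other length.\<close>

type_synonym ('e, 'm) form = "('e, 'm) parametrization \<Rightarrow> 'e \<Rightarrow> 'e list \<Rightarrow> real"

definition alternating_multilinear :: "nat \<Rightarrow> ('e::real_vector list \<Rightarrow> real) \<Rightarrow> bool"
  where "alternating_multilinear n \<alpha> \<longleftrightarrow>
    (\<forall>vs. length vs \<noteq> n \<longrightarrow> \<alpha> vs = 0) \<and>
    (\<forall>vs i. length vs = n \<and> i < n \<longrightarrow> linear (\<lambda>v. \<alpha> (vs[i := v]))) \<and>
    (\<forall>vs i j. length vs = n \<and> i < j \<and> j < n \<and> vs ! i = vs ! j \<longrightarrow> \<alpha> vs = 0)"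

text \<open>The last clause is the transformation rule: on overlaps the local expressions are related
  by pullback along the change of coordinates \<open>f'\<^sup>-\<^sup>1 \<circ> f\<close>.\<close>

definition forms ::
    "('e::real_normed_vector, 'm) parametrization set \<Rightarrow> nat \<Rightarrow> ('e, 'm) form set"
  where "forms \<A> n = {\<omega>.
    (\<forall>U f p. \<not> ((U, f) \<in> \<A> \<and> p \<in> U) \<longrightarrow> \<omega> (U, f) p = 0) \<and>
    (\<forall>(U, f)\<in>\<A>. \<forall>p\<in>U. alternating_multilinear n (\<omega> (U, f) p)) \<and>
    (\<forall>(U, f)\<in>\<A>. \<forall>vs. smooth_fun_on U (\<lambda>p. \<omega> (U, f) p vs)) \<and>
    (\<forall>(U, f)\<in>\<A>. \<forall>(U', f')\<in>\<A>. \<forall>p\<in>U. \<forall>p'\<in>U'. f p = f' p' \<longrightarrow>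
       (\<forall>vs. \<omega> (U, f) p vs =
             \<omega> (U', f') p' (map (frechet_derivative (inv_into U' f' \<circ> f) (at p)) vs)))}"

text \<open>The sign of the shuffle that moves the positions in \<open>I \<subseteq> {..<n}\<close> in front of the others.\<close>

definition shuffle_sign :: "nat \<Rightarrow> nat set \<Rightarrow> real"
  where "shuffle_sign n I = (-1) ^ card {(i, j). i \<in> I \<and> j \<in> {..<n} - I \<and> j < i}"

definition wedge :: "('e, 'm) form \<Rightarrow> ('e, 'm) form \<Rightarrow> ('e, 'm) form"
  where "wedge \<omega> \<eta> = (\<lambda>c p vs.
    \<Sum>I\<in>Pow {..<length vs}.
      shuffle_sign (length vs) I * \<omega> c p (nths vs I) * \<eta> c p (nths vs (- I)))"

definition unit_form :: "('e, 'm) parametrization set \<Rightarrow> ('e, 'm) form"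
  where "unit_form \<A> = (\<lambda>c p vs. if c \<in> \<A> \<and> p \<in> fst c \<and> vs = [] then 1 else 0)"

text \<open>\<open>(d\<omega>)(v\<^sub>0, \<dots>, v\<^sub>n) = \<Sum>\<^sub>i (-1)\<^sup>i D\<^bsub>v\<^sub>i\<^esub> (\<omega>(v\<^sub>0, \<dots>, v\<^sub>i omitted, \<dots>, v\<^sub>n))\<close> for constant vector
  fields \<open>v\<^sub>0, \<dots>, v\<^sub>n\<close>, whose Lie brackets vanish.\<close>

definition exterior_derivative ::
    "('e::real_normed_vector, 'm) parametrization set \<Rightarrow> ('e, 'm) form \<Rightarrow> ('e, 'm) form"
  where "exterior_derivative \<A> \<omega> = (\<lambda>c p vs.
    if c \<in> \<A> \<and> p \<in> fst c then
      \<Sum>i<length vs. (-1) ^ i *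
        frechet_derivative (\<lambda>q. \<omega> c q (take i vs @ drop (Suc i) vs)) (at p) (vs ! i)
    else 0)"

definition de_Rham :: "('e::real_normed_vector, 'm) parametrization set \<Rightarrow> ('e, 'm) form dga"
  where "de_Rham \<A> =
    \<lparr>component = forms \<A>, gmult = wedge, gone = unit_form \<A>, gdiff = exterior_derivative \<A>\<rparr>"

text \<open>\<open>(\<Lambda>V, d)\<close> together with some quasi-isomorphism to the de Rham algebra of the manifold with
  atlas \<open>\<A>\<close> is a minimal model of that manifold.\<close>

definition minimal_model ::
    "'g::wellorder set \<Rightarrow> ('g \<Rightarrow> nat) \<Rightarrow> ('g \<Rightarrow> 'g list \<Rightarrow> real) \<Rightarrow>
     ('e::real_normed_vector, 'm) parametrization set \<Rightarrow> bool"
  where "minimal_model X deg dg \<A> \<longleftrightarrow>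
    minimal_sullivan X deg dg \<and>
    (\<exists>\<phi>. quasi_isomorphism (free_dga X deg dg) (de_Rham \<A>) \<phi>)"


section \<open>The oscillator group and its solvmanifolds\<close>

type_synonym real4 = "real \<times> real \<times> real \<times> real"

fun osc_mult :: "real4 \<Rightarrow> real4 \<Rightarrow> real4"
  where "osc_mult (t, x, y, z) (t', x', y', z') =
    (let u = x' * cos t + y' * sin t; v = - x' * sin t + y' * cos t
     in (t + t', x + u, y + v, z + z' + 1/2 * (x * v - u * y)))"

definition oscillator :: "real4 monoid"
  where "oscillator = \<lparr>carrier = UNIV, mult = osc_mult, one = (0, 0, 0, 0)\<rparr>"

text \<open>\<open>\<theta>\<int> \<times> \<Gamma>\<^sub>k\<close> with \<open>\<Gamma>\<^sub>k = \<int> \<times> \<int> \<times> 1/(2k) \<int>\<close>; the lattices \<open>\<Lambda>\<^bsub>k,0\<^esub>\<close>, \<open>\<Lambda>\<^bsub>k,\<pi>\<^esub>\<close>, \<open>\<Lambda>\<^bsub>k,\<pi>/2\<^esub>\<close>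
  are obtained for \<open>\<theta> = 2\<pi>, \<pi>, \<pi>/2\<close>.\<close>

definition osc_lattice :: "nat \<Rightarrow> real \<Rightarrow> real4 set"
  where "osc_lattice k \<theta> =
    {(\<theta> * of_int m, of_int a, of_int b, of_int c / (2 * real k)) | m a b c. True}"

text \<open>The smooth structure on the space of left cosets \<open>lcosets\<^bsub>oscillator\<^esub> L\<close> for which the
  projection from the oscillator group is a local diffeomorphism: its parametrizations are the
  restrictions of the projection to the open sets on which it is injective.\<close>

definition osc_quotient :: "real4 set \<Rightarrow> (real4, real4 set) parametrization set"
  where "osc_quotient L =
    {(U, \<lambda>g. g <#\<^bsub>oscillator\<^esub> L) | U. open U \<and> inj_on (\<lambda>g. g <#\<^bsub>oscillator\<^esub> L) U}"

definition M_0 :: "nat \<Rightarrow> (real4, real4 set) parametrization set"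
  where "M_0 k = osc_quotient (osc_lattice k (2 * pi))"

definition M_pi :: "nat \<Rightarrow> (real4, real4 set) parametrization set"
  where "M_pi k = osc_quotient (osc_lattice k pi)"

definition M_pi2 :: "nat \<Rightarrow> (real4, real4 set) parametrization set"
  where "M_pi2 k = osc_quotient (osc_lattice k (pi / 2))"

text \<open>The differential algebras \<open>(\<Lambda>(x\<^sub>1, y\<^sub>1, z\<^sub>1, t\<^sub>1), d)\<close> with \<open>dx\<^sub>1 = dy\<^sub>1 = dt\<^sub>1 = 0\<close>,
  \<open>dz\<^sub>1 = - x\<^sub>1 y\<^sub>1\<close>, where \<open>x\<^sub>1, y\<^sub>1, z\<^sub>1, t\<^sub>1\<close> are numbered \<open>0, 1, 2, 3\<close>, and \<open>(\<Lambda>(t\<^sub>1, w\<^sub>3), 0)\<close>,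
  where \<open>t\<^sub>1, w\<^sub>3\<close> are numbered \<open>0, 1\<close>.\<close>

definition model_0_gens :: "nat set"
  where "model_0_gens = {0, 1, 2, 3}"

definition model_0_deg :: "nat \<Rightarrow> nat"
  where "model_0_deg g = 1"

definition model_0_diff :: "nat \<Rightarrow> nat list \<Rightarrow> real"
  where "model_0_diff g = (if g = 2 then - monomial [0, 1] else 0)"

definition model_pi_gens :: "nat set"
  where "model_pi_gens = {0, 1}"

definition model_pi_deg :: "nat \<Rightarrow> nat"
  where "model_pi_deg g = (if g = 0 then 1 else 3)"

definition model_pi_diff :: "nat \<Rightarrow> nat list \<Rightarrow> real"
  where "model_pi_diff g = 0"

lemma group_oscillator: "group oscillator"
proof (rule groupI)
  fix g h l :: real4
  obtain t x y z where g: "g = (t, x, y, z)" by (cases g)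
  obtain t' x' y' z' where h: "h = (t', x', y', z')" by (cases h)
  obtain t'' x'' y'' z'' where l: "l = (t'', x'', y'', z'')" by (cases l)
  define c s c' s' where cs: "c = cos t" "s = sin t" "c' = cos t'" "s' = sin t'"
  have "c * c + s * s = 1"
    by (simp add: cs)
  moreover define r :: real where "r = 1/2"
  moreover from this have "2 * r = 1"
    by simp
  ultimately have z: "z + z' + r * (x * (- x' * s + y' * c) - (x' * c + y' * s) * y) + z'' +
      r * ((x + (x' * c + y' * s)) * (- x'' * (s * c' + c * s') + y'' * (c * c' - s * s')) -
       (x'' * (c * c' - s * s') + y'' * (s * c' + c * s')) * (y + (- x' * s + y' * c))) =
    z + (z' + z'' + r * (x' * (- x'' * s' + y'' * c') - (x'' * c' + y'' * s') * y')) +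
      r * (x * (- (x' + (x'' * c' + y'' * s')) * s + (y' + (- x'' * s' + y'' * c')) * c) -
       ((x' + (x'' * c' + y'' * s')) * c + (y' + (- x'' * s' + y'' * c')) * s) * y)"
    by algebra
  show "g \<otimes>\<^bsub>oscillator\<^esub> h \<otimes>\<^bsub>oscillator\<^esub> l = g \<otimes>\<^bsub>oscillator\<^esub> (h \<otimes>\<^bsub>oscillator\<^esub> l)"
    unfolding g h l oscillator_def monoid.simps osc_mult.simps Let_def prod.inject
      cos_add sin_add cs(1-4)[symmetric] \<open>r = 1/2\<close>[symmetric]
    using z by (simp add: algebra_simps)
  show "\<exists>h\<in>carrier oscillator. h \<otimes>\<^bsub>oscillator\<^esub> g = \<one>\<^bsub>oscillator\<^esub>"
  proof
    let ?h = "(- t, - (x * cos t - y * sin t), - (x * sin t + y * cos t), - z)"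
    show "?h \<otimes>\<^bsub>oscillator\<^esub> g = \<one>\<^bsub>oscillator\<^esub>"
      by (simp add: g oscillator_def Let_def field_simps)
  qed (simp add: oscillator_def)
qed (auto simp: oscillator_def)

lemma cos_sin_quarter_turns:
  obtains p q :: int where "cos (pi / 2 * of_int m) = of_int p" "sin (pi / 2 * of_int m) = of_int q"
proof -
  have "\<exists>p q :: int. cos (pi / 2 * of_int m) = of_int p \<and> sin (pi / 2 * of_int m) = of_int q"
  proof (induction m rule: int_induct[of _ 0])
    case base
    show ?case by (intro exI[of _ 1] exI[of _ 0]) simp
  next
    case (step1 i)
    then obtain p q :: int
      where pq: "cos (pi / 2 * of_int i) = of_int p" "sin (pi / 2 * of_int i) = of_int q" by blast
    have eq: "pi / 2 * of_int (i + 1) = pi / 2 * of_int i + pi / 2"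
      by (simp add: algebra_simps)
    show ?case
      unfolding eq cos_add sin_add pq by (intro exI[of _ "- q"] exI[of _ p]) simp
  next
    case (step2 i)
    then obtain p q :: int
      where pq: "cos (pi / 2 * of_int i) = of_int p" "sin (pi / 2 * of_int i) = of_int q" by blast
    have eq: "pi / 2 * of_int (i - 1) = pi / 2 * of_int i - pi / 2"
      by (simp add: field_simps)
    show ?case
      unfolding eq cos_diff sin_diff pq by (intro exI[of _ q] exI[of _ "- p"]) simp
  qed
  then show thesis using that by blast
qed

lemma subgroup_osc_lattice:
  fixes n :: int
  assumes k: "k \<ge> 1" and \<theta>: "\<theta> = pi / 2 * of_int n"
  shows "subgroup (osc_lattice k \<theta>) oscillator"
proof -
  interpret group oscillator by (rule group_oscillator)
  have eq: "\<theta> * of_int m = pi / 2 * of_int (n * m)" for m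
    by (simp add: \<theta>)
  have mult: "osc_mult g h \<in> osc_lattice k \<theta>"
    if gh: "g \<in> osc_lattice k \<theta>" "h \<in> osc_lattice k \<theta>" for g h
  proof -
    obtain m a b c where g: "g = (\<theta> * of_int m, of_int a, of_int b, of_int c / (2 * real k))"
      using gh(1) by (auto simp: osc_lattice_def)
    obtain m' a' b' c' where h: "h = (\<theta> * of_int m', of_int a', of_int b', of_int c' / (2 * real k))"
      using gh(2) by (auto simp: osc_lattice_def)
    obtain p q :: int where pq: "cos (\<theta> * of_int m) = of_int p" "sin (\<theta> * of_int m) = of_int q"
      using cos_sin_quarter_turns[of "n * m"] unfolding eq by blast
    define u v where uv: "u = a' * p + b' * q" "v = - a' * q + b' * p"
    have "osc_mult g h = (\<theta> * of_int (m + m'), of_int (a + u), of_int (b + v),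
        of_int (c + c' + int k * (a * v - u * b)) / (2 * real k))"
      using k by (simp add: g h pq uv Let_def field_simps)
    then show ?thesis
      unfolding osc_lattice_def by blast
  qed
  have inv: "inv\<^bsub>oscillator\<^esub> g \<in> osc_lattice k \<theta>" if g: "g \<in> osc_lattice k \<theta>" for g
  proof -
    obtain m a b c where g: "g = (\<theta> * of_int m, of_int a, of_int b, of_int c / (2 * real k))"
      using g by (auto simp: osc_lattice_def)
    obtain p q :: int where pq: "cos (\<theta> * of_int m) = of_int p" "sin (\<theta> * of_int m) = of_int q"
      using cos_sin_quarter_turns[of "n * m"] unfolding eq by blast
    let ?h = "(\<theta> * of_int (- m), of_int (- (a * p - b * q)), of_int (- (a * q + b * p)),
      of_int (- c) / (2 * real k)) :: real4"
    have "?h \<otimes>\<^bsub>oscillator\<^esub> g = \<one>\<^bsub>oscillator\<^esub>"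
      by (simp add: g oscillator_def Let_def pq field_simps)
    then have "inv\<^bsub>oscillator\<^esub> g = ?h"
      by (intro inv_equality) (auto simp: oscillator_def)
    then show ?thesis
      unfolding osc_lattice_def by blast
  qed
  have "(0, 0, 0, 0) \<in> osc_lattice k \<theta>"
    unfolding osc_lattice_def by (auto intro!: exI[of _ 0])
  then show ?thesis
    using mult inv by unfold_locales (auto simp: oscillator_def)
qed

lemma osc_quotient_covers:
  assumes k: "k \<ge> 1" and \<theta>: "\<theta> > 0"
  shows "\<exists>(U, f)\<in>osc_quotient (osc_lattice k \<theta>). p \<in> U"
proof -
  define L where "L = osc_lattice k \<theta>"
  define e where "e = min (\<theta> / 2) (1 / (4 * real k))"
  have e: "e > 0" "2 * e \<le> \<theta>" "2 * e \<le> 1 / (2 * real k)"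
    using k \<theta> by (auto simp: e_def min_def field_simps)
  have "1 / (2 * real k) \<le> 1 / 2"
    using k by (simp add: field_simps)
  then have e': "2 * e \<le> 1 / 2"
    using e by linarith
  have "inj_on (\<lambda>g. g <#\<^bsub>oscillator\<^esub> L) (ball p e)"
  proof (rule inj_onI)
    fix g h assume g: "g \<in> ball p e" and h: "h \<in> ball p e"
      and eq: "g <#\<^bsub>oscillator\<^esub> L = h <#\<^bsub>oscillator\<^esub> L"
    have one: "(0, 0, 0, 0) \<in> L"
      unfolding L_def osc_lattice_def by (auto intro!: exI[of _ 0])
    have "osc_mult h (0, 0, 0, 0) = h"
      by (cases h) simp
    then have "h \<in> h <#\<^bsub>oscillator\<^esub> L"
      using one unfolding l_coset_def oscillator_def by force
    then have "h \<in> g <#\<^bsub>oscillator\<^esub> L"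
      using eq by simp
    then obtain l where l: "l \<in> L" "h = osc_mult g l"
      unfolding l_coset_def oscillator_def by auto
    obtain t x y z where g': "g = (t, x, y, z)" by (cases g)
    obtain m a b c where l': "l = (\<theta> * of_int m, of_int a, of_int b, of_int c / (2 * real k))"
      using l(1) by (auto simp: L_def osc_lattice_def)
    obtain t' x' y' z' where h': "h = (t', x', y', z')" by (cases h)
    define u v where uv: "u = of_int a * cos t + of_int b * sin t"
      "v = - of_int a * sin t + of_int b * cos t"
    have hg: "t' = t + \<theta> * of_int m" "x' = x + u" "y' = y + v"
      "z' = z + of_int c / (2 * real k) + 1/2 * (x * v - u * y)"
      using l(2) by (simp_all add: g' h' l' Let_def uv)
    have "dist g h < 2 * e"
      using g h dist_triangle[of g h p] by (auto simp: dist_commute)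
    moreover have "dist t t' \<le> dist g h" "dist x x' \<le> dist g h" "dist y y' \<le> dist g h"
      "dist z z' \<le> dist g h"
      using dist_fst_le[of g h] dist_snd_le[of g h]
        dist_fst_le[of "snd g" "snd h"] dist_snd_le[of "snd g" "snd h"]
        dist_fst_le[of "snd (snd g)" "snd (snd h)"] dist_snd_le[of "snd (snd g)" "snd (snd h)"]
      unfolding g' h' by simp_all
    ultimately have d: "\<bar>t' - t\<bar> < 2 * e" "\<bar>x' - x\<bar> < 2 * e" "\<bar>y' - y\<bar> < 2 * e" "\<bar>z' - z\<bar> < 2 * e"
      by (simp_all add: dist_real_def abs_minus_commute)
    have "\<theta> * \<bar>of_int m\<bar> < 2 * e"
      using d(1) \<theta> by (simp add: hg abs_mult)
    also note \<open>2 * e \<le> \<theta>\<close>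
    finally have "\<bar>real_of_int m\<bar> < 1"
      using \<theta> by simp
    then have m: "m = 0"
      by linarith
    have "u\<^sup>2 < (1/2)\<^sup>2" "v\<^sup>2 < (1/2)\<^sup>2"
      using d(2,3) e' by (intro power2_strict_mono; simp add: hg)+
    moreover have "u\<^sup>2 + v\<^sup>2 = (of_int a)\<^sup>2 + (of_int b)\<^sup>2"
      using sin_cos_squared_add3[of t] unfolding uv by algebra
    ultimately have "real_of_int (a\<^sup>2 + b\<^sup>2) < 1"
      by (simp add: power2_eq_square)
    then have "a\<^sup>2 + b\<^sup>2 < 1"
      by linarith
    then have "a\<^sup>2 + b\<^sup>2 = 0"
      using zero_le_power2[of a] zero_le_power2[of b] by linarith
    then have ab: "a = 0" "b = 0"
      by (simp_all add: sum_power2_eq_zero_iff)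
    then have "u = 0" "v = 0"
      by (simp_all add: uv)
    moreover from this have "\<bar>of_int c\<bar> / (2 * real k) < 1 / (2 * real k)"
      using d(4) e(3) by (simp add: hg)
    then have "\<bar>real_of_int c\<bar> < 1"
      using k by (simp add: divide_less_cancel)
    then have "c = 0"
      by linarith
    ultimately show "g = h"
      using m by (simp add: g' h' hg)
  qed
  then show ?thesis
    using e(1) by (auto simp: osc_quotient_def L_def intro!: exI[of _ "ball p e"])
qed

end

theory Submission
  imports Defs
begin

text \<open>
  Rotating the \<open>(x, y)\<close>-plane by the angle \<open>t\<close> gives coordinates \<open>(t, X, Y, z)\<close> in which the forms \<open>dt\<close>, \<open>dX\<close>, \<open>dY\<close>
  and \<open>\<zeta> = dz + (X dY - Y dX) / 2\<close> are invariant under \<open>\<Lambda>\<^sub>k\<^sub>,\<^sub>0\<close>, and \<open>d\<zeta> = dX \<and> dY\<close> is the only nonzero differential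
  among them. A closed invariant form is modified by exact ones until its coefficients with respect to this coframe are
  constant: homotopy operators replace the coefficients by their averages along the central direction and along \<open>t\<close>,
  and what remains is a problem on the torus with coordinates \<open>X, Y\<close>. So the invariant coframe generates a
  quasi-isomorphic subalgebra, which is the minimal model of the nilmanifold \<open>M\<^sub>k\<^sub>,\<^sub>0\<close>. The other two manifolds are
  quotients of \<open>M\<^sub>k\<^sub>,\<^sub>0\<close> by translations in \<open>t\<close>, which rotate \<open>dX, dY\<close> by a half or a quarter turn; averaging over them
  leaves the classes of \<open>1\<close>, \<open>dt\<close>, \<open>dX dY \<zeta>\<close> and the volume form.
\<close>

section \<open>Smooth functions\<close>

text \<open>The lattice shift of \<open>X\<close> by 1 also moves \<open>z\<close> by
  \<open>- Y/2\<close>, and the frame vectors dual to \<open>dX\<close> and \<open>dY\<close> have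
  the \<open>z\<close>-components \<open>Y/2\<close> and \<open>- X/2\<close>; translations in
  \<open>X\<close> and \<open>Y\<close> are compatible with neither. Translations in
  \<open>z\<close> and in \<open>t\<close> are compatible with both. Once the coefficients no longer
  depend on \<open>z\<close>, the twist is invisible and ordinary means on a flat torus can be
  taken. On the torus the single nonzero differential acts twice. A closed form has at \<zeta> a
  coefficient that is constant and also a sum of derivatives, hence zero; conversely constant
  multiples of \<open>dX \<and> dY\<close> are differentials of multiples of \<zeta>. The same holds
  after multiplication by \<open>dt\<close>. Of the sixteen constant monomials twelve remain, in
  numbers 1, 3, 4, 3, 1 by degree. The quotient of order four is reached by two averages of order
  two. The half turn already removes all classes that are going to disappear, and the quarter turn
  only has to fix the remaining ones.\<close>

abbreviation smooth :: "('e::real_normed_vector \<Rightarrow> real) \<Rightarrow> bool"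
  where "smooth f \<equiv> smooth_fun_on UNIV f"

definition dird :: "'e::real_normed_vector \<Rightarrow> ('e \<Rightarrow> real) \<Rightarrow> 'e \<Rightarrow> real"
  where "dird v f = (\<lambda>p. frechet_derivative f (at p) v)"

lemma dird_eqI: "(\<And>p. (f has_derivative f' p) (at p)) \<Longrightarrow> dird v f = (\<lambda>p. f' p v)"
  unfolding dird_def by (metis frechet_derivative_at)

lemma has_derivative_dird:
  "f differentiable at p \<Longrightarrow> (f has_derivative (\<lambda>v. dird v f p)) (at p)"
  using frechet_derivative_works unfolding dird_def by (metis (mono_tags, lifting) eta_contract_eq)

lemma Ck_on_Suc_UNIV:
  "Ck_on (Suc k) UNIV f \<longleftrightarrow> (\<forall>p. f differentiable at p) \<and> (\<forall>v. Ck_on k UNIV (dird v f))"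
  by (simp add: dird_def)

lemma Ck_on_SucD: "Ck_on (Suc k) U f \<Longrightarrow> Ck_on k U f"
proof (induction k arbitrary: f)
  case 0
  then show ?case
    by (simp add: differentiable_at_withinI differentiable_imp_continuous_on differentiable_on_def)
next
  case (Suc k)
  have "\<forall>p\<in>U. f differentiable (at p)" "Ck_on (Suc k) U (\<lambda>p. frechet_derivative f (at p) v)" for v
    using Suc.prems unfolding Ck_on.simps(2)[of "Suc k"] by blast+
  then show ?case using Suc.IH unfolding Ck_on.simps(2)[of k] by blast
qed

lemma Ck_on_cong:
  assumes "open U" "\<And>p. p \<in> U \<Longrightarrow> f p = g p" "Ck_on k U f"
  shows "Ck_on k U g"
  using assms(2,3)
proof (induction k arbitrary: f g)
  case 0
  then show ?case by (auto cong: continuous_on_cong)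
next
  case (Suc k)
  have d: "g differentiable (at p)" "frechet_derivative f (at p) = frechet_derivative g (at p)"
    if p: "p \<in> U" for p
  proof -
    have f: "f differentiable (at p)"
      using Suc.prems p by simp
    then show "frechet_derivative f (at p) = frechet_derivative g (at p)"
      using frechet_derivative_transform_within_open assms(1) p Suc.prems(1) by blast
    show "g differentiable (at p)"
      using f has_derivative_transform_within_open[OF _ assms(1) p] Suc.prems(1)
      unfolding differentiable_def by blast
  qed
  have "Ck_on k U (\<lambda>p. frechet_derivative g (at p) v)" for v
    by (rule Suc.IH[where f = "\<lambda>p. frechet_derivative f (at p) v"]) (use d Suc.prems in auto)
  then show ?case
    using d by simp
qed

lemma Ck_on_subset: "Ck_on k U f \<Longrightarrow> V \<subseteq> U \<Longrightarrow> Ck_on k V f"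
  by (induction k arbitrary: f) (auto intro: continuous_on_subset)

lemma Ck_on_local:
  assumes "\<And>p. \<exists>U. open U \<and> p \<in> U \<and> Ck_on k U f"
  shows "Ck_on k UNIV f"
  using assms
proof (induction k arbitrary: f)
  case 0
  have "continuous (at p) f" for p
    using 0[of p] by (auto simp: continuous_on_eq_continuous_at)
  then show ?case
    by (simp add: continuous_on_eq_continuous_at)
next
  case (Suc k)
  have "\<exists>U. open U \<and> p \<in> U \<and> Ck_on k U (\<lambda>p. frechet_derivative f (at p) v)" for v p
    using Suc.prems[of p] by auto
  moreover have "f differentiable at p" for p
    using Suc.prems[of p] by auto
  ultimately show ?case
    using Suc.IH by simp
qed

lemma smooth_fun_on_cong:
  "open U \<Longrightarrow> (\<And>p. p \<in> U \<Longrightarrow> f p = g p) \<Longrightarrow> smooth_fun_on U f \<Longrightarrow> smooth_fun_on U g"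
  unfolding smooth_fun_on_def using Ck_on_cong by blast

lemma smooth_fun_on_subset: "smooth_fun_on U f \<Longrightarrow> V \<subseteq> U \<Longrightarrow> smooth_fun_on V f"
  unfolding smooth_fun_on_def using Ck_on_subset by blast

text \<open>A form on the quotient is known only chart by chart; this glues its local expressions to
  a smooth object on all of the group.\<close>

lemma smooth_local:
  assumes "\<And>p. \<exists>U. open U \<and> p \<in> U \<and> smooth_fun_on U f"
  shows "smooth f"
  unfolding smooth_fun_on_def
  by (intro allI Ck_on_local) (metis assms smooth_fun_on_def)

lemma smooth_differentiable: "smooth f \<Longrightarrow> f differentiable at p"
  unfolding smooth_fun_on_def by (metis Ck_on.simps(2) UNIV_I)

lemma smooth_has_derivative: "smooth f \<Longrightarrow> (f has_derivative (\<lambda>v. dird v f p)) (at p)"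
  by (simp add: has_derivative_dird smooth_differentiable)

lemma smooth_dird [intro]: "smooth f \<Longrightarrow> smooth (dird v f)"
  unfolding smooth_fun_on_def by (metis Ck_on_Suc_UNIV)

lemma smooth_continuous: "smooth f \<Longrightarrow> continuous_on S f"
  unfolding smooth_fun_on_def by (metis Ck_on.simps(1) continuous_on_subset subset_UNIV)

lemma linear_dird: "smooth f \<Longrightarrow> linear (\<lambda>v. dird v f p)"
  using smooth_has_derivative has_derivative_linear by blast

lemma dird_const [simp]: "dird v (\<lambda>_. c) = (\<lambda>_. 0)"
  by (rule dird_eqI[where f' = "\<lambda>_ _. 0"]) simp

lemma Ck_on_const [simp]: "Ck_on k UNIV (\<lambda>_. c)"
  by (induction k arbitrary: c) (auto simp: Ck_on_Suc_UNIV simp del: Ck_on.simps(2))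

lemma smooth_const [simp]: "smooth (\<lambda>_. c)"
  by (simp add: smooth_fun_on_def)

lemma dird_linear: "bounded_linear f \<Longrightarrow> dird v f = (\<lambda>_. f v)"
  using dird_eqI[of f "\<lambda>_. f"] bounded_linear_imp_has_derivative by blast

lemma smooth_linear:
  assumes "bounded_linear f"
  shows "smooth f"
  unfolding smooth_fun_on_def
proof
  show "Ck_on k UNIV f" for k
    using assms by (cases k)
      (auto simp: Ck_on_Suc_UNIV dird_linear bounded_linear_imp_differentiable
        linear_continuous_on simp del: Ck_on.simps(2))
qed

lemma dird_add:
  "f differentiable at p \<Longrightarrow> g differentiable at p \<Longrightarrow>
    dird v (\<lambda>p. f p + g p) p = dird v f p + dird v g p"
proof -
  assume "f differentiable at p" "g differentiable at p"
  then have "((\<lambda>p. f p + g p) has_derivative (\<lambda>h. dird h f p + dird h g p)) (at p)"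
    by (intro has_derivative_add has_derivative_dird)
  from frechet_derivative_at[OF this] show ?thesis
    unfolding dird_def by metis
qed

lemma dird_mult:
  assumes "f differentiable at p" "g differentiable at p"
  shows "dird v (\<lambda>p. f p * g p) p = f p * dird v g p + dird v f p * g p"
proof -
  have "((\<lambda>p. f p * g p) has_derivative (\<lambda>h. f p * dird h g p + dird h f p * g p)) (at p)"
    using assms by (intro has_derivative_mult has_derivative_dird)
  from frechet_derivative_at[OF this] show ?thesis
    unfolding dird_def by metis
qed

lemma Ck_on_add: "Ck_on k UNIV f \<Longrightarrow> Ck_on k UNIV g \<Longrightarrow> Ck_on k UNIV (\<lambda>p. f p + g p)"
proof (induction k arbitrary: f g)
  case 0
  then show ?case by (simp add: continuous_on_add)
next
  case (Suc k)
  then have "dird v (\<lambda>p. f p + g p) = (\<lambda>p. dird v f p + dird v g p)" for v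
    by (intro ext dird_add) auto
  then show ?case
    using Suc unfolding Ck_on_Suc_UNIV by auto
qed

lemma Ck_on_mult: "Ck_on k UNIV f \<Longrightarrow> Ck_on k UNIV g \<Longrightarrow> Ck_on k UNIV (\<lambda>p. f p * g p)"
proof (induction k arbitrary: f g)
  case 0
  then show ?case by (simp add: continuous_on_mult)
next
  case (Suc k)
  then have "dird v (\<lambda>p. f p * g p) = (\<lambda>p. f p * dird v g p + dird v f p * g p)" for v
    by (intro ext dird_mult) auto
  moreover have "Ck_on k UNIV f" "Ck_on k UNIV g"
    using Suc.prems Ck_on_SucD by blast+
  ultimately show ?case
    using Suc unfolding Ck_on_Suc_UNIV by (auto intro!: Ck_on_add)
qed

lemma smooth_add: "smooth f \<Longrightarrow> smooth g \<Longrightarrow> smooth (\<lambda>p. f p + g p)"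
  by (simp add: smooth_fun_on_def Ck_on_add)

lemma smooth_mult: "smooth f \<Longrightarrow> smooth g \<Longrightarrow> smooth (\<lambda>p. f p * g p)"
  by (simp add: smooth_fun_on_def Ck_on_mult)

lemma smooth_cmult: "smooth f \<Longrightarrow> smooth (\<lambda>p. c * f p)"
  by (intro smooth_mult smooth_const)

lemma smooth_minus: "smooth f \<Longrightarrow> smooth (\<lambda>p. - f p)"
  using smooth_cmult[of f "-1"] by simp

lemma smooth_diff: "smooth f \<Longrightarrow> smooth g \<Longrightarrow> smooth (\<lambda>p. f p - g p)"
  using smooth_add[of f "\<lambda>p. - g p"] smooth_minus[of g] by simp

lemma smooth_sum: "(\<And>i. i \<in> A \<Longrightarrow> smooth (f i)) \<Longrightarrow> smooth (\<lambda>p. \<Sum>i\<in>A. f i p)"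
  by (induction A rule: infinite_finite_induct) (auto intro: smooth_add)

lemma smooth_divide: "smooth f \<Longrightarrow> smooth (\<lambda>p. f p / c)"
  using smooth_cmult[of f "1 / c"] by simp

lemmas smooth_intros =
  smooth_const smooth_add smooth_mult smooth_minus smooth_diff smooth_sum smooth_divide smooth_dird

lemma dird_smooth_add:
  "smooth f \<Longrightarrow> smooth g \<Longrightarrow> dird v (\<lambda>p. f p + g p) = (\<lambda>p. dird v f p + dird v g p)"
  by (intro ext dird_add smooth_differentiable)

lemma dird_smooth_mult:
  "smooth f \<Longrightarrow> smooth g \<Longrightarrow>
    dird v (\<lambda>p. f p * g p) = (\<lambda>p. f p * dird v g p + dird v f p * g p)"
  by (intro ext dird_mult smooth_differentiable)

lemma dird_cmult: "smooth f \<Longrightarrow> dird v (\<lambda>p. c * f p) = (\<lambda>p. c * dird v f p)"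
  by (simp add: dird_smooth_mult)

lemma dird_minus: "smooth f \<Longrightarrow> dird v (\<lambda>p. - f p) = (\<lambda>p. - dird v f p)"
  using dird_cmult[of f v "-1"] by simp

lemma dird_smooth_diff:
  "smooth f \<Longrightarrow> smooth g \<Longrightarrow> dird v (\<lambda>p. f p - g p) = (\<lambda>p. dird v f p - dird v g p)"
  using dird_smooth_add[of f "\<lambda>p. - g p"] by (simp add: dird_minus smooth_minus)

lemma Ck_on_sin_cos:
  "Ck_on k UNIV f \<Longrightarrow> Ck_on k UNIV (\<lambda>p. sin (f p)) \<and> Ck_on k UNIV (\<lambda>p. cos (f p))"
proof (induction k arbitrary: f)
  case 0
  then show ?case by (auto intro: continuous_intros)
next
  case (Suc k)
  have f: "f differentiable at p" for p
    using Suc.prems by simp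
  have s: "((\<lambda>p. sin (f p)) has_derivative (\<lambda>v. dird v f p * cos (f p))) (at p)" for p
    using has_derivative_sin[OF has_derivative_dird[OF f]] by simp
  have c: "((\<lambda>p. cos (f p)) has_derivative (\<lambda>v. dird v f p * - sin (f p))) (at p)" for p
    using has_derivative_cos[OF has_derivative_dird[OF f]] by simp
  have "Ck_on k UNIV f"
    using Suc.prems Ck_on_SucD by blast
  moreover from this Suc.IH have "Ck_on k UNIV (\<lambda>p. - 1 * sin (f p))"
    by (intro Ck_on_mult) (auto simp del: mult_minus1)
  then have "Ck_on k UNIV (\<lambda>p. - sin (f p))"
    by simp
  ultimately have "Ck_on k UNIV (\<lambda>p. dird v f p * cos (f p))"
    "Ck_on k UNIV (\<lambda>p. dird v f p * - sin (f p))" for v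
    using Suc unfolding Ck_on_Suc_UNIV by (intro Ck_on_mult; blast)+
  then show ?case
    unfolding Ck_on_Suc_UNIV dird_eqI[OF s] dird_eqI[OF c]
    using differentiableI[OF s] differentiableI[OF c] by blast
qed

lemma smooth_sin: "smooth f \<Longrightarrow> smooth (\<lambda>p. sin (f p))"
  and smooth_cos: "smooth f \<Longrightarrow> smooth (\<lambda>p. cos (f p))"
  by (simp_all add: smooth_fun_on_def Ck_on_sin_cos)

section \<open>Composition with smooth maps into four-dimensional space\<close>

lemma real4_decompose:
  fixes f :: "real4 \<Rightarrow> real"
  assumes "linear f"
  shows "f (a, b, c, d) =
    a * f (1, 0, 0, 0) + b * f (0, 1, 0, 0) + c * f (0, 0, 1, 0) + d * f (0, 0, 0, 1)"
proof -
  have "(a, b, c, d) = a *\<^sub>R (1, 0, 0, 0) + b *\<^sub>R (0, 1, 0, 0) + c *\<^sub>R (0, 0, 1, 0)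
      + d *\<^sub>R (0, 0, 0, 1 :: real)"
    by simp
  then show ?thesis
    unfolding \<open>(a, b, c, d) = _\<close> by (simp only: linear_add[OF assms] linear_scale[OF assms]
      real_scaleR_def)
qed

lemma dird_compose:
  fixes f :: "real4 \<Rightarrow> real"
  assumes "\<And>q. f differentiable at q" "\<And>p. a differentiable at p" "\<And>p. b differentiable at p"
    "\<And>p. c differentiable at p" "\<And>p. d differentiable at p"
  shows "((\<lambda>p. f (a p, b p, c p, d p)) has_derivative (\<lambda>v.
    dird v a p * dird (1, 0, 0, 0) f (a p, b p, c p, d p) +
    dird v b p * dird (0, 1, 0, 0) f (a p, b p, c p, d p) +
    dird v c p * dird (0, 0, 1, 0) f (a p, b p, c p, d p) +
    dird v d p * dird (0, 0, 0, 1) f (a p, b p, c p, d p))) (at p)"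
proof -
  have "((\<lambda>p. (a p, b p, c p, d p)) has_derivative
      (\<lambda>v. (dird v a p, dird v b p, dird v c p, dird v d p))) (at p)"
    using assms by (intro has_derivative_Pair has_derivative_dird)
  from has_derivative_compose[OF this has_derivative_dird[OF assms(1)]]
  show ?thesis
    by (rule has_derivative_eq_rhs)
      (rule ext, rule real4_decompose[OF has_derivative_linear[OF has_derivative_dird[OF assms(1)]]])
qed

text \<open>The induction is on the order of \<open>f\<close> only. The chain rule turns a
  derivative of the composite into products of derivatives of the inner functions with composites of
  partial derivatives of \<open>f\<close>, so the inner functions have every order from the
  start.\<close>

lemma Ck_on_compose:
  fixes f :: "real4 \<Rightarrow> real"
  assumes "Ck_on k UNIV f" "\<And>k. Ck_on k UNIV a" "\<And>k. Ck_on k UNIV b" "\<And>k. Ck_on k UNIV c"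
    "\<And>k. Ck_on k UNIV d"
  shows "Ck_on k UNIV (\<lambda>p. f (a p, b p, c p, d p))"
  using assms(1)
proof (induction k arbitrary: f)
  case 0
  then show ?case
    using assms(2-)[of 0] by (auto intro!: continuous_intros continuous_on_compose2[of UNIV f])
next
  case (Suc k)
  have diff: "a differentiable at p" "b differentiable at p" "c differentiable at p"
    "d differentiable at p" for p
    using assms(2-)[of "Suc 0"] by auto
  have d: "((\<lambda>p. f (a p, b p, c p, d p)) has_derivative (\<lambda>v.
    dird v a p * dird (1, 0, 0, 0) f (a p, b p, c p, d p) +
    dird v b p * dird (0, 1, 0, 0) f (a p, b p, c p, d p) +
    dird v c p * dird (0, 0, 1, 0) f (a p, b p, c p, d p) +
    dird v d p * dird (0, 0, 0, 1) f (a p, b p, c p, d p))) (at p)" for p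
    using Suc.prems diff by (intro dird_compose) auto
  have "Ck_on k UNIV (dird v a)" "Ck_on k UNIV (dird v b)" "Ck_on k UNIV (dird v c)"
    "Ck_on k UNIV (dird v d)" for v
    using assms(2-)[of "Suc k"] unfolding Ck_on_Suc_UNIV by auto
  then show ?case
    using Suc d unfolding Ck_on_Suc_UNIV dird_eqI[OF d]
    by (auto intro!: differentiableI[OF d] Ck_on_add Ck_on_mult)
qed

lemma smooth_compose:
  fixes f :: "real4 \<Rightarrow> real"
  assumes "smooth f" "smooth a" "smooth b" "smooth c" "smooth d"
  shows "smooth (\<lambda>p. f (a p, b p, c p, d p))"
  using assms by (simp add: smooth_fun_on_def Ck_on_compose)

lemma smooth_compose_translation:
  fixes f :: "'e::real_normed_vector \<Rightarrow> real"
  shows "smooth f \<Longrightarrow> smooth (\<lambda>p. f (p + e))"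
    and "smooth f \<Longrightarrow> dird v (\<lambda>p. f (p + e)) = (\<lambda>p. dird v f (p + e))"
proof -
  have d: "((\<lambda>p. f (p + e)) has_derivative (\<lambda>v. dird v f (p + e))) (at p)"
    if "\<And>p. f differentiable at p" for f :: "'e \<Rightarrow> real" and p
  proof -
    have "((\<lambda>p. p + e) has_derivative (\<lambda>v. v)) (at p)"
      by (auto intro!: derivative_eq_intros)
    from has_derivative_compose[OF this has_derivative_dird[OF that]] show ?thesis .
  qed
  show "smooth f \<Longrightarrow> dird v (\<lambda>p. f (p + e)) = (\<lambda>p. dird v f (p + e))"
    using dird_eqI[OF d] smooth_differentiable by blast
  have "Ck_on k UNIV f \<Longrightarrow> Ck_on k UNIV (\<lambda>p. f (p + e))" for k f
  proof (induction k arbitrary: f)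
    case 0
    then show ?case
      by (auto intro!: continuous_intros continuous_on_compose2[of UNIV f])
  next
    case (Suc k)
    then have f: "\<And>p. f differentiable at p" by simp
    have "(\<lambda>p. f (p + e)) differentiable at p" for p
      by (rule differentiableI[OF d[OF f]])
    then show ?case
      using Suc unfolding Ck_on_Suc_UNIV dird_eqI[OF d[OF f]] by blast
  qed
  then show "smooth f \<Longrightarrow> smooth (\<lambda>p. f (p + e))"
    by (simp add: smooth_fun_on_def)
qed

section \<open>Averages along a direction\<close>

text \<open>One weighted line integral serves two operators: weight 1 gives the mean over a period,
  and weight \<open>s\<close>, scaled by the period, gives for periodic \<open>f\<close> a periodic
  primitive of \<open>f\<close> minus its mean.\<close>

definition pint :: "(real \<Rightarrow> real) \<Rightarrow> 'e \<Rightarrow> ('e::euclidean_space \<Rightarrow> real) \<Rightarrow> 'e \<Rightarrow> real"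
  where "pint g e f q = integral {0..1} (\<lambda>s. g s * f (q + s *\<^sub>R e))"

lemma dird_Basis_sum:
  fixes f :: "'e::euclidean_space \<Rightarrow> real"
  assumes "smooth f"
  shows "dird v f p = (\<Sum>i\<in>Basis. (v \<bullet> i) * dird i f p)"
proof -
  have "dird v f p = dird (\<Sum>i\<in>Basis. (v \<bullet> i) *\<^sub>R i) f p"
    by (simp add: euclidean_representation)
  also have "\<dots> = (\<Sum>i\<in>Basis. (v \<bullet> i) * dird i f p)"
    by (simp only: linear_sum[OF linear_dird[OF assms]] linear_scale[OF linear_dird[OF assms]]
        real_scaleR_def)
  finally show ?thesis .
qed

lemma pint_integrable:
  fixes f :: "'e::euclidean_space \<Rightarrow> real"
  assumes "smooth f" "continuous_on {0..1} g"
  shows "(\<lambda>s. g s * f (q + s *\<^sub>R e)) integrable_on {0..1}"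
  using assms smooth_continuous[OF assms(1), of UNIV]
  by (intro integrable_continuous_interval)
    (auto intro!: continuous_intros continuous_on_compose2[of UNIV f])

lemma pint_has_derivative:
  fixes f :: "'e::euclidean_space \<Rightarrow> real"
  assumes f: "smooth f" and g: "continuous_on {0..1} g"
  shows "(pint g e f has_derivative (\<lambda>v. pint g e (dird v f) q)) (at q)"
proof -
  \<comment> \<open>The Leibniz rule asks for the derivative as a continuous family of bounded
    operators, so it is assembled from the partial derivatives along \<open>Basis\<close>.\<close>
  define D where "D q = (\<Sum>i\<in>Basis. dird i f q *\<^sub>R blinfun_inner_left i)" for q
  have D: "blinfun_apply (D q) v = dird v f q" for q v
    unfolding D_def dird_Basis_sum[OF f, of v]
    by (simp add: blinfun.sum_left blinfun.scaleR_left mult.commute inner_commute)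
  have cD: "continuous_on UNIV D"
    unfolding D_def using smooth_continuous[OF smooth_dird[OF f]] by (intro continuous_intros)
  let ?D = "\<lambda>q s. g s *\<^sub>R D (q + s *\<^sub>R e)"
  have "((\<lambda>q. integral (cbox 0 1) (\<lambda>s. g s * f (q + s *\<^sub>R e))) has_derivative
      blinfun_apply (integral (cbox 0 1) (?D q))) (at q within UNIV)"
  proof (rule leibniz_rule)
    show "((\<lambda>q. g s * f (q + s *\<^sub>R e)) has_derivative blinfun_apply (?D q s)) (at q within UNIV)"
      for q s
    proof -
      have "((\<lambda>q. q + s *\<^sub>R e) has_derivative (\<lambda>v. v)) (at q)"
        by (auto intro!: derivative_eq_intros)
      from has_derivative_compose[OF this smooth_has_derivative[OF f]]
      have "((\<lambda>q. g s * f (q + s *\<^sub>R e)) has_derivative (\<lambda>v. g s * dird v f (q + s *\<^sub>R e))) (at q)"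
        by (intro has_derivative_mult_right)
      moreover have "blinfun_apply (?D q s) = (\<lambda>v. g s * dird v f (q + s *\<^sub>R e))"
        by (simp add: fun_eq_iff blinfun.scaleR_left D)
      ultimately show ?thesis by simp
    qed
    show "(\<lambda>s. g s * f (q + s *\<^sub>R e)) integrable_on cbox 0 1" for q
      using pint_integrable[OF f g] by simp
    have "continuous_on (UNIV \<times> {0..1}) (\<lambda>x. ?D (fst x) (snd x))"
      by (intro continuous_intros continuous_on_compose2[OF cD] continuous_on_compose2[OF g]) auto
    then show "continuous_on (UNIV \<times> cbox 0 1) (\<lambda>(q, s). ?D q s)"
      by (simp add: split_beta)
  qed auto
  moreover have "?D q integrable_on cbox 0 1"
    by (intro integrable_continuous continuous_intros continuous_on_compose2[OF cD] continuous_on_compose2[OF g]) auto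
  then have "blinfun_apply (integral (cbox 0 1) (?D q)) = (\<lambda>v. pint g e (dird v f) q)"
    by (intro ext, subst blinfun_apply_integral) (auto simp: pint_def blinfun.scaleR_left D)
  ultimately show ?thesis
    unfolding pint_def[abs_def] by simp
qed

context
  fixes g :: "real \<Rightarrow> real" and e :: "'e::euclidean_space"
  assumes g: "continuous_on {0..1} g"
begin

lemma dird_pint: "smooth f \<Longrightarrow> dird v (pint g e f) = pint g e (dird v f)"
  by (simp add: dird_eqI[OF pint_has_derivative[OF _ g]] fun_eq_iff)

lemma smooth_pint: 
  assumes "smooth f"
  shows "smooth (pint g e f)"
proof -
  have "Ck_on k UNIV (pint g e f)" if "smooth f" for k and f :: "'e \<Rightarrow> real"
    using that
  proof (induction k arbitrary: f)
    case 0
    then have "pint g e f differentiable at q" for q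
      by (rule differentiableI[OF pint_has_derivative[OF _ g]])
    then show ?case
      by (simp add: differentiable_imp_continuous_on differentiable_on_def)
  next
    case (Suc k)
    have "pint g e f differentiable at q" for q
      by (rule differentiableI[OF pint_has_derivative[OF Suc.prems g]])
    then show ?case
      unfolding Ck_on_Suc_UNIV dird_pint[OF Suc.prems] using Suc by blast
  qed
  with assms show ?thesis
    unfolding smooth_fun_on_def by blast
qed

lemma pint_add:
  "smooth f \<Longrightarrow> smooth h \<Longrightarrow> pint g e (\<lambda>q. f q + h q) = (\<lambda>q. pint g e f q + pint g e h q)"
  unfolding pint_def
  by (subst integral_add[symmetric]) (auto intro: pint_integrable[OF _ g] simp: algebra_simps)

end

lemma pint_mult:
  "(\<And>s. h (q + s *\<^sub>R e) = h q) \<Longrightarrow> pint g e (\<lambda>q. h q * f q) q = h q * pint g e f q"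
proof -
  assume "\<And>s. h (q + s *\<^sub>R e) = h q"
  then have "(\<lambda>s. g s * (h (q + s *\<^sub>R e) * f (q + s *\<^sub>R e))) = (\<lambda>s. h q * (g s * f (q + s *\<^sub>R e)))"
    by (simp add: fun_eq_iff)
  then show ?thesis
    unfolding pint_def by simp
qed

lemma pint_cmult: "pint g e (\<lambda>q. c * f q) = (\<lambda>q. c * pint g e f q)"
  by (rule ext, rule pint_mult) simp

lemma pint_zero [simp]: "pint g e (\<lambda>q. 0) = (\<lambda>q. 0)"
  by (simp add: pint_def fun_eq_iff)

lemma pint_sum:
  "continuous_on {0..1} g \<Longrightarrow> (\<And>i. i \<in> A \<Longrightarrow> smooth (f i)) \<Longrightarrow>
    pint g e (\<lambda>q. \<Sum>i\<in>A. f i q) = (\<lambda>q. \<Sum>i\<in>A. pint g e (f i) q)"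
  by (induction A rule: infinite_finite_induct) (auto simp: pint_add smooth_sum)

text \<open>The reason why averaging preserves invariance under every transformation that commutes
  with the translations averaged over.\<close>

lemma pint_commute_map:
  assumes "\<And>q s. T (q + s *\<^sub>R e) = T q + s *\<^sub>R e" "\<And>q. f (T q) = f q"
  shows "pint g e f (T q) = pint g e f q"
  unfolding pint_def by (simp add: assms flip: assms(1))

lemma pint_invariant: "(\<And>s. f (q + s *\<^sub>R e) = f q) \<Longrightarrow> pint (\<lambda>_. 1) e f q = f q"
  by (simp add: pint_def)

lemma has_vector_derivative_line:
  assumes "smooth f"
  shows "((\<lambda>s. f (q + s *\<^sub>R e)) has_vector_derivative dird e f (q + s *\<^sub>R e)) (at s within S)"
proof -
  have "((\<lambda>s. q + s *\<^sub>R e) has_derivative (\<lambda>s. s *\<^sub>R e)) (at s within S)"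
    by (auto intro!: derivative_eq_intros)
  from has_derivative_compose[OF this smooth_has_derivative[OF assms]]
  show ?thesis
    unfolding has_vector_derivative_def
    by (simp add: linear_scale[OF linear_dird[OF assms]])
qed

lemma pint_one_dird:
  assumes "smooth f"
  shows "pint (\<lambda>_. 1) e (dird e f) q = f (q + e) - f q"
proof -
  have "((\<lambda>s. dird e f (q + s *\<^sub>R e)) has_integral f (q + 1 *\<^sub>R e) - f (q + 0 *\<^sub>R e)) {0..1}"
    by (intro fundamental_theorem_of_calculus has_vector_derivative_line assms) simp
  then show ?thesis
    by (simp add: pint_def integral_unique)
qed

text \<open>Integration by parts: the boundary term of \<open>s * f\<close> is present only at
  \<open>s = 1\<close>, and the derivative of the weight produces the mean.\<close>

lemma pint_id_dird:
  assumes f: "smooth f"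
  shows "pint (\<lambda>s. s) e (dird e f) q = f (q + e) - pint (\<lambda>_. 1) e f q"
proof -
  have "((\<lambda>s. s * f (q + s *\<^sub>R e)) has_vector_derivative
      s * dird e f (q + s *\<^sub>R e) + 1 * f (q + s *\<^sub>R e)) (at s within {0..1})" for s
    by (intro has_vector_derivative_mult has_vector_derivative_line f has_vector_derivative_id)
  then have "((\<lambda>s. s * dird e f (q + s *\<^sub>R e) + 1 * f (q + s *\<^sub>R e)) has_integral
      1 * f (q + 1 *\<^sub>R e) - 0 * f (q + 0 *\<^sub>R e)) {0..1}"
    by (intro fundamental_theorem_of_calculus) auto
  then have "integral {0..1} (\<lambda>s. s * dird e f (q + s *\<^sub>R e) + 1 * f (q + s *\<^sub>R e)) = f (q + e)"
    by (simp add: integral_unique)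
  moreover have "integral {0..1} (\<lambda>s. s * dird e f (q + s *\<^sub>R e) + 1 * f (q + s *\<^sub>R e)) =
      pint (\<lambda>s. s) e (dird e f) q + pint (\<lambda>_. 1) e f q"
    unfolding pint_def
    by (intro integral_add pint_integrable smooth_dird f continuous_intros)
  ultimately show ?thesis
    by linarith
qed

lemma dird_scale: "smooth f \<Longrightarrow> dird (c *\<^sub>R v) f = (\<lambda>p. c * dird v f p)"
  by (simp add: fun_eq_iff linear_scale[OF linear_dird])

text \<open>The derivative along a multiple of \<open>e\<close> vanishes too, so the fundamental
  theorem over the single segment from \<open>q\<close> to its translate is enough.\<close>

lemma dird_zero_invariant:
  fixes f :: "'e::euclidean_space \<Rightarrow> real"
  assumes "smooth f" "\<And>p. dird e f p = 0"
  shows "f (q + s *\<^sub>R e) = f q"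
proof -
  have "dird (s *\<^sub>R e) f = (\<lambda>_. 0)"
    using assms by (simp add: dird_scale)
  then show ?thesis
    using pint_one_dird[OF assms(1), of "s *\<^sub>R e" q] by simp
qed

lemma invariant_dird_zero:
  assumes "smooth f" "\<And>q s. f (q + s *\<^sub>R e) = f q"
  shows "dird e f = (\<lambda>_. 0)"
proof
  fix q
  have "((\<lambda>s. f (q + s *\<^sub>R e)) has_vector_derivative dird e f (q + 0 *\<^sub>R e)) (at 0)"
    by (intro has_vector_derivative_line assms)
  then have "((\<lambda>s::real. f q) has_vector_derivative dird e f q) (at 0)"
    by (simp add: assms)
  then show "dird e f q = 0"
    using vector_derivative_at has_vector_derivative_const by metis
qed

section \<open>Exterior algebra by contraction\<close>

text \<open>The shuffle sum, unfolded by contraction with the first vector: \<open>i\<^sub>v (\<theta> \<and> \<beta>) = \<theta>(v) \<beta> - \<theta> \<and> i\<^sub>v \<beta>\<close>.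
  In this shape the identities of the exterior algebra follow by induction on the list of arguments.\<close>

fun w1 :: "('v \<Rightarrow> real) \<Rightarrow> ('v list \<Rightarrow> real) \<Rightarrow> 'v list \<Rightarrow> real"
  where
    "w1 \<theta> \<beta> [] = 0"
  | "w1 \<theta> \<beta> (v # vs) = \<theta> v * \<beta> vs - w1 \<theta> (\<lambda>us. \<beta> (v # us)) vs"

lemma w1_add: "w1 \<theta> (\<lambda>vs. \<alpha> vs + \<beta> vs) = (\<lambda>vs. w1 \<theta> \<alpha> vs + w1 \<theta> \<beta> vs)"
proof
  show "w1 \<theta> (\<lambda>vs. \<alpha> vs + \<beta> vs) vs = w1 \<theta> \<alpha> vs + w1 \<theta> \<beta> vs" for vs
    by (induction vs arbitrary: \<alpha> \<beta>) (simp_all add: algebra_simps)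
qed

lemma w1_cmult: "w1 \<theta> (\<lambda>vs. c * \<beta> vs) = (\<lambda>vs. c * w1 \<theta> \<beta> vs)"
proof
  show "w1 \<theta> (\<lambda>vs. c * \<beta> vs) vs = c * w1 \<theta> \<beta> vs" for vs
    by (induction vs arbitrary: \<beta>) (simp_all add: algebra_simps)
qed

lemma w1_minus: "w1 \<theta> (\<lambda>vs. - \<beta> vs) = (\<lambda>vs. - w1 \<theta> \<beta> vs)"
  using w1_cmult[of \<theta> "-1" \<beta>] by simp

lemma w1_diff: "w1 \<theta> (\<lambda>vs. \<alpha> vs - \<beta> vs) = (\<lambda>vs. w1 \<theta> \<alpha> vs - w1 \<theta> \<beta> vs)"
  using w1_add[of \<theta> \<alpha> "\<lambda>vs. - \<beta> vs"] by (simp add: w1_minus)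

lemma w1_zero [simp]: "w1 \<theta> (\<lambda>vs. 0) = (\<lambda>vs. 0)"
  using w1_cmult[of \<theta> 0 "\<lambda>_. 0"] by simp

lemma w1_add_left: "w1 (\<lambda>v. \<theta> v + \<phi> v) \<beta> vs = w1 \<theta> \<beta> vs + w1 \<phi> \<beta> vs"
  by (induction vs arbitrary: \<beta>) (simp_all add: algebra_simps)

lemma w1_cmult_left: "w1 (\<lambda>v. c * \<theta> v) \<beta> vs = c * w1 \<theta> \<beta> vs"
  by (induction vs arbitrary: \<beta>) (simp_all add: algebra_simps)

lemma w1_minus_left: "w1 (\<lambda>v. - \<theta> v) \<beta> vs = - w1 \<theta> \<beta> vs"
  using w1_cmult_left[of "-1" \<theta>] by simp

lemma w1_zero_left [simp]: "w1 (\<lambda>v. 0) \<beta> vs = 0"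
  using w1_cmult_left[of 0 "\<lambda>_. 0"] by simp

text \<open>Contraction with the first vector reduces the claim to the contracted \<beta>; the mixed
  terms, with one factor evaluated at that vector, agree on the two sides.\<close>

lemma w1_anticommute: "w1 \<theta> (w1 \<phi> \<beta>) = (\<lambda>vs. - w1 \<phi> (w1 \<theta> \<beta>) vs)"
proof
  show "w1 \<theta> (w1 \<phi> \<beta>) vs = - w1 \<phi> (w1 \<theta> \<beta>) vs" for vs
  proof (induction vs arbitrary: \<beta>)
    case (Cons v vs)
    show ?case
      by (simp add: w1_diff w1_cmult Cons)
  qed simp
qed

lemma w1_same: "w1 \<theta> (w1 \<theta> \<beta>) = (\<lambda>vs. 0)"
proof
  show "w1 \<theta> (w1 \<theta> \<beta>) vs = 0" for vs
    using w1_anticommute[of \<theta> \<theta> \<beta>] by (simp add: fun_eq_iff)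
qed

lemma w1_vanishes: "(\<And>v. v \<in> set vs \<Longrightarrow> \<theta> v = 0) \<Longrightarrow> w1 \<theta> \<beta> vs = 0"
  by (induction vs arbitrary: \<beta>) simp_all

text \<open>Wedging with a one-form raises the degree by one, which costs one sign. The sign is
  carried by the length of the argument list because \<beta> has no fixed degree.\<close>

lemma w1_sgn:
  "w1 \<theta> (\<lambda>us. (-1) ^ length us * \<beta> us) = (\<lambda>vs. - ((-1) ^ length vs * w1 \<theta> \<beta> vs))"
proof
  show "w1 \<theta> (\<lambda>us. (-1) ^ length us * \<beta> us) vs = - ((-1) ^ length vs * w1 \<theta> \<beta> vs)" for vs
proof (induction vs arbitrary: \<beta>)
  case (Cons v vs)
  have "w1 \<theta> (\<lambda>us. (-1) ^ length us * \<beta> us) (v # vs) = \<theta> v * ((-1) ^ length vs * \<beta> vs)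
      + w1 \<theta> (\<lambda>us. (-1) ^ length us * \<beta> (v # us)) vs"
    by (simp add: w1_minus)
  also have "\<dots> = - ((-1) ^ length (v # vs) * w1 \<theta> \<beta> (v # vs))"
    unfolding Cons by (simp add: algebra_simps)
  finally show ?case .
qed simp
qed

text \<open>\<open>wedge\<close> at a single point, with the chart and the base point stripped
  off.\<close>

definition wdg :: "('v list \<Rightarrow> real) \<Rightarrow> ('v list \<Rightarrow> real) \<Rightarrow> 'v list \<Rightarrow> real"
  where "wdg \<alpha> \<beta> vs =
    (\<Sum>I\<in>Pow {..<length vs}. shuffle_sign (length vs) I * \<alpha> (nths vs I) * \<beta> (nths vs (- I)))"

lemma wdg_Nil [simp]: "wdg \<alpha> \<beta> [] = \<alpha> [] * \<beta> []"
  by (simp add: wdg_def shuffle_sign_def)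

text \<open>Position 0 has nothing before it, so putting it into the front block creates no
  inversion.\<close>

lemma shuffle_sign_insert_0: "shuffle_sign (Suc n) (insert 0 (Suc ` I)) = shuffle_sign n I"
proof -
  have "{(i, j). i \<in> insert 0 (Suc ` I) \<and> j \<in> {..<Suc n} - insert 0 (Suc ` I) \<and> j < i} =
      map_prod Suc Suc ` {(i, j). i \<in> I \<and> j \<in> {..<n} - I \<and> j < i}" (is "?A = ?B")
  proof (intro equalityI subsetI)
    fix x assume "x \<in> ?A"
    then obtain i j where x: "x = (Suc i, Suc j)" "i \<in> I" "j < n" "j \<notin> I" "j < i"
      by (cases x, case_tac a; case_tac b; auto)
    then show "x \<in> ?B" by (auto simp: image_iff)
  qed auto
  then show ?thesis
    by (simp add: shuffle_sign_def card_image inj_on_def)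
qed

text \<open>Position 0 now belongs to the second block, and every position of the first block has to
  be moved past it; this is the extra \<open>card I\<close>.\<close>

lemma shuffle_sign_Suc_image:
  assumes "I \<subseteq> {..<n}"
  shows "shuffle_sign (Suc n) (Suc ` I) = (-1) ^ card I * shuffle_sign n I"
proof -
  let ?C = "{(i, j). i \<in> I \<and> j \<in> {..<n} - I \<and> j < i}"
  have fin: "finite I"
    using assms finite_subset by blast
  have "{(i, j). i \<in> Suc ` I \<and> j \<in> {..<Suc n} - Suc ` I \<and> j < i} =
      (\<lambda>i. (Suc i, 0)) ` I \<union> map_prod Suc Suc ` ?C" (is "?A = ?B")
  proof (intro equalityI subsetI)
    fix x assume "x \<in> ?A"
    then obtain i j where x: "x = (Suc i, j)" "i \<in> I" "j < Suc n" "j \<notin> Suc ` I" "j < Suc i"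
      by auto
    then show "x \<in> ?B" by (cases j) (auto simp: image_iff)
  qed auto
  moreover have "finite ?C"
    by (rule finite_subset[of _ "I \<times> {..<n}"]) (auto simp: fin)
  then have "card ?B = card I + card ?C"
    by (subst card_Un_disjoint) (auto simp: fin card_image inj_on_def)
  ultimately show ?thesis
    by (simp add: shuffle_sign_def power_add)
qed

lemma length_nths_subset: "I \<subseteq> {..<length vs} \<Longrightarrow> length (nths vs I) = card I"
proof -
  assume "I \<subseteq> {..<length vs}"
  then have "{i. i < length vs \<and> i \<in> I} = I" by auto
  then show ?thesis by (simp add: length_nths)
qed

text \<open>Contraction is an antiderivation of the wedge product. The sign from the degree of
  \<alpha> is expressed by the argument length, so that \<alpha> need not be homogeneous.\<close>

lemma wdg_Cons:
  "wdg \<alpha> \<beta> (v # vs) = wdg (\<lambda>us. \<alpha> (v # us)) \<beta> vs +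
    wdg (\<lambda>us. (-1) ^ length us * \<alpha> us) (\<lambda>us. \<beta> (v # us)) vs"
proof -
  let ?n = "length vs"
  let ?f = "\<lambda>I. shuffle_sign (Suc ?n) I * \<alpha> (nths (v # vs) I) * \<beta> (nths (v # vs) (- I))"
  \<comment> \<open>The subsets are split according to whether the first vector is handed to \<beta>
    or to \<alpha>.\<close>
  have P: "Pow {..<Suc ?n} = (`) Suc ` Pow {..<?n} \<union> insert 0 ` (`) Suc ` Pow {..<?n}"
    by (simp add: lessThan_Suc_eq_insert_0 Pow_insert image_Pow_surj[OF refl])
  have inj: "inj_on ((`) Suc) X" for X
    by (rule inj_on_image) (simp add: inj_on_def)
  have inj0: "inj_on (insert 0) ((`) Suc ` X)" for X :: "nat set set"
    by (rule inj_onI) (metis (no_types, lifting) Zero_not_Suc imageE insert_ident)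
  have "wdg \<alpha> \<beta> (v # vs) =
      sum ?f ((`) Suc ` Pow {..<?n}) + sum ?f (insert 0 ` (`) Suc ` Pow {..<?n})"
    unfolding wdg_def length_Cons P by (intro sum.union_disjoint) auto
  also have "sum ?f ((`) Suc ` Pow {..<?n}) = (\<Sum>I\<in>Pow {..<?n}. ?f (Suc ` I))"
    by (simp add: sum.reindex inj)
  also have "\<dots> = wdg (\<lambda>us. (-1) ^ length us * \<alpha> us) (\<lambda>us. \<beta> (v # us)) vs"
    unfolding wdg_def
  proof (rule sum.cong)
    fix I assume I: "I \<in> Pow {..<?n}"
    have "{j. Suc j \<in> Suc ` I} = I" "{j. Suc j \<in> - Suc ` I} = - I"
      by auto
    moreover have "0 \<notin> Suc ` I" "0 \<in> - Suc ` I"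
      by auto
    ultimately show "?f (Suc ` I) = shuffle_sign ?n I * ((-1) ^ length (nths vs I) * \<alpha> (nths vs I)) *
        \<beta> (v # nths vs (- I))"
      using I by (simp add: nths_Cons shuffle_sign_Suc_image length_nths_subset)
  qed simp
  also have "sum ?f (insert 0 ` (`) Suc ` Pow {..<?n}) = (\<Sum>I\<in>Pow {..<?n}. ?f (insert 0 (Suc ` I)))"
    by (simp add: sum.reindex inj inj0)
  also have "\<dots> = wdg (\<lambda>us. \<alpha> (v # us)) \<beta> vs"
    unfolding wdg_def
  proof (rule sum.cong)
    fix I assume I: "I \<in> Pow {..<?n}"
    have "{j. Suc j \<in> insert 0 (Suc ` I)} = I" "{j. Suc j \<in> - insert 0 (Suc ` I)} = - I"
      by auto
    moreover have "0 \<in> insert 0 (Suc ` I)" "0 \<notin> - insert 0 (Suc ` I)"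
      by auto
    ultimately show "?f (insert 0 (Suc ` I)) = shuffle_sign ?n I * \<alpha> (v # nths vs I) *
        \<beta> (nths vs (- I))"
      by (simp add: nths_Cons shuffle_sign_insert_0 del: Compl_insert)
  qed simp
  finally show ?thesis
    by (simp add: add.commute)
qed

lemma wdg_add_left: "wdg (\<lambda>vs. \<alpha> vs + \<alpha>' vs) \<beta> vs = wdg \<alpha> \<beta> vs + wdg \<alpha>' \<beta> vs"
  by (simp add: wdg_def sum.distrib algebra_simps)

lemma wdg_cmult_left: "wdg (\<lambda>vs. c * \<alpha> vs) \<beta> vs = c * wdg \<alpha> \<beta> vs"
  by (simp add: wdg_def sum_distrib_left algebra_simps)

lemma wdg_add_right: "wdg \<alpha> (\<lambda>vs. \<beta> vs + \<beta>' vs) vs = wdg \<alpha> \<beta> vs + wdg \<alpha> \<beta>' vs"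
  by (simp add: wdg_def sum.distrib algebra_simps)

lemma wdg_cmult_right: "wdg \<alpha> (\<lambda>vs. c * \<beta> vs) vs = c * wdg \<alpha> \<beta> vs"
  by (simp add: wdg_def sum_distrib_left algebra_simps)

lemma wdg_diff_left: "wdg (\<lambda>vs. \<alpha> vs - \<alpha>' vs) \<beta> vs = wdg \<alpha> \<beta> vs - wdg \<alpha>' \<beta> vs"
  by (simp add: wdg_def sum_subtractf algebra_simps)

lemma wdg_minus_left: "wdg (\<lambda>vs. - \<alpha> vs) \<beta> vs = - wdg \<alpha> \<beta> vs"
  by (simp add: wdg_def sum_negf)

lemma wdg_zero_left [simp]: "wdg (\<lambda>vs. 0) \<beta> vs = 0"
  by (simp add: wdg_def)

lemma wdg_zero_right [simp]: "wdg \<alpha> (\<lambda>vs. 0) vs = 0"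
  by (simp add: wdg_def)

lemma wdg_sum_left: "wdg (\<lambda>vs. \<Sum>i\<in>A. \<alpha> i vs) \<beta> vs = (\<Sum>i\<in>A. wdg (\<alpha> i) \<beta> vs)"
  by (induction A rule: infinite_finite_induct) (simp_all add: wdg_add_left)

lemma wdg_sum_right: "wdg \<alpha> (\<lambda>vs. \<Sum>i\<in>A. \<beta> i vs) vs = (\<Sum>i\<in>A. wdg \<alpha> (\<beta> i) vs)"
  by (induction A rule: infinite_finite_induct) (simp_all add: wdg_add_right)

definition unit0 :: "'v list \<Rightarrow> real"
  where "unit0 vs = (if vs = [] then 1 else 0)"

lemma wdg_unit_left: "wdg unit0 \<beta> vs = \<beta> vs"
proof (induction vs arbitrary: \<beta>)
  case Nil
  show ?case by (simp add: unit0_def)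
next
  case (Cons v vs)
  have "(\<lambda>us. (-1) ^ length us * unit0 us) = (unit0 :: 'a list \<Rightarrow> real)" "(\<lambda>us. unit0 (v # us)) = (\<lambda>us. 0)"
    by (auto simp: unit0_def fun_eq_iff)
  then show ?case
    unfolding wdg_Cons by (simp only: Cons wdg_zero_left add_0_left)
qed

text \<open>Associativity with a one-form as leftmost factor. Iterated, it lets a product of
  one-forms act on \<eta> one factor at a time.\<close>

lemma wdg_w1: "wdg (w1 \<theta> \<beta>) \<eta> vs = w1 \<theta> (wdg \<beta> \<eta>) vs"
proof (induction vs arbitrary: \<beta> \<eta>)
  case (Cons v vs)
  have "wdg (w1 \<theta> \<beta>) \<eta> (v # vs) = \<theta> v * wdg \<beta> \<eta> vs - wdg (w1 \<theta> (\<lambda>us. \<beta> (v # us))) \<eta> vs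
      - wdg (w1 \<theta> (\<lambda>us. (-1) ^ length us * \<beta> us)) (\<lambda>us. \<eta> (v # us)) vs"
    by (simp add: wdg_Cons w1_sgn wdg_diff_left wdg_cmult_left wdg_minus_left)
  also have "\<dots> = w1 \<theta> (wdg \<beta> \<eta>) (v # vs)"
    by (simp add: wdg_Cons w1_add Cons)
  finally show ?case .
qed simp

section \<open>The exterior derivative of fields of multilinear functions\<close>

definition ext :: "('e::real_normed_vector \<Rightarrow> 'e list \<Rightarrow> real) \<Rightarrow> 'e \<Rightarrow> 'e list \<Rightarrow> real"
  where "ext w p vs =
    (\<Sum>i<length vs. (-1) ^ i * dird (vs ! i) (\<lambda>q. w q (take i vs @ drop (Suc i) vs)) p)"

lemma ext_Nil [simp]: "ext w p [] = 0"
  by (simp add: ext_def)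

text \<open>Cartan's formula for a constant vector field, whose Lie derivative is the plain
  directional derivative. The product rules for \<open>ext\<close> below are inductions over this
  recursion.\<close>

lemma ext_Cons: "ext w p (v # vs) = dird v (\<lambda>q. w q vs) p - ext (\<lambda>q us. w q (v # us)) p vs"
  unfolding ext_def by (simp add: sum.lessThan_Suc_shift sum_negf del: sum.lessThan_Suc)

definition smooth_field :: "('e::real_normed_vector \<Rightarrow> 'a \<Rightarrow> real) \<Rightarrow> bool"
  where "smooth_field w \<longleftrightarrow> (\<forall>vs. smooth (\<lambda>p. w p vs))"

lemma smooth_fieldD: "smooth_field w \<Longrightarrow> smooth (\<lambda>p. w p vs)"
  by (simp add: smooth_field_def)

lemma smooth_field_Cons: "smooth_field w \<Longrightarrow> smooth_field (\<lambda>p us. w p (v # us))"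
  by (simp add: smooth_field_def)

lemma smooth_field_add: "smooth_field w \<Longrightarrow> smooth_field w' \<Longrightarrow> smooth_field (\<lambda>p vs. w p vs + w' p vs)"
  by (simp add: smooth_field_def smooth_add)

lemma smooth_field_mult: "smooth h \<Longrightarrow> smooth_field w \<Longrightarrow> smooth_field (\<lambda>p vs. h p * w p vs)"
  by (simp add: smooth_field_def smooth_mult)

lemma smooth_field_sum:
  "(\<And>i. i \<in> A \<Longrightarrow> smooth_field (w i)) \<Longrightarrow> smooth_field (\<lambda>p vs. \<Sum>i\<in>A. w i p vs)"
  by (simp add: smooth_field_def smooth_sum)

lemma smooth_field_w1:
  assumes "smooth_field \<theta>" "smooth_field \<beta>"
  shows "smooth_field (\<lambda>p. w1 (\<theta> p) (\<beta> p))"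
proof -
  have "smooth (\<lambda>p. w1 (\<theta> p) (\<beta> p) vs)" for vs
    using assms(2)
  proof (induction vs arbitrary: \<beta>)
    case (Cons v vs)
    then show ?case
      using smooth_fieldD[OF assms(1)] smooth_fieldD[OF Cons.prems] smooth_field_Cons[OF Cons.prems]
      by (simp add: smooth_diff smooth_mult)
  qed simp
  then show ?thesis
    by (simp add: smooth_field_def)
qed

lemma dird_w1:
  assumes \<theta>: "smooth_field \<theta>" and "smooth_field \<beta>"
  shows "dird v (\<lambda>q. w1 (\<theta> q) (\<beta> q) vs) p =
    w1 (\<lambda>u. dird v (\<lambda>q. \<theta> q u) p) (\<beta> p) vs + w1 (\<theta> p) (\<lambda>us. dird v (\<lambda>q. \<beta> q us) p) vs"
  using assms(2)
proof (induction vs arbitrary: \<beta>)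
  case (Cons u vs)
  note s = smooth_fieldD[OF \<theta>] smooth_fieldD[OF Cons.prems] smooth_field_Cons[OF Cons.prems]
  note s' = smooth_fieldD[OF smooth_field_w1[OF \<theta> s(3)]]
  show ?case
    by (simp add: dird_smooth_diff dird_smooth_mult smooth_mult s s' Cons.IH[OF s(3)])
qed simp

lemma ext_add:
  "smooth_field w \<Longrightarrow> smooth_field w' \<Longrightarrow>
    ext (\<lambda>q us. w q us + w' q us) p vs = ext w p vs + ext w' p vs"
  by (simp add: ext_def dird_smooth_add smooth_fieldD sum.distrib algebra_simps)

lemma ext_mult:
  assumes h: "smooth h" and "smooth_field w"
  shows "ext (\<lambda>q us. h q * w q us) p vs = w1 (\<lambda>u. dird u h p) (w p) vs + h p * ext w p vs"
  using assms(2)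
proof (induction vs arbitrary: w)
  case (Cons v vs)
  then show ?case
    by (simp add: ext_Cons smooth_field_Cons dird_smooth_mult h smooth_fieldD algebra_simps)
qed simp

lemma ext_cmult: "smooth_field w \<Longrightarrow> ext (\<lambda>q us. c * w q us) p vs = c * ext w p vs"
  by (simp add: ext_mult)

lemma ext_diff:
  "smooth_field w \<Longrightarrow> smooth_field w' \<Longrightarrow>
    ext (\<lambda>q us. w q us - w' q us) p vs = ext w p vs - ext w' p vs"
  by (simp add: ext_def dird_smooth_diff smooth_fieldD sum_subtractf algebra_simps)

lemma ext_zero [simp]: "ext (\<lambda>p vs. 0) p vs = 0"
  by (simp add: ext_def)

lemma ext_sum:
  "(\<And>i. i \<in> A \<Longrightarrow> smooth_field (w i)) \<Longrightarrow>
    ext (\<lambda>p vs. \<Sum>i\<in>A. w i p vs) p vs = (\<Sum>i\<in>A. ext (w i) p vs)"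
  by (induction A rule: infinite_finite_induct) (simp_all add: ext_add smooth_field_sum)

text \<open>The symmetry of the derivative of \<theta> is closedness. In the induction the term that
  differentiates the coefficient \<theta>(v) cancels against the one produced by
  \<open>dird_w1\<close> because of this symmetry.\<close>

lemma ext_w1_closed:
  assumes \<theta>: "smooth_field \<theta>" and closed: "\<And>u v p. dird u (\<lambda>q. \<theta> q v) p = dird v (\<lambda>q. \<theta> q u) p"
    and "smooth_field \<beta>"
  shows "ext (\<lambda>q. w1 (\<theta> q) (\<beta> q)) p vs = - w1 (\<theta> p) (ext \<beta> p) vs"
  using assms(3)
proof (induction vs arbitrary: \<beta>)
  case (Cons v vs)
  note s = smooth_fieldD[OF \<theta>] smooth_fieldD[OF Cons.prems] smooth_field_Cons[OF Cons.prems]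
  have h: "ext (\<lambda>q us. \<theta> q v * \<beta> q us - w1 (\<theta> q) (\<lambda>us. \<beta> q (v # us)) us) p vs =
     w1 (\<lambda>u. dird u (\<lambda>q. \<theta> q v) p) (\<beta> p) vs + \<theta> p v * ext \<beta> p vs
     + w1 (\<theta> p) (ext (\<lambda>q us. \<beta> q (v # us)) p) vs"
    by (simp add: ext_diff ext_mult smooth_field_mult smooth_field_w1 s \<theta> Cons.prems Cons.IH)
  show ?case
    by (simp add: ext_Cons h dird_w1[OF \<theta> Cons.prems] w1_diff ext_Cons[abs_def] closed[of v])
qed simp

text \<open>A recursive variant of \<open>alternating_multilinear\<close>, shaped for induction by
  contraction with the first argument. Each level demands vanishing only when the first two
  arguments agree; arbitrary repetitions follow by swapping neighbours.\<close>

fun alt :: "nat \<Rightarrow> ('v::real_vector list \<Rightarrow> real) \<Rightarrow> bool"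
  where
    "alt 0 \<alpha> \<longleftrightarrow> (\<forall>vs. vs \<noteq> [] \<longrightarrow> \<alpha> vs = 0)"
  | "alt (Suc n) \<alpha> \<longleftrightarrow> \<alpha> [] = 0 \<and> (\<forall>v. alt n (\<lambda>vs. \<alpha> (v # vs))) \<and>
      (\<forall>vs. linear (\<lambda>v. \<alpha> (v # vs))) \<and> (\<forall>v vs. \<alpha> (v # v # vs) = 0)"

lemma alt_add: "alt n \<alpha> \<Longrightarrow> alt n \<beta> \<Longrightarrow> alt n (\<lambda>vs. \<alpha> vs + \<beta> vs)"
  by (induction n arbitrary: \<alpha> \<beta>) (auto intro: linear_compose_add)

lemma alt_cmult: "alt n \<alpha> \<Longrightarrow> alt n (\<lambda>vs. c * \<alpha> vs)"
proof (induction n arbitrary: \<alpha>)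
  case (Suc n)
  then have "linear (\<lambda>v. c * \<alpha> (v # vs))" for vs
    using linear_compose_scale_right[of "\<lambda>v. \<alpha> (v # vs)" c] by simp
  with Suc show ?case by auto
qed auto

lemma alt_zero: "alt n (\<lambda>vs. 0)"
  by (induction n) (auto intro: linear_zero)

lemma alt_diff: "alt n \<alpha> \<Longrightarrow> alt n \<beta> \<Longrightarrow> alt n (\<lambda>vs. \<alpha> vs - \<beta> vs)"
  using alt_add[of n \<alpha> "\<lambda>vs. - 1 * \<beta> vs"] alt_cmult[of n \<beta> "- 1"] by simp

lemma alt_sum: "(\<And>i. i \<in> A \<Longrightarrow> alt n (\<alpha> i)) \<Longrightarrow> alt n (\<lambda>vs. \<Sum>i\<in>A. \<alpha> i vs)"
  by (induction A rule: infinite_finite_induct) (auto intro: alt_add alt_zero)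

lemma alt_unit0: "alt 0 unit0"
  by (simp add: unit0_def)

lemma linear_w1:
  assumes "\<And>us. linear (\<lambda>v. \<beta> v us)"
  shows "linear (\<lambda>v. w1 \<theta> (\<beta> v) us)"
proof (rule linearI)
  have "\<beta> (x + y) = (\<lambda>us. \<beta> x us + \<beta> y us)" for x y
    by (simp add: fun_eq_iff linear_add[OF assms])
  then show "w1 \<theta> (\<beta> (x + y)) us = w1 \<theta> (\<beta> x) us + w1 \<theta> (\<beta> y) us" for x y
    by (simp add: w1_add)
  have "\<beta> (r *\<^sub>R x) = (\<lambda>us. r * \<beta> x us)" for r x
    by (simp add: fun_eq_iff linear_scale[OF assms])
  then show "w1 \<theta> (\<beta> (r *\<^sub>R x)) us = r *\<^sub>R w1 \<theta> (\<beta> x) us" for r x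
    by (simp add: w1_cmult)
qed

lemma linear_mult_const: "linear \<theta> \<Longrightarrow> linear (\<lambda>v. \<theta> v * c :: real)"
  by (rule linearI) (simp_all add: linear_add linear_scale algebra_simps)

lemma alt_w1: "linear \<theta> \<Longrightarrow> alt n \<beta> \<Longrightarrow> alt (Suc n) (w1 \<theta> \<beta>)"
proof (induction n arbitrary: \<beta>)
  case 0
  have "\<beta> (v # vs) = 0" for v vs
    using 0 by simp
  moreover from this 0 have "linear (\<lambda>v. \<theta> v * \<beta> vs)" for vs
    by (simp add: linear_mult_const)
  ultimately show ?case
    using 0 by simp
next
  case (Suc n)
  have lin: "linear (\<lambda>v. \<theta> v * \<beta> vs - w1 \<theta> (\<lambda>us. \<beta> (v # us)) vs)" for vs
    using Suc.prems by (intro linear_compose_sub linear_w1 linear_mult_const) auto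
  have zero: "(\<lambda>us. \<beta> (v # v # us)) = (\<lambda>us. 0)" for v
    using Suc.prems by auto
  have "alt (Suc n) (\<lambda>vs. \<theta> v * \<beta> vs - w1 \<theta> (\<lambda>us. \<beta> (v # us)) vs)" for v
    using Suc by (intro alt_diff alt_cmult Suc.IH) auto
  then show ?case
    unfolding alt.simps(2)[of "Suc n"] by (simp add: lin zero del: alt.simps)
qed

text \<open>Polarization: the value at a doubled argument \<open>u + v\<close> is zero and is
  expanded by linearity in both slots.\<close>

lemma alt_swap: "alt (Suc n) \<alpha> \<Longrightarrow> \<alpha> (u # v # vs) = - \<alpha> (v # u # vs)"
proof -
  assume a: "alt (Suc n) \<alpha>"
  then have l1: "linear (\<lambda>v. \<alpha> (v # vs))" for vs by simp
  have l2: "linear (\<lambda>v. \<alpha> (u # v # vs))" for u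
  proof (cases n)
    case 0
    then show ?thesis using a by (simp add: linear_zero)
  next
    case (Suc m)
    then show ?thesis using a by simp
  qed
  have "\<alpha> ((u + v) # (u + v) # vs) = 0"
    using a by simp
  then show ?thesis
    using a by (simp add: linear_add[OF l1] linear_add[OF l2])
qed

lemma alt_repeat: "alt n \<alpha> \<Longrightarrow> v \<in> set vs \<Longrightarrow> \<alpha> (v # vs) = 0"
proof (induction n arbitrary: \<alpha> v vs)
  case (Suc n)
  then obtain w us where vs: "vs = w # us" by (cases vs) auto
  show ?case
  proof (cases "v = w")
    case True
    then show ?thesis using Suc.prems vs by simp
  next
    case False
    then have "v \<in> set us" using Suc.prems vs by simp
    then have "\<alpha> (w # v # us) = 0"
      using Suc.IH[of "\<lambda>ts. \<alpha> (w # ts)"] Suc.prems by simp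
    then show ?thesis
      using alt_swap[OF Suc.prems(1), of v w us] vs by (simp del: alt.simps)
  qed
qed simp

lemma alt_length: "alt n \<alpha> \<Longrightarrow> length vs \<noteq> n \<Longrightarrow> \<alpha> vs = 0"
proof (induction n arbitrary: \<alpha> vs)
  case (Suc n)
  then show ?case
    using Suc.IH[of "\<lambda>us. \<alpha> (hd vs # us)" "tl vs"] by (cases vs) auto
qed auto

lemma alt_linear_slot: "alt n \<alpha> \<Longrightarrow> i < length vs \<Longrightarrow> linear (\<lambda>v. \<alpha> (vs[i := v]))"
proof (induction n arbitrary: \<alpha> vs i)
  case 0
  then have "vs[i := v] \<noteq> []" for v by (cases vs) (auto split: nat.split)
  with 0 have "\<alpha> (vs[i := v]) = 0" for v by simp
  then show ?case by (simp add: linear_zero)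
next
  case (Suc n)
  then obtain u us where vs: "vs = u # us" by (cases vs) auto
  show ?case
  proof (cases i)
    case 0
    then show ?thesis using Suc.prems vs by simp
  next
    case (Suc j)
    then show ?thesis
      using Suc.IH[of "\<lambda>us. \<alpha> (u # us)" j us] Suc.prems vs by simp
  qed
qed

lemma alt_repeat_slots: "alt n \<alpha> \<Longrightarrow> i < j \<Longrightarrow> j < length vs \<Longrightarrow> vs ! i = vs ! j \<Longrightarrow> \<alpha> vs = 0"
proof (induction n arbitrary: \<alpha> vs i j)
  case 0
  then have "vs \<noteq> []" by auto
  with 0 show ?case by simp
next
  case (Suc n)
  then obtain u us where vs: "vs = u # us" by (cases vs) auto
  obtain j' where j: "j = Suc j'" using Suc.prems by (cases j) auto
  show ?case
  proof (cases i)
    case 0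
    then have "u \<in> set us" using Suc.prems vs j by auto
    then show ?thesis using alt_repeat[OF Suc.prems(1)] vs by simp
  next
    case (Suc i')
    then show ?thesis
      using Suc.IH[of "\<lambda>us. \<alpha> (u # us)" i' j' us] Suc.prems vs j by simp
  qed
qed

lemma alt_iff: "alt n \<alpha> \<longleftrightarrow> alternating_multilinear n \<alpha>"
proof
  assume a: "alt n \<alpha>"
  show "alternating_multilinear n \<alpha>"
    unfolding alternating_multilinear_def
  proof (intro conjI allI impI)
    show "\<alpha> vs = 0" if "length vs \<noteq> n" for vs
      by (rule alt_length[OF a that])
    show "linear (\<lambda>v. \<alpha> (vs[i := v]))" if "length vs = n \<and> i < n" for vs i
      by (rule alt_linear_slot[OF a]) (use that in simp)
    show "\<alpha> vs = 0" if "length vs = n \<and> i < j \<and> j < n \<and> vs ! i = vs ! j" for vs i j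
      by (rule alt_repeat_slots[OF a, of i j]) (use that in simp_all)
  qed
next
  show "alternating_multilinear n \<alpha> \<Longrightarrow> alt n \<alpha>"
  proof (induction n arbitrary: \<alpha>)
    case 0
    then show ?case by (auto simp: alternating_multilinear_def)
  next
    case (Suc n)
    have len: "\<And>vs. length vs \<noteq> Suc n \<Longrightarrow> \<alpha> vs = 0"
      and lin: "\<And>vs i. length vs = Suc n \<Longrightarrow> i < Suc n \<Longrightarrow> linear (\<lambda>v. \<alpha> (vs[i := v]))"
      and rep: "\<And>vs i j. length vs = Suc n \<Longrightarrow> i < j \<Longrightarrow> j < Suc n \<Longrightarrow> vs ! i = vs ! j \<Longrightarrow> \<alpha> vs = 0"
      using Suc.prems unfolding alternating_multilinear_def by blast+
    have "linear (\<lambda>v. \<alpha> (v # vs))" for vs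
    proof (cases "length vs = n")
      case True
      then show ?thesis using lin[of "0 # vs" 0] by simp
    next
      case False
      then show ?thesis using len by (simp add: linear_zero)
    qed
    moreover have "\<alpha> (v # v # vs) = 0" for v vs
      using len[of "v # v # vs"] rep[of "v # v # vs" 0 1] by (cases "Suc (length vs) = n") auto
    moreover have "alternating_multilinear n (\<lambda>vs. \<alpha> (v # vs))" for v
      unfolding alternating_multilinear_def
    proof (intro conjI allI impI)
      show "linear (\<lambda>u. \<alpha> (v # vs[i := u]))" if "length vs = n \<and> i < n" for vs i
        using lin[of "v # vs" "Suc i"] that by simp
      show "\<alpha> (v # vs) = 0" if "length vs = n \<and> i < j \<and> j < n \<and> vs ! i = vs ! j" for vs i j
        using rep[of "v # vs" "Suc i" "Suc j"] that by simp
    qed (simp add: len)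
    ultimately show ?case
      using Suc.IH len[of "[]"] by simp
  qed
qed

section \<open>The coframe of the oscillator group\<close>

lemma alt_SucD:
  assumes "alt (Suc n) \<alpha>"
  shows "alt n (\<lambda>vs. \<alpha> (v # vs))" "linear (\<lambda>v. \<alpha> (v # vs))" "\<alpha> (v # v # vs) = 0"
  using assms by simp_all

abbreviation (input) ct :: "real4 \<Rightarrow> real" where "ct \<equiv> \<lambda>p. fst p"
abbreviation (input) cx :: "real4 \<Rightarrow> real" where "cx \<equiv> \<lambda>p. fst (snd p)"
abbreviation (input) cy :: "real4 \<Rightarrow> real" where "cy \<equiv> \<lambda>p. fst (snd (snd p))"
abbreviation (input) cz :: "real4 \<Rightarrow> real" where "cz \<equiv> \<lambda>p. snd (snd (snd p))"

definition rX :: "real4 \<Rightarrow> real" where "rX p = cx p * cos (ct p) - cy p * sin (ct p)"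
definition rY :: "real4 \<Rightarrow> real" where "rY p = cx p * sin (ct p) + cy p * cos (ct p)"

text \<open>In the coordinates \<open>(t, X, Y, z)\<close> given by \<open>straighten\<close>, multiplication by an element of the Heisenberg
  subgroup on the right shifts \<open>X\<close> and \<open>Y\<close> without any rotation.\<close>

definition straighten :: "real4 \<Rightarrow> real4" where "straighten p = (ct p, rX p, rY p, cz p)"

definition unstraighten :: "real4 \<Rightarrow> real4"
  where "unstraighten q = (ct q, cx q * cos (ct q) + cy q * sin (ct q),
    cy q * cos (ct q) - cx q * sin (ct q), cz q)"

lemma straighten_unstraighten [simp]: "straighten (unstraighten q) = q"
proof -
  obtain t x y z where q: "q = (t, x, y, z)" by (cases q)
  have "(x * cos t + y * sin t) * cos t - (y * cos t - x * sin t) * sin t = x"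
    "(x * cos t + y * sin t) * sin t + (y * cos t - x * sin t) * cos t = y"
    using sin_cos_squared_add3[of t] by algebra+
  then show ?thesis
    by (simp add: q straighten_def unstraighten_def rX_def rY_def)
qed

lemma unstraighten_straighten [simp]: "unstraighten (straighten p) = p"
proof -
  obtain t x y z where p: "p = (t, x, y, z)" by (cases p)
  have "(x * cos t - y * sin t) * cos t + (x * sin t + y * cos t) * sin t = x"
    "(x * sin t + y * cos t) * cos t - (x * cos t - y * sin t) * sin t = y"
    using sin_cos_squared_add3[of t] by algebra+
  then show ?thesis
    by (simp add: p straighten_def unstraighten_def rX_def rY_def)
qed

lemma bounded_linear_coordinates:
  "bounded_linear ct" "bounded_linear cx" "bounded_linear cy" "bounded_linear cz"
  by (intro bounded_linear_intros bounded_linear_compose[OF bounded_linear_fst]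
      bounded_linear_compose[OF bounded_linear_snd] bounded_linear_fst bounded_linear_snd)+

lemmas smooth_coordinates = bounded_linear_coordinates[THEN smooth_linear]
lemmas dird_coordinates = bounded_linear_coordinates[THEN dird_linear]

lemma smooth_rX: "smooth rX" and smooth_rY: "smooth rY"
  unfolding rX_def rY_def
  by (intro smooth_intros smooth_sin smooth_cos smooth_coordinates)+

lemma smooth_straighten: "smooth f \<Longrightarrow> smooth (\<lambda>p. f (straighten p))"
  unfolding straighten_def
  by (intro smooth_compose smooth_coordinates smooth_rX smooth_rY)

lemma smooth_unstraighten: "smooth f \<Longrightarrow> smooth (\<lambda>q. f (unstraighten q))"
  unfolding unstraighten_def
  by (intro smooth_compose smooth_intros smooth_sin smooth_cos smooth_coordinates)

text \<open>\<open>dt\<close>, \<open>dX\<close>, \<open>dY\<close> and \<zeta> written in the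
  original coordinates. In the last three the terms with \<open>ct v\<close> come from
  differentiating the rotation angle; in \<zeta> they combine to \<open>x^2 + y^2\<close>.\<close>

definition coframe :: "nat \<Rightarrow> real4 \<Rightarrow> real4 \<Rightarrow> real"
  where "coframe i p v =
    (if i = 0 then ct v
     else if i = 1 then cx v * cos (ct p) - cy v * sin (ct p) - rY p * ct v
     else if i = 2 then cx v * sin (ct p) + cy v * cos (ct p) + rX p * ct v
     else if i = 3 then cz v + 1/2 * (cx p * cy v - cy p * cx v + (cx p * cx p + cy p * cy p) * ct v)
     else 0)"

text \<open>The dual frame: \<open>d/dt\<close> with \<open>X\<close>, \<open>Y\<close>,
  \<open>z\<close> held fixed, then \<open>d/dX + (Y/2) d/dz\<close>,
  \<open>d/dY - (X/2) d/dz\<close> and \<open>d/dz\<close>. The corrections along \<open>z\<close>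
  make \<zeta> vanish on the middle two.\<close>

definition frame :: "nat \<Rightarrow> real4 \<Rightarrow> real4"
  where "frame i p =
    (if i = 0 then (1, cy p, - cx p, 0)
     else if i = 1 then (0, cos (ct p), - sin (ct p), rY p / 2)
     else if i = 2 then (0, sin (ct p), cos (ct p), - rX p / 2)
     else (0, 0, 0, 1))"

lemma coframe_frame:
  assumes "i < 4" "j < 4"
  shows "coframe i p (frame j p) = (if i = j then 1 else 0)"
proof -
  obtain t x y z where p: "p = (t, x, y, z)" by (cases p)
  have i: "i = 0 \<or> i = 1 \<or> i = 2 \<or> i = 3" "j = 0 \<or> j = 1 \<or> j = 2 \<or> j = 3"
    using assms by linarith+
  have sc: "cos t * cos t + sin t * sin t = 1" by (rule sin_cos_squared_add3)
  show ?thesis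
    using i sc sc[unfolded add.commute[of "cos t * cos t"]]
    by (elim disjE) (simp_all add: coframe_def frame_def p rX_def rY_def field_simps)
qed

lemma linear_coframe: "linear (coframe i p)"
  by (rule linearI; simp add: coframe_def algebra_simps)

lemma smooth_field_coframe: "smooth_field (coframe i)"
proof -
  have "smooth (\<lambda>p. coframe i p v)" for v
    unfolding coframe_def
    by (cases "i = 0"; cases "i = 1"; cases "i = 2"; cases "i = 3"; simp;
      intro smooth_intros smooth_sin smooth_cos smooth_coordinates smooth_rX smooth_rY)
  then show ?thesis by (simp add: smooth_field_def)
qed

lemma dird_rX: "dird v rX = (\<lambda>p. coframe 1 p v)"
proof (rule dird_eqI)
  show "(rX has_derivative (\<lambda>v. coframe 1 p v)) (at p)" for p
    unfolding rX_def[abs_def] coframe_def rY_def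
    by (auto intro!: derivative_eq_intros simp: algebra_simps)
qed

lemma dird_rY: "dird v rY = (\<lambda>p. coframe 2 p v)"
proof (rule dird_eqI)
  show "(rY has_derivative (\<lambda>v. coframe 2 p v)) (at p)" for p
    unfolding rY_def[abs_def] coframe_def rX_def
    by (auto intro!: derivative_eq_intros simp: algebra_simps)
qed

lemma coframe_closed:
  assumes "i < 3"
  shows "dird u (\<lambda>p. coframe i p v) p = dird v (\<lambda>p. coframe i p u) p"
proof -
  have i: "i = 0 \<or> i = 1 \<or> i = 2"
    using assms by linarith
  have d1: "((\<lambda>p. coframe 1 p v) has_derivative (\<lambda>u. - cx v * sin (ct p) * ct u -
      cy v * cos (ct p) * ct u - coframe 2 p u * ct v)) (at p)" for v p
    unfolding coframe_def[of 1] using smooth_has_derivative[OF smooth_rY, of p] unfolding dird_rY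
    by (auto intro!: derivative_eq_intros)
  have d2: "((\<lambda>p. coframe 2 p v) has_derivative (\<lambda>u. cx v * cos (ct p) * ct u -
      cy v * sin (ct p) * ct u + coframe 1 p u * ct v)) (at p)" for v p
    unfolding coframe_def[of 2] using smooth_has_derivative[OF smooth_rX, of p] unfolding dird_rX
    by (auto intro!: derivative_eq_intros)
  consider "i = 0" | "i = 1" | "i = 2" using i by blast
  then show ?thesis
  proof cases
    case 1
    then show ?thesis by (simp add: coframe_def)
  next
    case 2
    show ?thesis unfolding 2 dird_eqI[OF d1] by (simp add: coframe_def algebra_simps)
  next
    case 3
    show ?thesis unfolding 3 dird_eqI[OF d2] by (simp add: coframe_def algebra_simps)
  qed
qed

text \<open>The shape \<open>dz + (X dY - Y dX) / 2\<close>, from which the exterior derivative of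
  \<zeta> can be read off.\<close>

lemma coframe_3: "coframe 3 p v = cz v + (1/2 * rX p * coframe 2 p v - 1/2 * rY p * coframe 1 p v)"
proof -
  obtain t x y z where p: "p = (t, x, y, z)" by (cases p)
  obtain a b c d where v: "v = (a, b, c, d)" by (cases v)
  have sc: "cos t * cos t + sin t * sin t = 1" by (rule sin_cos_squared_add3)
  show ?thesis
    by (simp add: coframe_def p v rX_def rY_def) (use sc in algebra)
qed

lemma sum_lessThan_4: "(\<Sum>i<4::nat. g i) = g 0 + g 1 + g 2 + (g 3 :: 'a::comm_monoid_add)"
  by (simp add: eval_nat_numeral)

lemma frame_expansion: "(\<Sum>i<4. coframe i p v *\<^sub>R frame i p) = v"
proof -
  obtain t x y z where p: "p = (t, x, y, z)" by (cases p)
  obtain a b c d where v: "v = (a, b, c, d)" by (cases v)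
  define X Y where "X = x * cos t - y * sin t" and "Y = x * sin t + y * cos t"
  have X: "X * cos t + Y * sin t = x" and Y: "Y * cos t - X * sin t = y"
    unfolding X_def Y_def using sin_cos_squared_add3[of t] by algebra+
  define A B where "A = b * cos t - c * sin t - Y * a" and "B = b * sin t + c * cos t + X * a"
  have AB: "a * y + A * cos t + B * sin t = b" "- (a * x) - A * sin t + B * cos t = c"
    unfolding A_def B_def X[symmetric] Y[symmetric] using sin_cos_squared_add3[of t] by algebra+
  have r: "rX p = X" "rY p = Y" "coframe 0 p v = a" "coframe 1 p v = A" "coframe 2 p v = B"
    by (simp_all add: p v X_def Y_def A_def B_def rX_def rY_def coframe_def)
  show ?thesis
    unfolding sum_lessThan_4 coframe_3 r frame_def
    using AB by (simp add: p v r[unfolded p v])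
qed

lemma ext_coframe_closed:
  "i < 3 \<Longrightarrow> smooth_field \<beta> \<Longrightarrow>
    ext (\<lambda>q. w1 (coframe i q) (\<beta> q)) p = (\<lambda>vs. - w1 (coframe i p) (ext \<beta> p) vs)"
  by (rule ext, rule ext_w1_closed) (auto simp: smooth_field_coframe intro: coframe_closed)

text \<open>In the form of \<open>coframe_3\<close> only the products with \<open>rX\<close> and
  \<open>rY\<close> fail to be closed. Each contributes one half of \<open>dX \<and> dY\<close>, the
  second after a transposition.\<close>

lemma ext_coframe_3:
  assumes \<beta>: "smooth_field \<beta>"
  shows "ext (\<lambda>q. w1 (coframe 3 q) (\<beta> q)) p =
    (\<lambda>vs. w1 (coframe 1 p) (w1 (coframe 2 p) (\<beta> p)) vs - w1 (coframe 3 p) (ext \<beta> p) vs)"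
proof
  fix vs
  have w3: "w1 (coframe 3 q) \<gamma> us = w1 cz \<gamma> us +
      (1/2 * rX q * w1 (coframe 2 q) \<gamma> us + - 1/2 * rY q * w1 (coframe 1 q) \<gamma> us)" for q \<gamma> us
  proof -
    have "coframe 3 q = (\<lambda>v. cz v + ((1/2 * rX q) * coframe 2 q v + (- 1/2 * rY q) * coframe 1 q v))"
      by (simp add: coframe_3 fun_eq_iff)
    then show ?thesis
      by (simp only: w1_add_left w1_cmult_left)
  qed
  have cz: "smooth_field (\<lambda>p. cz)" by (simp add: smooth_field_def)
  note s = smooth_field_w1[OF cz \<beta>] smooth_field_w1[OF smooth_field_coframe \<beta>]
  have hX: "smooth (\<lambda>p. 1/2 * rX p)" and hY: "smooth (\<lambda>p. - 1/2 * rY p)"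
    by (intro smooth_intros smooth_rX smooth_rY)+
  have dz: "ext (\<lambda>q. w1 cz (\<beta> q)) p us = - w1 cz (ext \<beta> p) us" for us
    using ext_w1_closed[OF cz _ \<beta>] by simp
  have d12: "ext (\<lambda>q. w1 (coframe 1 q) (\<beta> q)) p us = - w1 (coframe 1 p) (ext \<beta> p) us"
    "ext (\<lambda>q. w1 (coframe 2 q) (\<beta> q)) p us = - w1 (coframe 2 p) (ext \<beta> p) us" for us
    by (simp_all add: ext_coframe_closed[OF _ \<beta>])
  have dX: "dird u (\<lambda>p. 1/2 * rX p) p = 1/2 * coframe 1 p u"
    and dY: "dird u (\<lambda>p. - 1/2 * rY p) p = - 1/2 * coframe 2 p u" for u
    by (simp_all only: dird_cmult[OF smooth_rX] dird_cmult[OF smooth_rY] dird_rX dird_rY)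
  have "ext (\<lambda>q. w1 (coframe 3 q) (\<beta> q)) p vs =
    - w1 cz (ext \<beta> p) vs + (1/2 * w1 (coframe 1 p) (w1 (coframe 2 p) (\<beta> p)) vs
      + 1/2 * rX p * - w1 (coframe 2 p) (ext \<beta> p) vs
      + (- 1/2 * w1 (coframe 2 p) (w1 (coframe 1 p) (\<beta> p)) vs
      + - 1/2 * rY p * - w1 (coframe 1 p) (ext \<beta> p) vs))"
    unfolding w3
    by (simp only: ext_add[OF s(1) smooth_field_add[OF smooth_field_mult[OF hX s(2)]
        smooth_field_mult[OF hY s(2)]]] ext_add[OF smooth_field_mult[OF hX s(2)]
        smooth_field_mult[OF hY s(2)]] ext_mult[OF hX s(2)] ext_mult[OF hY s(2)] dz dX dY
        w1_cmult_left d12)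
  then show "ext (\<lambda>q. w1 (coframe 3 q) (\<beta> q)) p vs =
     w1 (coframe 1 p) (w1 (coframe 2 p) (\<beta> p)) vs - w1 (coframe 3 p) (ext \<beta> p) vs"
    using w1_anticommute[of "coframe 1 p" "coframe 2 p" "\<beta> p"] unfolding w3
    by (simp add: fun_eq_iff)
qed

definition cowedge :: "nat list \<Rightarrow> real4 \<Rightarrow> real4 list \<Rightarrow> real"
  where "cowedge I p = foldr (\<lambda>i. w1 (coframe i p)) I unit0"

lemma cowedge_Nil [simp]: "cowedge [] p = unit0"
  and cowedge_Cons: "cowedge (i # I) p = w1 (coframe i p) (cowedge I p)"
  by (simp_all add: cowedge_def)

lemma alt_cowedge: "alt (length I) (cowedge I p)"
  by (induction I) (simp_all add: cowedge_Cons alt_unit0 alt_w1 linear_coframe del: alt.simps)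

lemma smooth_field_cowedge: "smooth_field (cowedge I)"
proof (induction I)
  case Nil
  then show ?case by (simp add: smooth_field_def)
next
  case (Cons i I)
  then show ?case
    unfolding cowedge_Cons by (intro smooth_field_w1 smooth_field_coframe)
qed

lemma cowedge_swap: "cowedge (j # i # I) p = (\<lambda>vs. - cowedge (i # j # I) p vs)"
  unfolding cowedge_Cons by (rule w1_anticommute)

lemma cowedge_repeat: "cowedge (i # i # I) p = (\<lambda>vs. 0)"
  unfolding cowedge_Cons by (rule w1_same)

definition basis :: "nat list set" where "basis = set (subseqs [0, 1, 2, 3])"

lemma basis_eq: "basis = {[], [0], [1], [2], [3], [0,1], [0,2], [0,3], [1,2], [1,3], [2,3],
    [0,1,2], [0,1,3], [0,2,3], [1,2,3], [0,1,2,3]}"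
  unfolding basis_def by auto

lemma finite_basis [simp]: "finite basis" by (simp add: basis_def)

lemma ext_cowedge:
  assumes "I \<in> basis"
  shows "ext (cowedge I) p = (\<lambda>vs. if I = [3] then cowedge [1, 2] p vs
    else if I = [0, 3] then - cowedge [0, 1, 2] p vs else 0)"
proof -
  have e0: "ext (cowedge []) p = (\<lambda>vs. 0)"
    by (simp add: ext_def fun_eq_iff)
  have e: "ext (cowedge (i # I)) p = (\<lambda>vs. - w1 (coframe i p) (ext (cowedge I) p) vs)"
    if "i < 3" for i I
    using ext_coframe_closed[OF that smooth_field_cowedge] by (simp add: cowedge_Cons[abs_def])
  have e3: "ext (cowedge (3 # I)) p =
      (\<lambda>vs. cowedge (1 # 2 # I) p vs - w1 (coframe 3 p) (ext (cowedge I) p) vs)" for I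
    using ext_coframe_3[OF smooth_field_cowedge] by (simp add: cowedge_Cons[abs_def])
  note r = w1_same w1_anticommute[of "coframe 2 p" "coframe (Suc 0) p"]
  show ?thesis
    using assms unfolding basis_eq
    by (auto simp: e0 e e3 cowedge_Cons r w1_minus)
qed

text \<open>The dual frame in straightened coordinates. Its components involve neither
  \<open>t\<close> nor \<open>z\<close>, which is what allows means and primitives in these two
  directions to pass through the derivatives.\<close>

definition dvf :: "nat \<Rightarrow> real4 \<Rightarrow> real4"
  where "dvf i q = (if i = 0 then (1, 0, 0, 0) else if i = 1 then (0, 1, 0, cy q / 2)
    else if i = 2 then (0, 0, 1, - cx q / 2) else (0, 0, 0, 1))"

definition deriv_along :: "nat \<Rightarrow> (real4 \<Rightarrow> real) \<Rightarrow> real4 \<Rightarrow> real"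
  where "deriv_along i f q = dird (dvf i q) f q"

lemma deriv_along_simps:
  assumes "smooth f"
  shows "deriv_along 0 f = dird (1, 0, 0, 0) f"
    "deriv_along 1 f = (\<lambda>q. dird (0, 1, 0, 0) f q + cy q / 2 * dird (0, 0, 0, 1) f q)"
    "deriv_along 2 f = (\<lambda>q. dird (0, 0, 1, 0) f q - cx q / 2 * dird (0, 0, 0, 1) f q)"
    "deriv_along 3 f = dird (0, 0, 0, 1) f"
proof -
  note l = real4_decompose[OF linear_dird[OF assms]]
  show "deriv_along 1 f = (\<lambda>q. dird (0, 1, 0, 0) f q + cy q / 2 * dird (0, 0, 0, 1) f q)"
    by (rule ext) (simp add: deriv_along_def dvf_def, subst l, simp)
  show "deriv_along 2 f = (\<lambda>q. dird (0, 0, 1, 0) f q - cx q / 2 * dird (0, 0, 0, 1) f q)"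
    by (rule ext) (simp add: deriv_along_def dvf_def, subst l, simp)
qed (simp_all add: deriv_along_def fun_eq_iff dvf_def)

lemma smooth_deriv_along: "smooth f \<Longrightarrow> smooth (deriv_along i f)"
proof -
  assume f: "smooth f"
  have "i = 0 \<or> i = 1 \<or> i = 2 \<or> deriv_along i f = deriv_along 3 f"
    by (auto simp: deriv_along_def fun_eq_iff dvf_def)
  then show "smooth (deriv_along i f)"
    using f by (elim disjE)
      (simp_all only: deriv_along_simps, (intro smooth_intros smooth_coordinates; assumption)+)
qed

lemma dird_straighten:
  assumes f: "smooth f"
  shows "dird v (\<lambda>p. f (straighten p)) p =
    (\<Sum>i<4. coframe i p v * deriv_along i f (straighten p))"
proof -
  have "dird v (\<lambda>p. f (straighten p)) p =
    dird v ct p * dird (1, 0, 0, 0) f (straighten p) +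
    dird v rX p * dird (0, 1, 0, 0) f (straighten p) +
    dird v rY p * dird (0, 0, 1, 0) f (straighten p) +
    dird v cz p * dird (0, 0, 0, 1) f (straighten p)"
    unfolding straighten_def
    by (subst dird_eqI[OF dird_compose[OF f[THEN smooth_differentiable]
        smooth_coordinates(1)[THEN smooth_differentiable] smooth_rX[THEN smooth_differentiable]
        smooth_rY[THEN smooth_differentiable] smooth_coordinates(4)[THEN smooth_differentiable]]]) (rule refl)
  also have "\<dots> = (\<Sum>i<4. coframe i p v * deriv_along i f (straighten p))"
    unfolding sum_lessThan_4 deriv_along_simps[OF f] dird_coordinates dird_rX dird_rY coframe_3
    by (simp add: straighten_def coframe_def[of 0] algebra_simps)
  finally show ?thesis .
qed

text \<open>The coefficients are read in straightened coordinates while the point and the vectors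
  stay in the original ones. Invariance of the form under Heisenberg elements then becomes
  invariance of its coefficient functions.\<close>

definition form_of :: "(nat list \<Rightarrow> real4 \<Rightarrow> real) \<Rightarrow> real4 \<Rightarrow> real4 list \<Rightarrow> real"
  where "form_of c p vs = (\<Sum>I\<in>basis. c I (straighten p) * cowedge I p vs)"

text \<open>The coefficient of \<open>J\<close> in the differential: the usual alternating sum of
  derivatives, and the contribution of \<open>d\<zeta> = dX \<and> dY\<close>. The latter reaches
  only \<open>[1, 2]\<close>, from \<zeta>, and \<open>[0, 1, 2]\<close>, from
  \<open>dt \<and> \<zeta>\<close>, since the other monomials with \<zeta> would repeat
  \<open>dX\<close> or \<open>dY\<close>.\<close>

definition diff_coeff :: "(nat list \<Rightarrow> real4 \<Rightarrow> real) \<Rightarrow> nat list \<Rightarrow> real4 \<Rightarrow> real"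
  where "diff_coeff c J q =
    (\<Sum>k<length J. (-1) ^ k * deriv_along (J ! k) (c (take k J @ drop (Suc k) J)) q) +
    (if J = [1, 2] then c [3] q else if J = [0, 1, 2] then - c [0, 3] q else 0)"

lemma smooth_field_form_of: "(\<And>I. smooth (c I)) \<Longrightarrow> smooth_field (form_of c)"
  unfolding form_of_def[abs_def]
  by (intro smooth_field_sum smooth_field_mult smooth_straighten smooth_field_cowedge)

lemma ext_form_of:
  assumes c: "\<And>I. smooth (c I)"
  shows "ext (form_of c) p vs = form_of (diff_coeff c) p vs"
proof -
  have "ext (form_of c) p vs =
    (\<Sum>I\<in>basis. ext (\<lambda>p vs. c I (straighten p) * cowedge I p vs) p vs)"
    unfolding form_of_def[abs_def]
    by (intro ext_sum smooth_field_mult smooth_straighten smooth_field_cowedge c)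
  also have "\<dots> = (\<Sum>I\<in>basis. (\<Sum>i<4. deriv_along i (c I) (straighten p) * cowedge (i # I) p vs) +
      c I (straighten p) * (if I = [3] then cowedge [1, 2] p vs
        else if I = [0, 3] then - cowedge [0, 1, 2] p vs else 0))"
  proof (rule sum.cong)
    fix I assume I: "I \<in> basis"
    have "w1 (\<lambda>u. \<Sum>i<4. coframe i p u * deriv_along i (c I) (straighten p)) (cowedge I p) vs =
      (\<Sum>i<4. deriv_along i (c I) (straighten p) * cowedge (i # I) p vs)"
      unfolding sum_lessThan_4 cowedge_Cons
      by (simp only: w1_add_left w1_cmult_left mult.commute[of "coframe _ _ _"])
    then show "ext (\<lambda>p vs. c I (straighten p) * cowedge I p vs) p vs =
      (\<Sum>i<4. deriv_along i (c I) (straighten p) * cowedge (i # I) p vs) +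
      c I (straighten p) * (if I = [3] then cowedge [1, 2] p vs
        else if I = [0, 3] then - cowedge [0, 1, 2] p vs else 0)"
      by (simp only: ext_mult[OF smooth_straighten[OF c] smooth_field_cowedge]
        dird_straighten[OF c] ext_cowedge[OF I])
  qed simp
  also have "\<dots> = form_of (diff_coeff c) p vs"
  proof -
    \<comment> \<open>Sorting an index prepended to an increasing word takes at most three adjacent
      swaps, and a repetition can end up as deep as the fourth place; the rules are stated for each
      depth that occurs.\<close>
    have s: "cowedge (j # i # I) p vs = - cowedge (i # j # I) p vs"
      "cowedge (a # j # i # I) p vs = - cowedge (a # i # j # I) p vs"
      "cowedge (a # b # j # i # I) p vs = - cowedge (a # b # i # j # I) p vs" for i j a b I
      using cowedge_swap[of j i I p] by (simp_all add: cowedge_Cons w1_minus)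
    have r: "cowedge (i # i # I) p vs = 0" "cowedge (a # i # i # I) p vs = 0"
      "cowedge (a # b # i # i # I) p vs = 0" "cowedge (a # b # b' # i # i # I) p vs = 0" for i a b b' I
      using cowedge_repeat[of i I p] by (simp_all add: cowedge_Cons)
    show ?thesis
      unfolding form_of_def basis_eq diff_coeff_def sum_lessThan_4
      by (simp add: r s[where j = "Suc 0" and i = 0] s[where j = 2 and i = 0] s[where j = 3 and i = 0] s[where j = 2 and i = "Suc 0"]
          s[where j = 3 and i = "Suc 0"] s[where j = 3 and i = 2])
        (simp add: algebra_simps)
  qed
  finally show ?thesis .
qed

section \<open>Expansion of alternating forms in the coframe\<close>

lemma cowedge_frame_eq_0:
  "j < 4 \<Longrightarrow> set I \<subseteq> {..<4} \<Longrightarrow> j \<notin> set I \<Longrightarrow> cowedge I p (frame j p # vs) = 0"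
proof (induction I arbitrary: vs)
  case Nil
  then show ?case by (simp add: unit0_def)
next
  case (Cons i I)
  then have "(\<lambda>us. cowedge I p (frame j p # us)) = (\<lambda>us. 0)"
    by auto
  with Cons.prems show ?case
    by (simp add: cowedge_Cons coframe_frame)
qed

lemma cowedge_frame:
  "sorted_wrt (<) I \<Longrightarrow> sorted_wrt (<) J \<Longrightarrow> set I \<subseteq> {..<4} \<Longrightarrow> set J \<subseteq> {..<4} \<Longrightarrow>
    cowedge I p (map (\<lambda>i. frame i p) J) = (if I = J then 1 else 0)"
proof (induction I arbitrary: J)
  case Nil
  then show ?case by (simp add: unit0_def)
next
  case (Cons i I)
  let ?f = "\<lambda>i. frame i p"
  have van: "w1 (coframe i p) \<beta> (map ?f K) = 0" if "i \<notin> set K" "set K \<subseteq> {..<4}" for K \<beta>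
    using that Cons.prems by (intro w1_vanishes) (auto simp: coframe_frame)
  show ?case
  proof (cases J)
    case Nil
    then show ?thesis by (simp add: cowedge_Cons)
  next
    case J: (Cons j K)
    consider "i = j" | "i \<notin> set J" | "i \<noteq> j" "i \<in> set K" using J by auto
    then show ?thesis
    proof cases
      case 1
      then have "i \<notin> set K" using Cons.prems J by auto
      then show ?thesis
        using 1 J Cons van by (simp add: cowedge_Cons coframe_frame)
    next
      case 2
      then show ?thesis
        using Cons.prems van[of J] J by (auto simp: cowedge_Cons)
    next
      case 3
      then have "j < i" using Cons.prems J by auto
      then have "j \<notin> set (i # I)" using Cons.prems by auto
      then have "cowedge (i # I) p (map ?f J) = 0"
        unfolding J list.map using Cons.prems J by (intro cowedge_frame_eq_0) auto
      then show ?thesis using 3 J by simp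
    qed
  qed
qed

lemma basis_iff: "I \<in> basis \<longleftrightarrow> sorted_wrt (<) I \<and> set I \<subseteq> {..<4}"
proof
  assume "sorted_wrt (<) I \<and> set I \<subseteq> {..<4}"
  then have I: "sorted I" "distinct I" "set I \<subseteq> {0, 1, 2, 3}"
    by (auto simp: strict_sorted_iff)
  have "set I \<in> set ` set (subseqs [0, 1, 2, 3])"
    unfolding subseqs_powset using I(3) by auto
  then obtain J where J: "J \<in> basis" "set J = set I"
    unfolding basis_def by (metis imageE)
  have "sorted J" "distinct J"
    using J(1) unfolding basis_eq by auto
  then have "I = J"
    using I J(2) sorted_distinct_set_unique by metis
  then show "I \<in> basis" using J by simp
qed (auto simp: basis_eq)

lemma form_of_frame:
  assumes "J \<in> basis"
  shows "form_of c p (map (\<lambda>i. frame i p) J) = c J (straighten p)"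
proof -
  have "form_of c p (map (\<lambda>i. frame i p) J) = (\<Sum>I\<in>basis. c I (straighten p) * (if I = J then 1 else 0))"
    unfolding form_of_def
    by (intro sum.cong refl arg_cong2[of _ _ _ _ "(*)"] cowedge_frame) (use assms basis_iff in auto)
  also have "\<dots> = c J (straighten p)"
    using assms by (simp add: if_distrib cong: if_cong)
  finally show ?thesis .
qed

text \<open>\<open>ys\<close> lists the frame vectors that \<alpha> may still detect. Removing its
  head \<open>y\<close> splits off \<open>coframe y\<close> wedged with the contraction by
  \<open>frame y\<close>; the remainder no longer sees \<open>frame y\<close>, and both the
  contraction and the remainder fall under the induction hypothesis.\<close>

lemma alt_frame_expansion:
  assumes "alt n \<alpha>" "\<And>j vs. j < 4 \<Longrightarrow> j \<notin> set ys \<Longrightarrow> \<alpha> (frame j p # vs) = 0"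
    "distinct ys" "set ys \<subseteq> {..<4}"
  shows "\<alpha> vs = (\<Sum>I\<leftarrow>subseqs ys. \<alpha> (map (\<lambda>i. frame i p) I) * cowedge I p vs)"
  using assms
proof (induction ys arbitrary: \<alpha> n vs)
  case Nil
  \<comment> \<open>With no index left, \<alpha> kills every frame vector in its first slot and so,
    by linearity, every nonempty list.\<close>
  have "\<alpha> vs = 0" if ne: "vs \<noteq> []"
  proof (cases n)
    case 0
    then show ?thesis using Nil that by simp
  next
    case (Suc m)
    obtain u us where vs: "vs = u # us" using ne by (cases vs) auto
    have l: "linear (\<lambda>v. \<alpha> (v # us))" using Nil(1) alt_SucD(2) unfolding Suc by blast
    have "\<alpha> vs = \<alpha> ((\<Sum>i<4. coframe i p u *\<^sub>R frame i p) # us)"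
      by (simp add: frame_expansion vs)
    also have "\<dots> = (\<Sum>i<4. coframe i p u * \<alpha> (frame i p # us))"
      by (simp add: linear_sum[OF l] linear_scale[OF l])
    finally show ?thesis using Nil by simp
  qed
  then show ?case by (simp add: unit0_def)
next
  case (Cons y ys)
  let ?f = "\<lambda>i. frame i p"
  show ?case
  proof (cases n)
    case 0
    have z: "\<alpha> (frame j p # vs) = 0" for j vs using Cons.prems 0 by simp
    have "\<alpha> vs = (\<Sum>I\<leftarrow>subseqs ys. \<alpha> (map ?f I) * cowedge I p vs)"
      using Cons.prems z by (intro Cons.IH[of n]) auto
    then show ?thesis
      by (simp add: Let_def z o_def)
  next
    case (Suc m)
    define \<gamma> where "\<gamma> = (\<lambda>vs. \<alpha> (frame y p # vs))"
    define \<beta> where "\<beta> = (\<lambda>vs. \<alpha> vs - w1 (coframe y p) \<gamma> vs)"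
    have \<gamma>: "alt m \<gamma>"
      using Cons.prems(1) unfolding Suc \<gamma>_def by (rule alt_SucD)
    then have \<beta>: "alt n \<beta>"
      unfolding \<beta>_def Suc using Cons.prems(1)[unfolded Suc] by (intro alt_diff alt_w1 linear_coframe)
    have \<gamma>0: "\<gamma> (frame j p # vs) = 0" if "j < 4" "j \<notin> set ys" for j vs
    proof (cases "j = y")
      case True
      then show ?thesis using alt_SucD(3)[OF Cons.prems(1)[unfolded Suc]] by (simp add: \<gamma>_def)
    next
      case False
      then show ?thesis
        using that Cons.prems(2)[of j] alt_swap[OF Cons.prems(1)[unfolded Suc], of "frame y p" "frame j p" vs]
        by (simp add: \<gamma>_def del: alt.simps)
    qed
    have y: "y < 4" "y \<notin> set ys" using Cons.prems by auto
    have \<beta>0: "\<beta> (frame j p # vs) = 0" if "j < 4" "j \<notin> set ys" for j vs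
    proof -
      have "(\<lambda>us. \<gamma> (frame j p # us)) = (\<lambda>us. 0)"
        using \<gamma>0[OF that] by simp
      then have "\<beta> (frame j p # vs) = \<alpha> (frame j p # vs) - (if y = j then 1 else 0) * \<gamma> vs"
        using that y by (simp add: \<beta>_def coframe_frame)
      then show ?thesis
        using that Cons.prems(2)[of j vs] by (auto simp: \<gamma>_def)
    qed
    have \<beta>I: "\<beta> (map ?f I) = \<alpha> (map ?f I)" if "I \<in> set (subseqs ys)" for I
    proof -
      have "set I \<in> Pow (set ys)"
        using that unfolding subseqs_powset[symmetric] by (rule imageI)
      then have i: "i \<noteq> y" "i < 4" if "i \<in> set I" for i
        using that y Cons.prems(4) by auto
      have "w1 (coframe y p) \<gamma> (map ?f I) = 0"
      proof (rule w1_vanishes)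
        fix v assume "v \<in> set (map ?f I)"
        then obtain j where "v = frame j p" "j \<in> set I" by auto
        then show "coframe y p v = 0"
          using i[of j] coframe_frame[OF y(1), of j p] by simp
      qed
      then show ?thesis
        unfolding \<beta>_def by simp
    qed
    have \<gamma>s: "\<gamma> = (\<lambda>vs. \<Sum>I\<leftarrow>subseqs ys. \<gamma> (map ?f I) * cowedge I p vs)"
      using Cons.prems \<gamma> \<gamma>0 by (intro ext Cons.IH[of m]) auto
    have ws: "w1 \<theta> (\<lambda>vs. \<Sum>I\<leftarrow>Is. a I * g I vs) vs = (\<Sum>I\<leftarrow>Is. a I * w1 \<theta> (g I) vs)"
      for \<theta> a vs and g :: "nat list \<Rightarrow> real4 list \<Rightarrow> real" and Is
      by (induction Is) (simp_all add: w1_add w1_cmult)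
    have "\<alpha> vs = w1 (coframe y p) \<gamma> vs + \<beta> vs"
      by (simp add: \<beta>_def)
    also have "\<beta> vs = (\<Sum>I\<leftarrow>subseqs ys. \<beta> (map ?f I) * cowedge I p vs)"
      using Cons.prems \<beta> \<beta>0 by (intro Cons.IH[of n]) auto
    also have "\<dots> = (\<Sum>I\<leftarrow>subseqs ys. \<alpha> (map ?f I) * cowedge I p vs)"
      using \<beta>I by (intro arg_cong[of _ _ sum_list] map_cong) auto
    also have "w1 (coframe y p) \<gamma> vs = (\<Sum>I\<leftarrow>subseqs ys. \<alpha> (map ?f (y # I)) * cowedge (y # I) p vs)"
      by (subst \<gamma>s) (simp add: ws cowedge_Cons \<gamma>_def)
    finally show ?thesis
      by (simp add: Let_def o_def)
  qed
qed

text \<open>Smoothness of a field refers to constant arguments. The frame vectors vary with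
  \<open>p\<close>, so the first one is expanded in the standard basis, where its components are
  smooth functions.\<close>

lemma smooth_frame_fun:
  assumes "smooth_field w" "\<And>p. alt n (w p)"
  shows "smooth (\<lambda>p. w p (map (\<lambda>i. frame i p) I))"
  using assms
proof (induction I arbitrary: w n)
  case Nil
  then show ?case by (simp add: smooth_fieldD)
next
  case (Cons i I)
  show ?case
  proof (cases n)
    case 0
    then show ?thesis using Cons.prems by simp
  next
    case (Suc m)
    let ?vs = "\<lambda>p. map (\<lambda>i. frame i p) I"
    have s: "smooth (\<lambda>p. w p (v # ?vs p))" for v
      by (intro Cons.IH[of _ m] smooth_field_Cons Cons.prems(1)
          alt_SucD(1)[OF Cons.prems(2)[unfolded Suc]])
    have "linear (\<lambda>v. w p (v # us))" for p us
      by (rule alt_SucD(2)[OF Cons.prems(2)[unfolded Suc]])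
    from real4_decompose[OF this]
    have "w p (frame i p # ?vs p) =
        ct (frame i p) * w p ((1, 0, 0, 0) # ?vs p) + cx (frame i p) * w p ((0, 1, 0, 0) # ?vs p) +
        cy (frame i p) * w p ((0, 0, 1, 0) # ?vs p) + cz (frame i p) * w p ((0, 0, 0, 1) # ?vs p)" for p
      by (metis prod.collapse)
    moreover have "smooth (\<lambda>p. ct (frame i p))" "smooth (\<lambda>p. cx (frame i p))"
      "smooth (\<lambda>p. cy (frame i p))" "smooth (\<lambda>p. cz (frame i p))"
      unfolding frame_def
      by (cases "i = 0"; cases "i = 1"; cases "i = 2"; simp;
        intro smooth_intros smooth_sin smooth_cos smooth_coordinates smooth_rX smooth_rY)+
    ultimately show ?thesis
      by (simp add: smooth_add smooth_mult s)
  qed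
qed

section \<open>Averaging closed forms\<close>

definition coeff :: "(real4 \<Rightarrow> real4 list \<Rightarrow> real) \<Rightarrow> nat list \<Rightarrow> real4 \<Rightarrow> real"
  where "coeff w I q = w (unstraighten q) (map (\<lambda>i. frame i (unstraighten q)) I)"

lemma smooth_coeff: "smooth_field w \<Longrightarrow> (\<And>p. alt n (w p)) \<Longrightarrow> smooth (coeff w I)"
  unfolding coeff_def[abs_def] by (rule smooth_unstraighten[OF smooth_frame_fun])

lemma form_of_coeff:
  assumes "\<And>p. alt n (w p)"
  shows "form_of (coeff w) p vs = w p vs"
proof -
  have d: "distinct (subseqs [0, 1, 2, 3 :: nat])"
    by simp
  have "w p vs = (\<Sum>I\<leftarrow>subseqs [0, 1, 2, 3]. w p (map (\<lambda>i. frame i p) I) * cowedge I p vs)"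
    using assms by (rule alt_frame_expansion) auto
  also have "\<dots> = form_of (coeff w) p vs"
    unfolding sum_list_distinct_conv_sum_set[OF d] form_of_def basis_def coeff_def by simp
  finally show ?thesis ..
qed

lemma coeff_length: "(\<And>p. alt n (w p)) \<Longrightarrow> length I \<noteq> n \<Longrightarrow> coeff w I q = 0"
  unfolding coeff_def by (rule alt_length) auto

lemma alt_form_of:
  assumes "\<And>I q. length I \<noteq> n \<Longrightarrow> c I q = 0"
  shows "alt n (form_of c p)"
proof -
  have "alt n (\<lambda>vs. c I (straighten p) * cowedge I p vs)" for I
    using alt_cmult[OF alt_cowedge[of I p]] assms[of I] alt_zero by (cases "length I = n") auto
  then show ?thesis
    unfolding form_of_def[abs_def] by (intro alt_sum)
qed

lemma form_of_cong: "(\<And>I q. I \<in> basis \<Longrightarrow> c I q = c' I q) \<Longrightarrow> form_of c = form_of c'"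
  by (simp add: form_of_def fun_eq_iff)

definition uv :: "nat \<Rightarrow> real4"
  where "uv i = (if i = 0 then (1, 0, 0, 0) else if i = 1 then (0, 1, 0, 0)
    else if i = 2 then (0, 0, 1, 0) else (0, 0, 0, 1))"

definition period :: "nat \<Rightarrow> nat \<Rightarrow> real"
  where "period k i = (if i = 0 then 2 * pi else if i = 3 then 1 / (2 * real k) else 1)"

definition mean :: "nat \<Rightarrow> nat \<Rightarrow> (real4 \<Rightarrow> real) \<Rightarrow> real4 \<Rightarrow> real"
  where "mean k i f = pint (\<lambda>_. 1) (period k i *\<^sub>R uv i) f"

text \<open>A primitive that involves no choice of base point: it therefore inherits every symmetry
  of \<open>f\<close> that commutes with the translations along \<open>uv i\<close>.\<close>

definition prim :: "nat \<Rightarrow> nat \<Rightarrow> (real4 \<Rightarrow> real) \<Rightarrow> real4 \<Rightarrow> real"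
  where "prim k i f = (\<lambda>q. period k i * pint (\<lambda>s. s) (period k i *\<^sub>R uv i) f q)"

lemma smooth_mean: "smooth f \<Longrightarrow> smooth (mean k i f)"
  unfolding mean_def by (intro smooth_pint continuous_intros)

lemma smooth_prim: "smooth f \<Longrightarrow> smooth (prim k i f)"
  unfolding prim_def by (intro smooth_cmult smooth_pint continuous_intros)

lemma dird_mean: "smooth f \<Longrightarrow> dird v (mean k i f) = mean k i (dird v f)"
  unfolding mean_def by (intro dird_pint continuous_intros)

lemma dird_prim: "smooth f \<Longrightarrow> dird v (prim k i f) = prim k i (dird v f)"
  unfolding prim_def
  by (simp add: dird_cmult smooth_pint dird_pint continuous_on_id)

lemma mean_dird:
  assumes "smooth f" "\<And>q. f (q + period k i *\<^sub>R uv i) = f q" "period k i \<noteq> 0"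
  shows "mean k i (dird (uv i) f) = (\<lambda>q. 0)"
proof
  fix q
  have "pint (\<lambda>_. 1) (period k i *\<^sub>R uv i) (dird (period k i *\<^sub>R uv i) f) q = 0"
    using assms by (simp add: pint_one_dird)
  then show "mean k i (dird (uv i) f) q = 0"
    using assms by (simp add: mean_def dird_scale pint_cmult)
qed

lemma prim_dird:
  assumes "smooth f" "\<And>q. f (q + period k i *\<^sub>R uv i) = f q"
  shows "prim k i (dird (uv i) f) = (\<lambda>q. f q - mean k i f q)"
proof
  fix q
  have "pint (\<lambda>s. s) (period k i *\<^sub>R uv i) (dird (period k i *\<^sub>R uv i) f) q = f q - mean k i f q"
    using assms by (simp add: pint_id_dird mean_def)
  then show "prim k i (dird (uv i) f) q = f q - mean k i f q"
    using assms by (simp add: prim_def dird_scale pint_cmult)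
qed

lemma mean_invariant:
  assumes "smooth f" "\<And>q. f (q + period k i *\<^sub>R uv i) = f q" "period k i \<noteq> 0"
  shows "mean k i f (q + s *\<^sub>R uv i) = mean k i f q"
  using assms by (intro dird_zero_invariant smooth_mean) (simp_all add: dird_mean mean_dird)

lemma mean_commute_map:
  assumes "\<And>q s. T (q + s *\<^sub>R uv i) = T q + s *\<^sub>R uv i" "\<And>q. f (T q) = f q"
  shows "mean k i f (T q) = mean k i f q" "prim k i f (T q) = prim k i f q"
  unfolding mean_def prim_def
  using assms by (simp_all add: pint_commute_map scaleR_scaleR)

lemma mean_sum: "(\<And>j. j \<in> A \<Longrightarrow> smooth (f j)) \<Longrightarrow>
    mean k i (\<lambda>q. \<Sum>j\<in>A. f j q) = (\<lambda>q. \<Sum>j\<in>A. mean k i (f j) q)"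
  unfolding mean_def by (intro pint_sum continuous_intros)

lemma mean_add: "smooth f \<Longrightarrow> smooth h \<Longrightarrow>
    mean k i (\<lambda>q. f q + h q) = (\<lambda>q. mean k i f q + mean k i h q)"
  unfolding mean_def by (intro pint_add continuous_intros)

lemma mean_cmult: "mean k i (\<lambda>q. c * f q) = (\<lambda>q. c * mean k i f q)"
  unfolding mean_def by (rule pint_cmult)

lemma mean_const [simp]: "mean k i (\<lambda>q. c) = (\<lambda>q. c)"
  unfolding mean_def by (rule ext, rule pint_invariant) simp

lemma prim_sum: "(\<And>j. j \<in> A \<Longrightarrow> smooth (f j)) \<Longrightarrow>
    prim k i (\<lambda>q. \<Sum>j\<in>A. f j q) = (\<lambda>q. \<Sum>j\<in>A. prim k i (f j) q)"
  unfolding prim_def by (subst pint_sum) (auto simp: sum_distrib_left continuous_on_id)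

lemma prim_add: "smooth f \<Longrightarrow> smooth h \<Longrightarrow>
    prim k i (\<lambda>q. f q + h q) = (\<lambda>q. prim k i f q + prim k i h q)"
  unfolding prim_def by (subst pint_add) (auto simp: algebra_simps continuous_on_id)

lemma prim_cmult: "prim k i (\<lambda>q. c * f q) = (\<lambda>q. c * prim k i f q)"
  unfolding prim_def by (simp add: pint_cmult algebra_simps)

lemma prim_zero [simp]: "prim k i (\<lambda>q. 0) = (\<lambda>q. 0)"
  unfolding prim_def by simp

lemma mean_mult: "(\<And>s. h (q + s *\<^sub>R uv i) = h q) \<Longrightarrow>
    mean k i (\<lambda>q. h q * f q) q = h q * mean k i f q"
  unfolding mean_def by (rule pint_mult) simp

lemma prim_mult: "(\<And>s. h (q + s *\<^sub>R uv i) = h q) \<Longrightarrow>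
    prim k i (\<lambda>q. h q * f q) q = h q * prim k i f q"
  unfolding prim_def by (subst pint_mult) simp_all

lemma deriv_along_eq:
  assumes "smooth f"
  shows "deriv_along j f = (\<lambda>q. dird (uv j) f q +
    (if j = 1 then cy q / 2 else if j = 2 then - cx q / 2 else 0) * dird (uv 3) f q)"
proof -
  have "j = 0 \<or> j = 1 \<or> j = 2 \<or> deriv_along j f = deriv_along 3 f \<and> uv j = uv 3 \<and> j \<noteq> 1 \<and> j \<noteq> 2"
    by (auto simp: deriv_along_def fun_eq_iff dvf_def uv_def)
  then show ?thesis
    by (elim disjE) (auto simp: deriv_along_simps[OF assms, unfolded One_nat_def] uv_def)
qed

text \<open>The factors \<open>Y/2\<close> and \<open>- X/2\<close> in the frame are constant along
  \<open>t\<close> and \<open>z\<close>, so they can be taken out of the line integrals in these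
  directions.\<close>

lemma deriv_along_mean_prim:
  assumes f: "smooth f" and i: "i = 0 \<or> i = 3"
  shows "deriv_along j (mean k i f) = mean k i (deriv_along j f)"
    and "deriv_along j (prim k i f) = prim k i (deriv_along j f)"
proof -
  let ?h = "\<lambda>q::real4. if j = 1 then cy q / 2 else if j = 2 then - cx q / 2 else 0"
  have h: "?h (q + s *\<^sub>R uv i) = ?h q" for q s
    using i by (auto simp: uv_def)
  have sh: "smooth ?h"
    by (cases "j = 1"; cases "j = 2"; simp; intro smooth_intros smooth_coordinates)
  have s: "smooth (\<lambda>q. ?h q * dird (uv 3) f q)"
    by (intro smooth_mult sh smooth_dird f)
  show "deriv_along j (mean k i f) = mean k i (deriv_along j f)"
    unfolding deriv_along_eq[OF f] deriv_along_eq[OF smooth_mean[OF f]]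
      mean_add[OF smooth_dird[OF f] s] dird_mean[OF f]
    by (rule ext, subst mean_mult[of ?h, OF h], rule refl)
  show "deriv_along j (prim k i f) = prim k i (deriv_along j f)"
    unfolding deriv_along_eq[OF f] deriv_along_eq[OF smooth_prim[OF f]]
      prim_add[OF smooth_dird[OF f] s] dird_prim[OF f]
    by (rule ext, subst prim_mult[of ?h, OF h], rule refl)
qed

lemma deriv_along_0_3: "smooth f \<Longrightarrow> i = 0 \<or> i = 3 \<Longrightarrow> deriv_along i f = dird (uv i) f"
  by (auto simp: deriv_along_eq)

lemma deriv_along_const [simp]: "deriv_along i (\<lambda>q. c) = (\<lambda>q. 0)"
  by (simp add: deriv_along_def fun_eq_iff)

lemma diff_coeff_add:
  assumes "\<And>I. smooth (c I)" "\<And>I. smooth (c' I)"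
  shows "diff_coeff (\<lambda>I q. c I q + c' I q) J q = diff_coeff c J q + diff_coeff c' J q"
  using assms by (simp add: diff_coeff_def deriv_along_def dird_smooth_add sum.distrib algebra_simps)

lemma diff_coeff_mean:
  assumes c: "\<And>I. smooth (c I)" and i: "i = 0 \<or> i = 3"
  shows "diff_coeff (\<lambda>I. mean k i (c I)) J = mean k i (diff_coeff c J)"
proof -
  let ?s = "\<lambda>q. \<Sum>j<length J. (-1) ^ j * deriv_along (J ! j) (c (take j J @ drop (Suc j) J)) q"
  let ?t = "\<lambda>c q. if J = [1, 2] then c [3] q else if J = [0, 1, 2] then - c [0, 3] q else (0 :: real)"
  have s: "smooth (deriv_along j (c I))" for j I
    by (intro smooth_deriv_along c)
  have "smooth (?t c)"
    using c by (cases "J = [1, 2]"; cases "J = [0, 1, 2]") (simp_all add: smooth_minus)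
  moreover have "smooth ?s"
    by (intro smooth_sum smooth_cmult s)
  ultimately have "mean k i (diff_coeff c J) = (\<lambda>q. mean k i ?s q + mean k i (?t c) q)"
    unfolding diff_coeff_def[abs_def] by (intro mean_add)
  also have "mean k i ?s = (\<lambda>q. \<Sum>j<length J. (-1) ^ j *
      deriv_along (J ! j) (mean k i (c (take j J @ drop (Suc j) J))) q)"
    by (subst mean_sum) (auto intro!: smooth_cmult s simp: mean_cmult deriv_along_mean_prim(1)[OF c i])
  also have "mean k i (?t c) = ?t (\<lambda>I. mean k i (c I))"
    using mean_cmult[of k i "-1" "c [0, 3]"] by auto
  finally show ?thesis
    unfolding diff_coeff_def[abs_def] by simp
qed

text \<open>Homotopy operators: contract with the \<open>i\<close>-th frame vector, then take the periodic primitive along it.\<close>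

definition contr0 :: "nat \<Rightarrow> (nat list \<Rightarrow> real4 \<Rightarrow> real) \<Rightarrow> nat list \<Rightarrow> real4 \<Rightarrow> real"
  where "contr0 k c I = (if 0 \<in> set I then (\<lambda>q. 0) else prim k 0 (c (0 # I)))"

definition contr3 :: "nat \<Rightarrow> (nat list \<Rightarrow> real4 \<Rightarrow> real) \<Rightarrow> nat list \<Rightarrow> real4 \<Rightarrow> real"
  where "contr3 k c I = (if 3 \<in> set I then (\<lambda>q. 0) else (\<lambda>q. (-1) ^ length I * prim k 3 (c (I @ [3])) q))"

lemma set_delete: "set (take k J @ drop (Suc k) J) \<subseteq> set J"
  using set_take_subset set_drop_subset by fastforce

text \<open>Cartan's homotopy formula on a closed form. If \<open>0\<close> occurs in
  \<open>J\<close>, only the derivative along \<open>t\<close> survives, because a contracted form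
  has no \<open>dt\<close>. Otherwise closedness at \<open>0 # J\<close> rewrites the derivative of
  \<open>c J\<close> along \<open>t\<close> through exactly the coefficients that the contraction
  uses.\<close>

lemma diff_coeff_contr0:
  assumes c: "\<And>I. smooth (c I)" and per: "\<And>I q. c I (q + period k 0 *\<^sub>R uv 0) = c I q"
    and closed: "\<And>J q. J \<in> basis \<Longrightarrow> diff_coeff c J q = 0" and J: "J \<in> basis"
  shows "diff_coeff (contr0 k c) J q = c J q - mean k 0 (c J) q"
proof (cases "0 \<in> set J")
  case True
  then obtain J' where J': "J = 0 # J'" "0 \<notin> set J'"
    using J unfolding basis_eq by auto
  have "diff_coeff (contr0 k c) J q = deriv_along 0 (prim k 0 (c J)) q"
    unfolding diff_coeff_def J' by (simp add: sum.lessThan_Suc_shift contr0_def J' del: sum.lessThan_Suc)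
  then show ?thesis
    by (simp add: deriv_along_mean_prim[OF c] deriv_along_0_3[OF c] prim_dird[OF c per])
next
  case False
  let ?d = "\<lambda>j. 0 # (take j J @ drop (Suc j) J)"
  let ?t = "\<lambda>q. if J = [1, 2] then c [0, 3] q else (0::real)"
  have J0: "0 # J \<in> basis"
    using J False by (auto simp: basis_iff) (metis gr0I)
  have "deriv_along 0 (c J) q = (\<Sum>j<length J. (-1) ^ j * deriv_along (J ! j) (c (?d j)) q) + ?t q" for q
  proof -
    \<comment> \<open>The minus sign of the structure term at \<open>[0, 1, 2]\<close> agrees with
      the sign that the leading \<open>0\<close> gives to all later terms.\<close>
    have "diff_coeff c (0 # J) q = deriv_along 0 (c J) q
        - (\<Sum>j<length J. (-1) ^ j * deriv_along (J ! j) (c (?d j)) q) - ?t q"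
      unfolding diff_coeff_def
      by (simp add: sum.lessThan_Suc_shift sum_negf del: sum.lessThan_Suc)
    then show ?thesis
      unfolding closed[OF J0] by linarith
  qed
  then have e: "deriv_along 0 (c J) =
      (\<lambda>q. (\<Sum>j<length J. (-1) ^ j * deriv_along (J ! j) (c (?d j)) q) + ?t q)"
    by blast
  have s: "smooth (deriv_along j (c I))" for j I
    by (intro smooth_deriv_along c)
  have "c J q - mean k 0 (c J) q = prim k 0 (deriv_along 0 (c J)) q"
    by (simp add: deriv_along_0_3[OF c] prim_dird[OF c per])
  also have "\<dots> = (\<Sum>j<length J. (-1) ^ j * deriv_along (J ! j) (prim k 0 (c (?d j))) q) +
      (if J = [1, 2] then prim k 0 (c [0, 3]) q else 0)"
  proof -
    have t: "smooth ?t"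
      by (cases "J = [1, 2]") (simp_all add: c)
    have "prim k 0 (\<lambda>q. \<Sum>j<length J. (-1) ^ j * deriv_along (J ! j) (c (?d j)) q) =
        (\<lambda>q. \<Sum>j<length J. (-1) ^ j * deriv_along (J ! j) (prim k 0 (c (?d j))) q)"
      by (subst prim_sum) (auto intro!: smooth_cmult s simp: prim_cmult deriv_along_mean_prim(2)[OF c])
    moreover have "prim k 0 ?t = (\<lambda>q. if J = [1, 2] then prim k 0 (c [0, 3]) q else 0)"
      by (cases "J = [1, 2]") simp_all
    moreover have "smooth (\<lambda>q. \<Sum>j<length J. (-1) ^ j * deriv_along (J ! j) (c (?d j)) q)"
      by (intro smooth_sum smooth_cmult s)
    ultimately show ?thesis
      unfolding e by (simp only: prim_add[OF _ t])
  qed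
  also have "\<dots> = diff_coeff (contr0 k c) J q"
  proof -
    have "0 \<notin> set (take j J @ drop (Suc j) J)" for j
      using False set_delete[of j J] by blast
    moreover have "J \<noteq> [0, 1, 2]" using False by auto
    ultimately show ?thesis
      unfolding diff_coeff_def contr0_def by simp
  qed
  finally show ?thesis ..
qed

text \<open>The same homotopy along the centre. Index 3 stands last in an increasing word, whence
  the sign \<open>(-1) ^ length I\<close> in \<open>contr3\<close>. The contribution of
  \<open>d\<zeta>\<close> does not interfere: the words receiving it do not contain 3, and the
  contracted form has no coefficient at \<open>[3]\<close> or \<open>[0, 3]\<close>.\<close>

lemma diff_coeff_contr3:
  assumes c: "\<And>I. smooth (c I)" and per: "\<And>I q. c I (q + period k 3 *\<^sub>R uv 3) = c I q"
    and closed: "\<And>J q. J \<in> basis \<Longrightarrow> diff_coeff c J q = 0" and J: "J \<in> basis"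
  shows "diff_coeff (contr3 k c) J q = c J q - mean k 3 (c J) q"
proof (cases "3 \<in> set J")
  case True
  then obtain J' where J': "J = J' @ [3]" "3 \<notin> set J'"
    using J unfolding basis_eq
    by (elim insertE emptyE) (auto intro: that[of "butlast J"])
  have t: "take j J @ drop (Suc j) J = (take j J' @ drop (Suc j) J') @ [3]" if "j < length J'" for j
    using that by (simp add: J')
  have "diff_coeff (contr3 k c) J q =
      (-1) ^ length J' * deriv_along 3 (\<lambda>q. (-1) ^ length J' * prim k 3 (c J) q) q"
    unfolding diff_coeff_def using J'
    by (auto simp: contr3_def nth_append)
  then show ?thesis
    by (simp add: deriv_along_0_3 smooth_cmult smooth_prim c dird_cmult dird_prim prim_dird[OF c per]
        flip: power_add mult.assoc) 
next
  case False
  let ?d = "\<lambda>j. (take j J @ drop (Suc j) J) @ [3]"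
  have J3: "J @ [3] \<in> basis"
  proof -
    have "x < 3" if "x \<in> set J" for x
    proof -
      have "x < 4" "x \<noteq> 3" using that J False by (auto simp: basis_iff)
      then show ?thesis by linarith
    qed
    then show ?thesis
      using J by (auto simp: basis_iff sorted_wrt_append)
  qed
  \<comment> \<open>The exponent \<open>length J - 1\<close> is the length of the word after one
    index is deleted. For empty \<open>J\<close> the subtraction is truncated, but the sum is then
    empty.\<close>
  let ?r = "\<lambda>q. \<Sum>j<length J. ((-1) ^ (length J - 1) * (-1) ^ j) * deriv_along (J ! j) (c (?d j)) q"
  have "deriv_along 3 (c J) q = ?r q" for q
  proof -
    have "(\<Sum>j<length J. (-1) ^ j * deriv_along (J ! j) (c (?d j)) q) +
        (-1) ^ length J * deriv_along 3 (c J) q = diff_coeff c (J @ [3]) q"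
      unfolding diff_coeff_def by (simp add: nth_append)
    then have z: "(\<Sum>j<length J. (-1) ^ j * deriv_along (J ! j) (c (?d j)) q) =
        - ((-1) ^ length J * deriv_along 3 (c J) q)"
      unfolding closed[OF J3] by linarith
    show ?thesis
    proof (cases J)
      case Nil
      then show ?thesis using z by simp
    next
      case (Cons j K)
      have "?r q = (-1) ^ length K * (\<Sum>j<length J. (-1) ^ j * deriv_along (J ! j) (c (?d j)) q)"
        unfolding sum_distrib_left by (simp add: Cons mult.assoc)
      also have "\<dots> = deriv_along 3 (c J) q"
        unfolding z by (simp add: Cons flip: power_add mult.assoc)
      finally show ?thesis ..
    qed
  qed
  then have e: "deriv_along 3 (c J) = ?r"
    by blast
  have s: "smooth (deriv_along j (c I))" for j I
    by (intro smooth_deriv_along c)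
  have "c J q - mean k 3 (c J) q = prim k 3 (deriv_along 3 (c J)) q"
    by (simp add: deriv_along_0_3[OF c] prim_dird[OF c per])
  also have "\<dots> = (\<Sum>j<length J. ((-1) ^ (length J - 1) * (-1) ^ j) * deriv_along (J ! j) (prim k 3 (c (?d j))) q)"
    unfolding e
    by (subst prim_sum) (auto intro!: smooth_cmult s simp: prim_cmult deriv_along_mean_prim(2)[OF c])
  also have "\<dots> = diff_coeff (contr3 k c) J q"
  proof -
    have d: "3 \<notin> set (take j J @ drop (Suc j) J)" for j
      using False set_delete[of j J] by blast
    have "contr3 k c (take j J @ drop (Suc j) J) =
        (\<lambda>q. (-1) ^ (length J - 1) * prim k 3 (c (?d j)) q)" if "j < length J" for j
    proof -
      have "length (take j J @ drop (Suc j) J) = length J - 1" using that by simp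
      then show ?thesis unfolding contr3_def using d[of j] by (simp only: if_False)
    qed
    then show ?thesis
      unfolding diff_coeff_def
      by (auto simp: deriv_along_def dird_cmult smooth_prim c contr3_def intro!: sum.cong)
  qed
  finally show ?thesis ..
qed

section \<open>Closed forms on the torus\<close>

declare split_paired_All [simp del] split_paired_Ex [simp del] One_nat_def [simp del]

text \<open>Functions on the torus with coordinates \<open>X\<close>, \<open>Y\<close>, kept as
  functions of four variables so that the same derivatives and means apply to them.\<close>

definition torus_fun :: "(real4 \<Rightarrow> real) \<Rightarrow> bool"
  where "torus_fun f \<longleftrightarrow> smooth f \<and> (\<forall>q s. f (q + s *\<^sub>R uv 0) = f q) \<and>
    (\<forall>q s. f (q + s *\<^sub>R uv 3) = f q) \<and> (\<forall>q. f (q + uv 1) = f q) \<and> (\<forall>q. f (q + uv 2) = f q)"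

lemma torus_smooth: "torus_fun f \<Longrightarrow> smooth f"
  by (simp add: torus_fun_def)

lemma period_1_2 [simp]: "period k 1 = 1" "period k (Suc 0) = 1" "period k 2 = 1"
  by (simp_all add: period_def)

lemma torus_const: "torus_fun (\<lambda>q. c)"
  by (simp add: torus_fun_def)

lemma torus_add: "torus_fun f \<Longrightarrow> torus_fun g \<Longrightarrow> torus_fun (\<lambda>q. f q + g q)"
  by (simp add: torus_fun_def smooth_add)

lemma torus_minus: "torus_fun f \<Longrightarrow> torus_fun (\<lambda>q. - f q)"
  by (simp add: torus_fun_def smooth_minus)

lemma torus_diff: "torus_fun f \<Longrightarrow> torus_fun g \<Longrightarrow> torus_fun (\<lambda>q. f q - g q)"
  by (simp add: torus_fun_def smooth_diff)

lemma torus_mean_prim: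
  assumes "torus_fun f"
  shows "torus_fun (mean k i f)" "torus_fun (prim k i f)"
proof -
  have "mean k i f (q + e) = mean k i f q" "prim k i f (q + e) = prim k i f q"
    if "\<And>q. f (q + e) = f q" for q e
    using mean_commute_map[where T = "\<lambda>q. q + e" and f = f and i = i and k = k and q = q] that
    by (simp_all add: algebra_simps)
  then show "torus_fun (mean k i f)" "torus_fun (prim k i f)"
    using assms unfolding torus_fun_def by (auto intro!: smooth_mean smooth_prim)
qed

lemma torus_deriv_along:
  assumes "torus_fun f"
  shows "deriv_along 0 f q = 0" "deriv_along 3 f q = 0" "deriv_along 1 f q = dird (uv 1) f q"
    "deriv_along 2 f q = dird (uv 2) f q"
proof -
  have "dird (uv 0) f = (\<lambda>_. 0)" "dird (uv 3) f = (\<lambda>_. 0)"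
    using assms unfolding torus_fun_def by (intro invariant_dird_zero; simp)+
  then show "deriv_along 0 f q = 0" "deriv_along 3 f q = 0" "deriv_along 1 f q = dird (uv 1) f q"
    "deriv_along 2 f q = dird (uv 2) f q"
    using deriv_along_eq[OF torus_smooth[OF assms]] by simp_all
qed

lemma torus_prim_mean_dird:
  assumes "torus_fun f" and i: "i = 1 \<or> i = 2"
  shows "mean k i (dird (uv i) f) = (\<lambda>q. 0)"
    "prim k i (dird (uv i) f) = (\<lambda>q. f q - mean k i f q)"
  using assms by (auto intro!: mean_dird prim_dird simp: torus_fun_def period_def)

lemma real4_uv_sum: "q = 0 + ct q *\<^sub>R uv 0 + cx q *\<^sub>R uv 1 + cy q *\<^sub>R uv 2 + cz q *\<^sub>R uv 3"
  by (simp add: uv_def)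

lemma torus_constant:
  assumes f: "torus_fun f" and "\<And>q. dird (uv 1) f q = 0" "\<And>q. dird (uv 2) f q = 0"
  shows "f q = f 0"
proof -
  have e: "f (q + s *\<^sub>R uv i) = f q" if "i = 0 \<or> i = 1 \<or> i = 2 \<or> i = 3" for q s i
    using that assms dird_zero_invariant[OF torus_smooth[OF f]] unfolding torus_fun_def
    by (elim disjE) simp_all
  show ?thesis
    by (subst real4_uv_sum) (simp only: e simp_thms)
qed

text \<open>The mean over the whole torus. The periods in the directions 1 and 2 equal 1 for every
  \<open>k\<close>; here \<open>k\<close> is set to 1.\<close>

definition mean2 :: "(real4 \<Rightarrow> real) \<Rightarrow> real4 \<Rightarrow> real"
  where "mean2 f = mean 1 2 (mean 1 1 f)"

lemma mean2_dird:
  assumes f: "torus_fun f"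
  shows "mean2 (dird (uv 1) f) = (\<lambda>q. 0)" "mean2 (dird (uv 2) f) = (\<lambda>q. 0)"
proof -
  show "mean2 (dird (uv 1) f) = (\<lambda>q. 0)"
    unfolding mean2_def using torus_prim_mean_dird(1)[OF f, of 1 1] by simp
  show "mean2 (dird (uv 2) f) = (\<lambda>q. 0)"
    unfolding mean2_def dird_mean[OF torus_smooth[OF f], symmetric]
    using torus_prim_mean_dird(1)[OF torus_mean_prim(1)[OF f, of 1 1], of 2 1] by simp
qed

lemma mean2_constant:
  assumes f: "torus_fun f"
  shows "mean2 f q = mean2 f 0"
proof (rule torus_constant)
  show "torus_fun (mean2 f)"
    unfolding mean2_def by (intro torus_mean_prim f)
  have "dird (uv i) (mean2 f) = mean2 (dird (uv i) f)" for i
    using torus_smooth[OF f] by (simp add: mean2_def dird_mean smooth_mean)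
  then show "dird (uv 1) (mean2 f) q = 0" "dird (uv 2) (mean2 f) q = 0" for q
    using mean2_dird[OF f] by simp_all
qed

text \<open>The primitive of \<open>u\<close> along \<open>X\<close> accounts for \<open>u\<close>
  up to its \<open>X\<close>-mean, which is constant because its \<open>Y\<close>-derivative is the
  \<open>X\<close>-mean of the \<open>X\<close>-derivative of \<open>v\<close>. For \<open>v\<close>
  it leaves the \<open>X\<close>-mean of \<open>v\<close>, and the second summand of
  \<open>g\<close> removes the oscillation of that mean along \<open>Y\<close>.\<close>

lemma torus_closed_1_form:
  assumes u: "torus_fun u" and v: "torus_fun v" and uv: "\<And>q. dird (uv 1) v q = dird (uv 2) u q"
  shows "\<exists>g a b. torus_fun g \<and> (\<forall>q. u q = a + dird (uv 1) g q) \<and> (\<forall>q. v q = b + dird (uv 2) g q)"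
proof -
  note su = torus_smooth[OF u] note sv = torus_smooth[OF v]
  define g where "g = (\<lambda>q. prim 1 1 u q + prim 1 2 (mean 1 1 v) q)"
  have e: "dird (uv 1) v = dird (uv 2) u" using uv by blast
  note m = torus_mean_prim
  have mu: "mean 1 1 u q = mean 1 1 u 0" for q
    by (rule torus_constant)
      (simp_all add: m u dird_mean su torus_prim_mean_dird(1)[OF u] torus_prim_mean_dird(1)[OF v] flip: e)
  have "dird (uv 1) g = (\<lambda>q. u q - mean 1 1 u q)"
    unfolding g_def
    by (simp add: dird_smooth_add smooth_prim smooth_mean su sv dird_prim dird_mean
      torus_prim_mean_dird[OF u] torus_prim_mean_dird[OF v])
  moreover have "dird (uv 2) g = (\<lambda>q. v q - mean2 v q)"
    unfolding g_def
    by (simp add: dird_smooth_add smooth_prim smooth_mean su sv dird_prim mean2_def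
      torus_prim_mean_dird[OF v] torus_prim_mean_dird[OF m(1)[OF v]] flip: e)
  moreover have "torus_fun g"
    unfolding g_def by (intro torus_add m u v)
  ultimately have "torus_fun g" "u q = mean 1 1 u 0 + dird (uv 1) g q" "v q = mean2 v 0 + dird (uv 2) g q" for q
    using mu[of q] mean2_constant[OF v, of q] by simp_all
  then show ?thesis by blast
qed

text \<open>Removing the oscillation along \<open>X\<close>, and then that of the
  \<open>X\<close>-mean along \<open>Y\<close>, leaves the total mean, the only obstruction in top
  degree.\<close>

lemma torus_2_form:
  assumes f: "torus_fun f"
  shows "\<exists>g h b. torus_fun g \<and> torus_fun h \<and> (\<forall>q. f q = b + dird (uv 1) g q + dird (uv 2) h q)"
proof -
  note s = torus_smooth[OF f] note m = torus_mean_prim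
  have "dird (uv 1) (prim 1 1 f) = (\<lambda>q. f q - mean 1 1 f q)"
    by (simp add: dird_prim s torus_prim_mean_dird[OF f])
  moreover have "dird (uv 2) (prim 1 2 (mean 1 1 f)) = (\<lambda>q. mean 1 1 f q - mean2 f q)"
    by (simp add: dird_prim s smooth_mean torus_prim_mean_dird[OF m(1)[OF f]] mean2_def)
  ultimately have "f q = mean2 f 0 + dird (uv 1) (prim 1 1 f) q + dird (uv 2) (prim 1 2 (mean 1 1 f)) q" for q
    using mean2_constant[OF f, of q] by simp
  then show ?thesis
    using m(2)[OF f] m(2)[OF m(1)[OF f]] by blast
qed

text \<open>The coefficients at \<open>[]\<close>, \<open>[0]\<close>, \<open>[3]\<close> and
  \<open>[0, 3]\<close> have vanishing derivatives. Closedness also writes those at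
  \<open>[3]\<close> and \<open>[0, 3]\<close> as sums of derivatives, so these two are zero. What
  remains are closed one-forms and two-forms on the torus, multiplied by \<open>1\<close>,
  \<open>dt\<close>, \<zeta> and \<open>dt \<and> \<zeta>\<close> and coupled only through
  \<open>d\<zeta>\<close>.\<close>

lemma torus_closed_coeff:
  assumes c: "\<And>I. torus_fun (c I)" and closed: "\<And>J q. J \<in> basis \<Longrightarrow> diff_coeff c J q = 0"
  obtains a :: "nat list \<Rightarrow> real" and \<eta> where "\<And>I. torus_fun (\<eta> I)"
    "\<And>J q. J \<in> basis \<Longrightarrow> c J q = a J + diff_coeff \<eta> J q"
    "a [3] = 0" "a [0, 3] = 0" "a [1, 2] = 0" "a [0, 1, 2] = 0"
proof -
  note d = torus_deriv_along[OF c]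
  note cl = closed[unfolded diff_coeff_def]
  have z: "dird (uv 1) (c []) q = 0" "dird (uv 2) (c []) q = 0"
    "dird (uv 1) (c [0]) q = 0" "dird (uv 2) (c [0]) q = 0"
    "dird (uv 1) (c [3]) q = 0" "dird (uv 2) (c [3]) q = 0"
    "dird (uv 1) (c [0, 3]) q = 0" "dird (uv 2) (c [0, 3]) q = 0" for q
    using cl[of "[1]" q] cl[of "[2]" q] cl[of "[0, 1]" q] cl[of "[0, 2]" q] cl[of "[1, 3]" q]
      cl[of "[2, 3]" q] cl[of "[0, 1, 3]" q] cl[of "[0, 2, 3]" q]
    by (simp_all add: basis_eq d)
  have e: "c [3] q = dird (uv 2) (c [1]) q - dird (uv 1) (c [2]) q"
    "c [0, 3] q = dird (uv 2) (c [0, 1]) q - dird (uv 1) (c [0, 2]) q"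
    "dird (uv 1) (c [2, 3]) q = dird (uv 2) (c [1, 3]) q"
    "dird (uv 1) (c [0, 2, 3]) q = dird (uv 2) (c [0, 1, 3]) q" for q
    using cl[of "[1, 2]" q] cl[of "[0, 1, 2]" q] cl[of "[1, 2, 3]" q] cl[of "[0, 1, 2, 3]" q]
    by (simp_all add: basis_eq d)
  have k: "c I q = c I 0" if "I \<in> {[], [0], [3], [0, 3]}" for I q
    using that by (elim insertE emptyE; simp; intro torus_constant c z)
  \<comment> \<open>Both derivatives have total mean zero, so a constant equal to their difference
    must vanish.\<close>
  have zero: "x = 0" if "\<And>q. x = dird (uv 2) (c I) q - dird (uv 1) (c I') q" for x :: real and I I'
  proof -
    have "(\<lambda>q. dird (uv 2) (c I) q + - 1 * dird (uv 1) (c I') q) = (\<lambda>q. x)"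
      using that by simp
    then have "mean2 (\<lambda>q. dird (uv 2) (c I) q + - 1 * dird (uv 1) (c I') q) = (\<lambda>q. x)"
      by (simp add: mean2_def)
    moreover have "mean2 (\<lambda>q. dird (uv 2) (c I) q + - 1 * dird (uv 1) (c I') q) =
        (\<lambda>q. mean2 (dird (uv 2) (c I)) q + - 1 * mean2 (dird (uv 1) (c I')) q)"
      unfolding mean2_def
      by (simp only: mean_add mean_cmult smooth_cmult smooth_dird smooth_mean torus_smooth[OF c])
    ultimately show ?thesis
      by (simp add: mean2_dird[OF c] fun_eq_iff)
  qed
  have "c [3] 0 = 0"
  proof (rule zero)
    show "c [3] 0 = dird (uv 2) (c [1]) q - dird (uv 1) (c [2]) q" for q
      using e(1)[of q] k[of "[3]" q] by simp
  qed
  moreover have "c [0, 3] 0 = 0"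
  proof (rule zero)
    show "c [0, 3] 0 = dird (uv 2) (c [0, 1]) q - dird (uv 1) (c [0, 2]) q" for q
      using e(2)[of q] k[of "[0, 3]" q] by simp
  qed
  ultimately have c3: "c [3] q = 0" "c [0, 3] q = 0" for q
    using k[of "[3]" q] k[of "[0, 3]" q] by simp_all
  obtain g1 a1 a2 where g1: "torus_fun g1" "\<And>q. c [1] q = a1 + dird (uv 1) g1 q"
    "\<And>q. c [2] q = a2 + dird (uv 2) g1 q"
    using torus_closed_1_form[OF c c, of "[2]" "[1]"] e(1) c3 by auto
  obtain g2 a01 a02 where g2: "torus_fun g2" "\<And>q. c [0, 1] q = a01 + dird (uv 1) g2 q"
    "\<And>q. c [0, 2] q = a02 + dird (uv 2) g2 q"
    using torus_closed_1_form[OF c c, of "[0, 2]" "[0, 1]"] e(2) c3 by auto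
  obtain g3 a13 a23 where g3: "torus_fun g3" "\<And>q. c [1, 3] q = a13 + dird (uv 1) g3 q"
    "\<And>q. c [2, 3] q = a23 + dird (uv 2) g3 q"
    using torus_closed_1_form[OF c c, of "[2, 3]" "[1, 3]"] e(3) by auto
  obtain g4 a013 a023 where g4: "torus_fun g4" "\<And>q. c [0, 1, 3] q = a013 + dird (uv 1) g4 q"
    "\<And>q. c [0, 2, 3] q = a023 + dird (uv 2) g4 q"
    using torus_closed_1_form[OF c c, of "[0, 2, 3]" "[0, 1, 3]"] e(4) by auto
  \<comment> \<open>The coefficients at \<open>[1, 3]\<close> and \<open>[2, 3]\<close> are
    corrected by \<open>g3 \<zeta>\<close>, whose differential also contains
    \<open>g3 dX \<and> dY\<close>. That term is subtracted before the coefficient at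
    \<open>[1, 2]\<close> is treated; \<open>g4\<close> plays the same part at
    \<open>[0, 1, 2]\<close>.\<close>
  obtain f1 h1 b1 where f1: "torus_fun f1" "torus_fun h1"
    "\<And>q. c [1, 2] q - g3 q = b1 + dird (uv 1) f1 q + dird (uv 2) h1 q"
    using torus_2_form[OF torus_diff[OF c g3(1)], of "[1, 2]"] by auto
  obtain f2 h2 b2 where f2: "torus_fun f2" "torus_fun h2"
    "\<And>q. c [0, 1, 2] q - g4 q = b2 + dird (uv 1) f2 q + dird (uv 2) h2 q"
    using torus_2_form[OF torus_diff[OF c g4(1)], of "[0, 1, 2]"] by auto
  obtain f3 h3 b3 where f3: "torus_fun f3" "torus_fun h3"
    "\<And>q. c [1, 2, 3] q = b3 + dird (uv 1) f3 q + dird (uv 2) h3 q"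
    using torus_2_form[OF c, of "[1, 2, 3]"] by auto
  obtain f4 h4 b4 where f4: "torus_fun f4" "torus_fun h4"
    "\<And>q. c [0, 1, 2, 3] q = b4 + dird (uv 1) f4 q + dird (uv 2) h4 q"
    using torus_2_form[OF c, of "[0, 1, 2, 3]"] by auto
  \<comment> \<open>The constants \<open>b1\<close> and \<open>b2\<close> are absorbed into the
    coefficients of \<zeta> and \<open>dt \<and> \<zeta>\<close>, which is why nothing is left over
    at \<open>[1, 2]\<close> and \<open>[0, 1, 2]\<close>. The signs of the entries undo those in
    \<open>diff_coeff\<close>.\<close>
  define \<eta> :: "nat list \<Rightarrow> real4 \<Rightarrow> real" where "\<eta> = (\<lambda>_ _. 0)([] := g1, [0] := (\<lambda>q. - g2 q),
    [3] := (\<lambda>q. g3 q + b1), [0, 3] := (\<lambda>q. - (g4 q + b2)),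
    [2] := f1, [1] := (\<lambda>q. - h1 q), [0, 2] := (\<lambda>q. - f2 q), [0, 1] := h2,
    [2, 3] := f3, [1, 3] := (\<lambda>q. - h3 q), [0, 2, 3] := (\<lambda>q. - f4 q), [0, 1, 3] := h4)"
  define a :: "nat list \<Rightarrow> real" where "a = (\<lambda>_. 0)([] := c [] 0, [0] := c [0] 0, [1] := a1, [2] := a2,
    [0, 1] := a01, [0, 2] := a02, [1, 3] := a13, [2, 3] := a23, [0, 1, 3] := a013, [0, 2, 3] := a023,
    [1, 2, 3] := b3, [0, 1, 2, 3] := b4)"
  note t = g1(1) g2(1) g3(1) g4(1) f1(1,2) f2(1,2) f3(1,2) f4(1,2)
  have \<eta>: "torus_fun (\<eta> I)" for I
    unfolding \<eta>_def fun_upd_def by (simp add: t torus_const torus_add torus_minus torus_diff)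
  note s = t[THEN torus_smooth]
  have "c J q = a J + diff_coeff \<eta> J q" if "J \<in> basis" for J q
  proof -
    have d\<eta>: "dird v (\<eta> [3]) q = dird v g3 q" "dird v (\<eta> [0, 3]) q = - dird v g4 q"
      "dird v (\<eta> [0]) q = - dird v g2 q" "dird v (\<eta> [1]) q = - dird v h1 q"
      "dird v (\<eta> [0, 2]) q = - dird v f2 q" "dird v (\<eta> [1, 3]) q = - dird v h3 q"
      "dird v (\<eta> [0, 2, 3]) q = - dird v f4 q" for v
      unfolding \<eta>_def by (simp_all add: dird_minus dird_smooth_add dird_smooth_diff s smooth_add smooth_minus)
    have e\<eta>: "\<eta> [] = g1" "\<eta> [2] = f1" "\<eta> [0, 1] = h2" "\<eta> [2, 3] = f3" "\<eta> [0, 1, 3] = h4"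
      "\<eta> [3] q = g3 q + b1" "\<eta> [0, 3] q = - (g4 q + b2)"
      "\<eta> [1, 2] = (\<lambda>q. 0)" "\<eta> [0, 1, 2] = (\<lambda>q. 0)" "\<eta> [1, 2, 3] = (\<lambda>q. 0)"
      unfolding \<eta>_def by simp_all
    have "c J q - a J - diff_coeff \<eta> J q = 0"
      using that c3[of q] k[of "[]" q] k[of "[0]" q] g1(2,3)[of q] g2(2,3)[of q] g3(2,3)[of q]
        g4(2,3)[of q] f1(3)[of q] f2(3)[of q] f3(3)[of q] f4(3)[of q]
      unfolding basis_eq
      by (elim insertE emptyE; hypsubst;
          simp add: diff_coeff_def torus_deriv_along[OF \<eta>] t[THEN torus_deriv_along(1)]
            t[THEN torus_deriv_along(2)] t[THEN torus_deriv_along(3)] t[THEN torus_deriv_along(4)]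
            d\<eta> e\<eta> a_def)
    then show ?thesis by simp
  qed
  then show thesis
    using that[of \<eta> a] \<eta> by (simp add: a_def)
qed

text \<open>Right multiplication by \<open>(0, a, b, c)\<close> seen in straightened coordinates;
  the term with \<open>/ 2\<close> is the Heisenberg cocycle.\<close>

definition lattice_shift :: "real \<Rightarrow> real \<Rightarrow> real \<Rightarrow> real4 \<Rightarrow> real4"
  where "lattice_shift a b c q = (ct q, cx q + a, cy q + b, cz q + c + (cx q * b - a * cy q) / 2)"

definition lattice_fun :: "nat \<Rightarrow> (real4 \<Rightarrow> real) \<Rightarrow> bool"
  where "lattice_fun k f \<longleftrightarrow> smooth f \<and> (\<forall>q. f (q + period k 0 *\<^sub>R uv 0) = f q) \<and>
    (\<forall>a b c q. f (lattice_shift (of_int a) (of_int b) (of_int c / (2 * real k)) q) = f q)"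

lemma lattice_fun_const: "lattice_fun k (\<lambda>q. c)"
  by (simp add: lattice_fun_def)

lemma lattice_fun_add: "lattice_fun k f \<Longrightarrow> lattice_fun k g \<Longrightarrow> lattice_fun k (\<lambda>q. f q + g q)"
  by (simp add: lattice_fun_def smooth_add)

lemma lattice_fun_cmult: "lattice_fun k f \<Longrightarrow> lattice_fun k (\<lambda>q. c * f q)"
  by (simp add: lattice_fun_def smooth_cmult)

lemma lattice_fun_period:
  assumes "lattice_fun k f" "i = 0 \<or> i = 3"
  shows "f (q + period k i *\<^sub>R uv i) = f q"
proof -
  have "lattice_shift (of_int 0) (of_int 0) (of_int 1 / (2 * real k)) q = q + period k 3 *\<^sub>R uv 3"
    by (cases q) (simp add: lattice_shift_def period_def uv_def)
  then show ?thesis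
    using assms unfolding lattice_fun_def by metis
qed

text \<open>Translations in \<open>t\<close> and \<open>z\<close> commute with every
  \<open>lattice_shift\<close>, whose twist depends on \<open>X\<close> and \<open>Y\<close>
  alone.\<close>

lemma lattice_fun_mean_prim:
  assumes f: "lattice_fun k f" and i: "i = 0 \<or> i = 3"
  shows "lattice_fun k (mean k i f)" "lattice_fun k (prim k i f)"
proof -
  have 1: "lattice_shift a b c (q + s *\<^sub>R uv i) = lattice_shift a b c q + s *\<^sub>R uv i" for a b c q s
    using i by (cases q) (auto simp: lattice_shift_def uv_def)
  have 2: "q + s *\<^sub>R uv i + e = q + e + s *\<^sub>R uv i" for q s e
    by simp
  show "lattice_fun k (mean k i f)" "lattice_fun k (prim k i f)"
    using f mean_commute_map[where i = i and f = f and k = k and T = "lattice_shift a b c" for a b c, OF 1]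
      mean_commute_map[where i = i and f = f and k = k and T = "\<lambda>q. q + period k 0 *\<^sub>R uv 0", OF 2]
    unfolding lattice_fun_def by (simp_all add: smooth_mean smooth_prim)
qed

text \<open>Once a function ignores \<open>z\<close>, the twisted unit shifts in \<open>X\<close>
  and \<open>Y\<close> act on it as plain translations.\<close>

lemma lattice_fun_torus:
  assumes k: "k \<ge> 1" and f: "lattice_fun k f"
  shows "torus_fun (mean k 0 (mean k 3 f))"
proof -
  let ?g = "mean k 0 (mean k 3 f)"
  have s: "smooth f" using f by (simp add: lattice_fun_def)
  have g: "lattice_fun k ?g"
    by (intro lattice_fun_mean_prim f) auto
  have p: "period k 0 \<noteq> 0" "period k 3 \<noteq> 0"
    using k by (simp_all add: period_def)
  have 0: "?g (q + s *\<^sub>R uv 0) = ?g q" for q s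
    using p lattice_fun_period[OF lattice_fun_mean_prim(1)[OF f]] smooth_mean[OF s]
    by (intro mean_invariant) auto
  have "mean k 3 f (q + s *\<^sub>R uv 3) = mean k 3 f q" for q s
    using p lattice_fun_period[OF f] \<open>smooth f\<close> by (intro mean_invariant) auto
  then have 3: "?g (q + s *\<^sub>R uv 3) = ?g q" for q s
    using mean_commute_map(1)[where T = "\<lambda>q. q + s *\<^sub>R uv 3" and f = "mean k 3 f" and i = 0 and k = k and q = q]
    by (simp add: add.commute add.left_commute)
  have "?g (q + uv 1) = ?g q" for q
  proof -
    have "lattice_shift (of_int 1) (of_int 0) (of_int 0 / (2 * real k)) q =
        q + uv 1 + (- cy q / 2) *\<^sub>R uv 3"
      by (cases q) (simp add: lattice_shift_def uv_def)
    then show ?thesis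
      using g 3 unfolding lattice_fun_def by metis
  qed
  moreover have "?g (q + uv 2) = ?g q" for q
  proof -
    have "lattice_shift (of_int 0) (of_int 1) (of_int 0 / (2 * real k)) q =
        q + uv 2 + (cx q / 2) *\<^sub>R uv 3"
      by (cases q) (simp add: lattice_shift_def uv_def)
    then show ?thesis
      using g 3 unfolding lattice_fun_def by metis
  qed
  ultimately show ?thesis
    using 0 3 g unfolding torus_fun_def lattice_fun_def by simp
qed

text \<open>Lets the correction found on the torus be used as one on the whole quotient.\<close>

lemma torus_lattice_fun:
  assumes f: "torus_fun f"
  shows "lattice_fun k f"
proof -
  have int: "f (q + of_int a *\<^sub>R e) = f q" if "\<And>q. f (q + e) = f q" for q e and a :: int
  proof (induction a rule: int_induct[of _ 0])
    case (step1 a)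
    then show ?case using that[of "q + of_int a *\<^sub>R e"] by (simp add: algebra_simps)
  next
    case (step2 a)
    then show ?case using that[of "q + of_int (a - 1) *\<^sub>R e"] by (simp add: algebra_simps)
  qed simp
  have "f (lattice_shift (of_int a) (of_int b) c q) = f q" for a b c q
  proof -
    have "lattice_shift (of_int a) (of_int b) c q = q + of_int a *\<^sub>R uv 1 + of_int b *\<^sub>R uv 2 +
        (c + (cx q * of_int b - of_int a * cy q) / 2) *\<^sub>R uv 3"
      by (cases q) (simp add: lattice_shift_def uv_def)
    then show ?thesis
      using f int unfolding torus_fun_def by metis
  qed
  then show ?thesis
    using f unfolding torus_fun_def lattice_fun_def by simp
qed

section \<open>Lattice-invariant forms\<close>

text \<open>The corrections telescope: \<open>contr3\<close> accounts for \<open>c - c1\<close>,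
  \<open>contr0\<close> for \<open>c1 - c2\<close>, and the torus problem for \<open>c2\<close> up
  to constants.\<close>

lemma lattice_closed_coeff:
  assumes k: "k \<ge> 1" and c: "\<And>I. lattice_fun k (c I)"
    and closed: "\<And>J q. J \<in> basis \<Longrightarrow> diff_coeff c J q = 0"
  obtains a :: "nat list \<Rightarrow> real" and \<eta> where "\<And>I. lattice_fun k (\<eta> I)"
    "\<And>J q. J \<in> basis \<Longrightarrow> c J q = a J + diff_coeff \<eta> J q"
    "a [3] = 0" "a [0, 3] = 0" "a [1, 2] = 0" "a [0, 1, 2] = 0"
proof -
  define c1 where "c1 = (\<lambda>I. mean k 3 (c I))"
  define c2 where "c2 = (\<lambda>I. mean k 0 (c1 I))"
  have c1: "lattice_fun k (c1 I)" for I
    unfolding c1_def by (intro lattice_fun_mean_prim c) simp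
  have c2: "torus_fun (c2 I)" for I
    unfolding c1_def c2_def by (intro lattice_fun_torus k c)
  have s: "smooth (c I)" "smooth (c1 I)" for I
    using c c1 by (simp_all add: lattice_fun_def)
  have cl0: "diff_coeff c J = (\<lambda>q. 0)" if "J \<in> basis" for J
    using closed that by blast
  have cl1: "diff_coeff c1 J q = 0" if "J \<in> basis" for J q
    using diff_coeff_mean[of c 3 k J] s that by (simp add: cl0 flip: c1_def)
  then have "diff_coeff c1 J = (\<lambda>q. 0)" if "J \<in> basis" for J
    using that by blast
  then have cl2: "diff_coeff c2 J q = 0" if "J \<in> basis" for J q
    using diff_coeff_mean[of c1 0 k J] s that by (simp flip: c2_def)
  obtain a \<eta>0 where \<eta>0: "\<And>I. torus_fun (\<eta>0 I)"
    "\<And>J q. J \<in> basis \<Longrightarrow> c2 J q = a J + diff_coeff \<eta>0 J q"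
    and a: "a [3] = 0" "a [0, 3] = 0" "a [1, 2] = 0" "a [0, 1, 2] = 0"
    by (rule torus_closed_coeff[of c2, OF c2 cl2], assumption) (rule that)
  define \<eta> where "\<eta> = (\<lambda>I q. (contr3 k c I q + contr0 k c1 I q) + \<eta>0 I q)"
  have l: "lattice_fun k (contr3 k c I)" "lattice_fun k (contr0 k c1 I)" "lattice_fun k (\<eta>0 I)" for I
    by (auto simp: contr3_def contr0_def intro!: lattice_fun_const lattice_fun_cmult
        lattice_fun_mean_prim c c1) (rule torus_lattice_fun[OF \<eta>0(1)])
  have "lattice_fun k (\<eta> I)" for I
    unfolding \<eta>_def by (intro lattice_fun_add l)
  moreover have "c J q = a J + diff_coeff \<eta> J q" if J: "J \<in> basis" for J q
  proof -
    have sl: "smooth (contr3 k c I)" "smooth (contr0 k c1 I)" "smooth (\<eta>0 I)" for I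
      using l by (simp_all add: lattice_fun_def)
    have "diff_coeff \<eta> J q = diff_coeff (contr3 k c) J q + diff_coeff (contr0 k c1) J q + diff_coeff \<eta>0 J q"
      unfolding \<eta>_def by (simp add: diff_coeff_add smooth_add sl)
    also have "diff_coeff (contr3 k c) J q = c J q - c1 J q"
      unfolding c1_def using closed J lattice_fun_period[OF c] by (intro diff_coeff_contr3 s) auto
    also have "diff_coeff (contr0 k c1) J q = c1 J q - c2 J q"
      unfolding c2_def using cl1 J lattice_fun_period[OF c1] by (intro diff_coeff_contr0 s) auto
    finally show ?thesis
      using \<eta>0(2)[OF J, of q] by simp
  qed
  ultimately show thesis
    using a by (rule that)
qed

lemma mean2_deriv_along:
  assumes "torus_fun f" "i < 4"
  shows "mean2 (deriv_along i f) = (\<lambda>q. 0)"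
proof -
  have "i = 0 \<or> i = 1 \<or> i = 2 \<or> i = 3" using assms by linarith
  moreover have "mean2 (\<lambda>q. 0) = (\<lambda>q. 0)" by (simp add: mean2_def)
  moreover have "deriv_along 0 f = (\<lambda>q. 0)" "deriv_along 3 f = (\<lambda>q. 0)"
    "deriv_along 1 f = dird (uv 1) f" "deriv_along 2 f = dird (uv 2) f"
    by (rule ext, rule torus_deriv_along[OF assms(1)])+
  ultimately show ?thesis
    using mean2_dird[OF assms(1)] by (elim disjE) simp_all
qed

text \<open>Averaging in all four directions kills every derivative and keeps the constant. Only the
  contribution of \<open>d\<zeta>\<close> could survive, hence the two excluded words.\<close>

lemma lattice_exact_constant:
  assumes k: "k \<ge> 1" and c: "\<And>I. lattice_fun k (c I)"
    and exact: "\<And>q. diff_coeff c J q = a" and J: "J \<in> basis" "J \<noteq> [1, 2]" "J \<noteq> [0, 1, 2]"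
  shows "a = 0"
proof -
  define c2 where "c2 = (\<lambda>I. mean k 0 (mean k 3 (c I)))"
  have c2: "torus_fun (c2 I)" for I
    unfolding c2_def by (intro lattice_fun_torus k c)
  have s: "smooth (c I)" "smooth (mean k 3 (c I))" for I
    using c by (simp_all add: lattice_fun_def smooth_mean)
  have "diff_coeff c J = (\<lambda>q. a)"
    using exact by blast
  then have "diff_coeff c2 J = (\<lambda>q. a)"
    unfolding c2_def using diff_coeff_mean[of "\<lambda>I. mean k 3 (c I)" 0 k J] diff_coeff_mean[of c 3 k J] s by simp
  then have "mean2 (diff_coeff c2 J) = (\<lambda>q. a)"
    by (simp add: mean2_def)
  moreover have "mean2 (diff_coeff c2 J) = (\<lambda>q. \<Sum>j<length J. (-1) ^ j *
      mean2 (deriv_along (J ! j) (c2 (take j J @ drop (Suc j) J))) q)"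
  proof -
    have sd: "smooth (deriv_along i (c2 I))" for i I
      by (intro smooth_deriv_along torus_smooth c2)
    show ?thesis
      unfolding diff_coeff_def[abs_def] mean2_def using J(2,3)
      by (simp add: mean_sum smooth_cmult smooth_mean sd mean_cmult)
  qed
  moreover have "mean2 (deriv_along (J ! j) (c2 I)) = (\<lambda>q. 0)" if "j < length J" for j I
    using J(1) nth_mem[OF that] by (intro mean2_deriv_along c2) (auto simp: basis_iff)
  ultimately show ?thesis
    by (simp add: fun_eq_iff)
qed

section \<open>Right multiplication in the group and invariance of the coframe\<close>

definition osc_jac :: "real4 \<Rightarrow> real4 \<Rightarrow> real4 \<Rightarrow> real4"
  where "osc_jac l p w =
    (let u = cx l * cos (ct p) + cy l * sin (ct p); v = - cx l * sin (ct p) + cy l * cos (ct p)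
     in (ct w, cx w + v * ct w, cy w - u * ct w,
         cz w + 1/2 * (cx w * v - cx p * (u * ct w) - v * ct w * cy p - u * cy w)))"

lemma osc_mult_eq: "osc_mult p l =
    (let u = cx l * cos (ct p) + cy l * sin (ct p); v = - cx l * sin (ct p) + cy l * cos (ct p)
     in (ct p + ct l, cx p + u, cy p + v, cz p + cz l + 1/2 * (cx p * v - u * cy p)))"
  by (cases p; cases l) (simp add: Let_def)

lemma osc_mult_has_derivative: "((\<lambda>p. osc_mult p l) has_derivative osc_jac l p) (at p)"
  unfolding osc_mult_eq osc_jac_def Let_def
  by (auto intro!: derivative_eq_intros simp: fun_eq_iff)
    (simp_all add: algebra_simps add_divide_distrib diff_divide_distrib)

lemma osc_mult_t: "osc_mult p (s, 0, 0, 0) = p + (s, 0, 0, 0)"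
  by (cases p) simp

lemma osc_jac_t: "osc_jac (s, 0, 0, 0) p w = w"
  by (cases w) (simp add: osc_jac_def)

text \<open>The \<open>t\<close>-component of a lattice element can be taken out as a final
  translation, whose derivative is the identity. Invariance under the lattice thus splits into a
  Heisenberg part and one translation in \<open>t\<close>.\<close>

lemma osc_mult_split: "osc_mult p (s, a, b, c) = osc_mult p (0, a, b, c) + (s, 0, 0, 0)"
  by (cases p) (simp add: Let_def)

lemma osc_jac_split: "osc_jac (s, a, b, c) = osc_jac (0, a, b, c)"
  by (simp add: osc_jac_def fun_eq_iff)

lemma straighten_osc_mult:
  "straighten (osc_mult p (0, a, b, c)) = lattice_shift a b c (straighten p)"
proof -
  obtain t x y z where p: "p = (t, x, y, z)" by (cases p)
  have sc: "cos t * cos t + sin t * sin t = 1" by (rule sin_cos_squared_add3)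
  have "(x + (a * cos t + b * sin t)) * cos t - (y + (b * cos t - a * sin t)) * sin t =
      x * cos t - y * sin t + a"
    "(x + (a * cos t + b * sin t)) * sin t + (y + (b * cos t - a * sin t)) * cos t =
      x * sin t + y * cos t + b"
    using sc by algebra+
  then show ?thesis
    by (simp add: p straighten_def lattice_shift_def rX_def rY_def Let_def field_simps)
qed

text \<open>A Heisenberg element adds constants to \<open>X\<close> and \<open>Y\<close>, so
  \<open>dX\<close> and \<open>dY\<close> do not change. In \<zeta> the change of \<open>dz\<close>
  is \<open>(b dX - a dY) / 2\<close>, and the change of \<open>(X dY - Y dX) / 2\<close> is its
  negative.\<close>

lemma coframe_osc_mult:
  assumes "i < 4"
  shows "coframe i (osc_mult p (0, a, b, c)) (osc_jac (0, a, b, c) p v) = coframe i p v"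
proof -
  obtain t x y z where p: "p = (t, x, y, z)" by (cases p)
  obtain t' x' y' z' where v: "v = (t', x', y', z')" by (cases v)
  have sc: "cos t * cos t + sin t * sin t = 1" by (rule sin_cos_squared_add3)
  let ?p = "osc_mult p (0, a, b, c)" and ?v = "osc_jac (0, a, b, c) p v"
  have r: "rX ?p = rX p + a" "rY ?p = rY p + b"
    using straighten_osc_mult[of p a b c] by (simp_all add: straighten_def lattice_shift_def)
  have 0: "coframe 0 ?p ?v = coframe 0 p v"
    by (simp add: coframe_def osc_jac_def Let_def)
  have "(x' + (- a * sin t + b * cos t) * t') * cos t - (y' - (a * cos t + b * sin t) * t') * sin t
      - (Y + b) * t' = x' * cos t - y' * sin t - Y * t'"
    "(x' + (- a * sin t + b * cos t) * t') * sin t + (y' - (a * cos t + b * sin t) * t') * cos t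
      + (X + a) * t' = x' * sin t + y' * cos t + X * t'" for X Y
    using sc by algebra+
  then have 12: "coframe 1 ?p ?v = coframe 1 p v" "coframe 2 ?p ?v = coframe 2 p v"
    unfolding coframe_def r by (simp_all add: osc_jac_def p v Let_def)
  have "cz ?v + (1/2 * a * coframe 2 p v - 1/2 * b * coframe 1 p v) = cz v"
    by (simp add: coframe_def rX_def rY_def osc_jac_def p v Let_def field_simps)
  then have "coframe 3 ?p ?v = coframe 3 p v"
    unfolding coframe_3 r 12 by (simp add: algebra_simps add_divide_distrib)
  moreover have "i = 0 \<or> i = 1 \<or> i = 2 \<or> i = 3" using assms by linarith
  ultimately show ?thesis
    using 0 12 by (elim disjE) simp_all
qed

lemma w1_map: "(\<And>v. \<theta> (f v) = \<theta>' v) \<Longrightarrow> (\<And>us. \<beta> (map f us) = \<beta>' us) \<Longrightarrow>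
    w1 \<theta> \<beta> (map f vs) = w1 \<theta>' \<beta>' vs"
proof (induction vs arbitrary: \<beta> \<beta>')
  case (Cons v vs)
  have "w1 \<theta> (\<lambda>us. \<beta> (f v # us)) (map f vs) = w1 \<theta>' (\<lambda>us. \<beta>' (v # us)) vs"
  proof (rule Cons.IH)
    show "\<beta> (f v # map f us) = \<beta>' (v # us)" for us
      using Cons.prems(2)[of "v # us"] by simp
  qed (rule Cons.prems)
  then show ?case
    using Cons.prems by simp
qed simp

lemma cowedge_osc_mult:
  assumes "set I \<subseteq> {..<4}"
  shows "cowedge I (osc_mult p (0, a, b, c)) (map (osc_jac (0, a, b, c) p) vs) = cowedge I p vs"
  using assms
proof (induction I arbitrary: vs)
  case Nil
  show ?case by (simp add: unit0_def)
next
  case (Cons i I)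
  then show ?case
    unfolding cowedge_Cons by (intro w1_map coframe_osc_mult) auto
qed

text \<open>Duality transfers the invariance of the coframe to the frame: a vector is determined by
  its coframe values.\<close>

lemma frame_osc_mult:
  assumes i: "i < 4"
  shows "frame i (osc_mult p (0, a, b, c)) = osc_jac (0, a, b, c) p (frame i p)"
proof -
  let ?p = "osc_mult p (0, a, b, c)" and ?v = "osc_jac (0, a, b, c) p (frame i p)"
  have "?v = (\<Sum>j<4. coframe j ?p ?v *\<^sub>R frame j ?p)"
    by (simp only: frame_expansion)
  also have "\<dots> = (\<Sum>j<4. (if j = i then 1 else 0) *\<^sub>R frame j ?p)"
    by (intro sum.cong) (auto simp: coframe_osc_mult coframe_frame i)
  also have "\<dots> = frame i ?p"
    using i by (simp add: if_distrib[of "\<lambda>x. x *\<^sub>R _"] cong: if_cong)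
  finally show ?thesis ..
qed

definition invariant_forms :: "real4 set \<Rightarrow> nat \<Rightarrow> (real4 \<Rightarrow> real4 list \<Rightarrow> real) set"
  where "invariant_forms L n = {w. (\<forall>p. alt n (w p)) \<and> smooth_field w \<and>
    (\<forall>l\<in>L. \<forall>p vs. w (osc_mult p l) (map (osc_jac l p) vs) = w p vs)}"

lemma invariant_forms_lattice_iff:
  "w \<in> invariant_forms (osc_lattice k \<theta>) n \<longleftrightarrow> (\<forall>p. alt n (w p)) \<and> smooth_field w \<and>
    (\<forall>a b c :: int. \<forall>p vs. w (osc_mult p (0, of_int a, of_int b, of_int c / (2 * real k)))
      (map (osc_jac (0, of_int a, of_int b, of_int c / (2 * real k)) p) vs) = w p vs) \<and>
    (\<forall>p vs. w (p + (\<theta>, 0, 0, 0)) vs = w p vs)" (is "?l \<longleftrightarrow> ?r")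
proof
  assume l: ?l
  have inv: "w (osc_mult p (\<theta> * of_int m, of_int a, of_int b, of_int c / (2 * real k)))
      (map (osc_jac (\<theta> * of_int m, of_int a, of_int b, of_int c / (2 * real k)) p) vs) = w p vs"
    for m a b c p vs
    using l unfolding invariant_forms_def osc_lattice_def by blast
  have "w (p + (\<theta>, 0, 0, 0)) vs = w p vs" for p vs
    using inv[of p 1 0 0 0] by (simp add: osc_mult_t osc_jac_t[abs_def])
  then show ?r
    using l inv[of _ 0] by (simp add: invariant_forms_def)
next
  assume r: ?r
  have t: "w (p + (\<theta> * of_int m, 0, 0, 0)) vs = w p vs" for m p vs
  proof (induction m arbitrary: p rule: int_induct[of _ 0])
    case base
    have "p + (\<theta> * of_int 0, 0, 0, 0) = p" by (cases p) simp
    then show ?case by simp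
  next
    case (step1 m)
    have e: "p + (\<theta> * of_int (m + 1), 0, 0, 0) = p + (\<theta> * of_int m, 0, 0, 0) + (\<theta>, 0, 0, 0)"
      by (cases p) (simp add: algebra_simps)
    show ?case unfolding e using r step1 by simp
  next
    case (step2 m)
    have e: "p + (\<theta> * of_int m, 0, 0, 0) = p + (\<theta> * of_int (m - 1), 0, 0, 0) + (\<theta>, 0, 0, 0)"
      by (cases p) (simp add: algebra_simps)
    show ?case using step2(2)[of p] r unfolding e by simp
  qed
  have "w (osc_mult p l) (map (osc_jac l p) vs) = w p vs" if "l \<in> osc_lattice k \<theta>" for l p vs
  proof -
    obtain m a b c where l: "l = (\<theta> * of_int m, of_int a, of_int b, of_int c / (2 * real k))"
      using \<open>l \<in> _\<close> unfolding osc_lattice_def by blast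
    show ?thesis
      unfolding l osc_jac_split[of "\<theta> * of_int m"]
      using osc_mult_split[of p "\<theta> * of_int m"] t r by simp
  qed
  then show ?l
    using r by (simp add: invariant_forms_def)
qed

lemma coframe_shift_2pi: "coframe i (p + (2 * pi, 0, 0, 0)) = coframe i p"
  by (cases p) (simp add: coframe_def fun_eq_iff rX_def rY_def)

lemma cowedge_shift_2pi: "cowedge I (p + (2 * pi, 0, 0, 0)) = cowedge I p"
  by (induction I) (simp_all add: cowedge_Cons coframe_shift_2pi)

lemma frame_shift_2pi: "frame i (p + (2 * pi, 0, 0, 0)) = frame i p"
  by (cases p) (simp add: frame_def rX_def rY_def)

lemma straighten_shift_2pi: "straighten (p + (2 * pi, 0, 0, 0)) = straighten p + period k 0 *\<^sub>R uv 0"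
  by (cases p) (simp add: straighten_def rX_def rY_def period_def uv_def)

text \<open>All four coframe elements return to themselves after a full turn of \<open>t\<close>;
  smaller turns rotate \<open>dX\<close> and \<open>dY\<close>, so here the \<open>t\<close>-period
  is \<open>2 * pi\<close>.\<close>

lemma form_of_invariant:
  assumes "\<And>I. lattice_fun k (c I)" "\<And>I q. length I \<noteq> n \<Longrightarrow> c I q = 0"
  shows "form_of c \<in> invariant_forms (osc_lattice k (2 * pi)) n"
  unfolding invariant_forms_lattice_iff
proof (intro conjI allI)
  show "alt n (form_of c p)" for p
    by (rule alt_form_of) (rule assms)
  show "smooth_field (form_of c)"
    using assms(1) by (intro smooth_field_form_of) (simp add: lattice_fun_def)
  show "form_of c (p + (2 * pi, 0, 0, 0)) vs = form_of c p vs" for p vs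
    using assms(1) unfolding form_of_def straighten_shift_2pi[of p k] cowedge_shift_2pi lattice_fun_def
    by simp
  show "form_of c (osc_mult p (0, of_int a, of_int b, of_int d / (2 * real k)))
      (map (osc_jac (0, of_int a, of_int b, of_int d / (2 * real k)) p) vs) = form_of c p vs"
    for a b d p vs
    unfolding form_of_def straighten_osc_mult
    using assms(1) by (intro sum.cong) (auto simp: cowedge_osc_mult basis_iff lattice_fun_def)
qed

lemma lattice_fun_coeff:
  assumes w: "w \<in> invariant_forms (osc_lattice k (2 * pi)) n" and I: "I \<in> basis"
  shows "lattice_fun k (coeff w I)"
proof -
  have w': "\<And>p. alt n (w p)" "smooth_field w"
    and inv: "\<And>a b c p vs. w (osc_mult p (0, of_int a, of_int b, of_int c / (2 * real k)))
      (map (osc_jac (0, of_int a, of_int b, of_int c / (2 * real k)) p) vs) = w p vs"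
    "\<And>p vs. w (p + (2 * pi, 0, 0, 0)) vs = w p vs"
    using w unfolding invariant_forms_lattice_iff by blast+
  have 1: "unstraighten (lattice_shift a b c q) = osc_mult (unstraighten q) (0, a, b, c)" for a b c q
    by (metis straighten_osc_mult straighten_unstraighten unstraighten_straighten)
  have 2: "unstraighten (q + period k 0 *\<^sub>R uv 0) = unstraighten q + (2 * pi, 0, 0, 0)" for q
    by (metis straighten_shift_2pi straighten_unstraighten unstraighten_straighten)
  have 3: "map (\<lambda>i. frame i (osc_mult p (0, a, b, c))) I =
      map (osc_jac (0, a, b, c) p) (map (\<lambda>i. frame i p) I)" for p a b c
    using I by (auto simp: basis_iff frame_osc_mult)
  show ?thesis
    unfolding lattice_fun_def coeff_def[of w I] 1 2 3 frame_shift_2pi inv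
    using smooth_coeff[OF w'(2,1), of I] by (simp add: coeff_def[abs_def])
qed

section \<open>Representatives of the cohomology classes\<close>

definition const_form :: "(nat list \<Rightarrow> real) \<Rightarrow> real4 \<Rightarrow> real4 list \<Rightarrow> real"
  where "const_form a p vs = (\<Sum>I\<in>basis. a I * cowedge I p vs)"

definition exact_forms :: "real4 set \<Rightarrow> nat \<Rightarrow> (real4 \<Rightarrow> real4 list \<Rightarrow> real) set"
  where "exact_forms L n = (case n of 0 \<Rightarrow> {\<lambda>p vs. 0} | Suc m \<Rightarrow> ext ` invariant_forms L m)"

lemma const_form_eq: "const_form a = form_of (\<lambda>I q. a I)"
  by (simp add: const_form_def form_of_def fun_eq_iff)

lemma invariant_form_coefficients:
  assumes w: "w \<in> invariant_forms (osc_lattice k (2 * pi)) n"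
  obtains c where "\<And>I. lattice_fun k (c I)" "\<And>I q. length I \<noteq> n \<Longrightarrow> c I q = 0" "form_of c = w"
proof -
  have alt: "\<And>p. alt n (w p)"
    using w unfolding invariant_forms_def by blast
  define c where "c = (\<lambda>I. if I \<in> basis then coeff w I else (\<lambda>q. 0))"
  have "form_of c = form_of (coeff w)"
    by (rule form_of_cong) (simp add: c_def)
  then have "form_of c = w"
    using form_of_coeff[of n w, OF alt] by (simp add: fun_eq_iff)
  moreover have "lattice_fun k (c I)" for I
    by (simp add: c_def lattice_fun_coeff[OF w] lattice_fun_const)
  moreover have "c I q = 0" if "length I \<noteq> n" for I q
    using coeff_length[of n w, OF alt that] by (simp add: c_def)
  ultimately show thesis
    by (rule that[rotated 2])
qed

lemma form_of_eqD:
  assumes "form_of c = form_of c'" "J \<in> basis"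
  shows "c J q = c' J q"
  using assms form_of_frame[OF assms(2), of c "unstraighten q"]
    form_of_frame[OF assms(2), of c' "unstraighten q"] by simp

lemma ext_form_of_eq: "(\<And>I. smooth (c I)) \<Longrightarrow> ext (form_of c) = form_of (diff_coeff c)"
  by (rule ext, rule ext, rule ext_form_of)

lemma const_form_exact:
  assumes k: "k \<ge> 1" and e: "const_form a \<in> exact_forms (osc_lattice k (2 * pi)) n"
    and J: "J \<in> basis" "J \<noteq> [1, 2]" "J \<noteq> [0, 1, 2]"
  shows "a J = 0"
proof (cases n)
  case 0
  then have "form_of (\<lambda>I q. a I) = form_of (\<lambda>I q. 0)"
    using e by (simp add: exact_forms_def const_form_eq form_of_def[of "\<lambda>I q. 0", abs_def])
  then show ?thesis
    using form_of_eqD J(1) by blast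
next
  case (Suc m)
  then obtain \<eta> where \<eta>: "\<eta> \<in> invariant_forms (osc_lattice k (2 * pi)) m" "const_form a = ext \<eta>"
    using e by (auto simp: exact_forms_def)
  obtain c where c: "\<And>I. lattice_fun k (c I)" "form_of c = \<eta>"
    by (rule invariant_form_coefficients[OF \<eta>(1)]) (rule that)
  have "form_of (diff_coeff c) = form_of (\<lambda>I q. a I)"
    using \<eta>(2) c ext_form_of_eq[of c] by (simp add: const_form_eq lattice_fun_def)
  then have d: "diff_coeff c J q = a J" for q
    by (rule form_of_eqD[OF _ J(1)])
  show ?thesis
    by (rule lattice_exact_constant[OF k c(1) d J])
qed

text \<open>The sixteen monomials without \<zeta> and \<open>dt \<and> \<zeta>\<close>, which are
  not closed, and without \<open>dX \<and> dY\<close> and \<open>dt \<and> dX \<and> dY\<close>,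
  which are their differentials up to sign.\<close>

definition reps_0 :: "nat list set"
  where "reps_0 = {[], [0], [1], [2], [0, 1], [0, 2], [1, 3], [2, 3], [0, 1, 3], [0, 2, 3], [1, 2, 3], [0, 1, 2, 3]}"

text \<open>\<open>lattice_closed_coeff\<close> takes no account of degrees. Here the constants are
  cut down to words of length \<open>n\<close> and the correction to words of length
  \<open>n - 1\<close>, which \<open>diff_coeff\<close> respects.\<close>

lemma closed_form_2pi:
  assumes k: "k \<ge> 1" and w: "w \<in> invariant_forms (osc_lattice k (2 * pi)) n"
    and closed: "\<And>p vs. ext w p vs = 0"
  obtains a where "\<And>I. a I \<noteq> 0 \<Longrightarrow> I \<in> reps_0 \<and> length I = n"
    "(\<lambda>p vs. w p vs - const_form a p vs) \<in> exact_forms (osc_lattice k (2 * pi)) n"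
proof -
  obtain c where c: "\<And>I. lattice_fun k (c I)" "\<And>I q. length I \<noteq> n \<Longrightarrow> c I q = 0" "form_of c = w"
    by (rule invariant_form_coefficients[OF w]) (rule that)
  have sc: "smooth (c I)" for I using c(1) by (simp add: lattice_fun_def)
  have "ext w = form_of (\<lambda>I q. 0)"
    using closed by (simp add: fun_eq_iff form_of_def)
  then have "form_of (diff_coeff c) = form_of (\<lambda>I q. 0)"
    using c(3) ext_form_of_eq[of c] sc by simp
  then have cl: "diff_coeff c J q = 0" if "J \<in> basis" for J q
    using that by (rule form_of_eqD)
  obtain a0 \<eta>0 where \<eta>0: "\<And>I. lattice_fun k (\<eta>0 I)"
    "\<And>J q. J \<in> basis \<Longrightarrow> c J q = a0 J + diff_coeff \<eta>0 J q"
    and a0: "a0 [3] = 0" "a0 [0, 3] = 0" "a0 [1, 2] = 0" "a0 [0, 1, 2] = 0"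
    by (rule lattice_closed_coeff[OF k c(1) cl], assumption) (rule that)
  define a where "a = (\<lambda>I. if I \<in> basis \<and> length I = n then a0 I else 0)"
  \<comment> \<open>Comparing \<open>Suc (length I)\<close> with \<open>n\<close> makes the
    correction zero for \<open>n = 0\<close>, as \<open>exact_forms\<close> requires.\<close>
  define \<eta> where "\<eta> = (\<lambda>I q. if Suc (length I) = n then \<eta>0 I q else 0)"
  have \<eta>: "lattice_fun k (\<eta> I)" for I
    using \<eta>0(1)[of I] by (cases "Suc (length I) = n") (simp_all add: \<eta>_def lattice_fun_const)
  then have s\<eta>: "smooth (\<eta> I)" for I
    by (simp add: lattice_fun_def)
  have d: "c J q = a J + diff_coeff \<eta> J q" if J: "J \<in> basis" for J q
  proof (cases "length J = n")
    case True
    then have "\<eta> (take j J @ drop (Suc j) J) = \<eta>0 (take j J @ drop (Suc j) J)" if "j < length J" for j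
      using that by (simp add: \<eta>_def)
    then have "(\<Sum>j<length J. (-1) ^ j * deriv_along (J ! j) (\<eta> (take j J @ drop (Suc j) J)) q) =
        (\<Sum>j<length J. (-1) ^ j * deriv_along (J ! j) (\<eta>0 (take j J @ drop (Suc j) J)) q)"
      by (intro sum.cong) (simp_all only: lessThan_iff)
    moreover have "(if J = [1, 2] then \<eta> [3] q else if J = [0, 1, 2] then - \<eta> [0, 3] q else 0) =
        (if J = [1, 2] then \<eta>0 [3] q else if J = [0, 1, 2] then - \<eta>0 [0, 3] q else 0)"
      using True by (cases "J = [1, 2]"; cases "J = [0, 1, 2]"; simp add: \<eta>_def)
    ultimately have "diff_coeff \<eta> J q = diff_coeff \<eta>0 J q"
      by (simp only: diff_coeff_def)
    then show ?thesis
      using \<eta>0(2)[OF J] J True by (simp add: a_def)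
  next
    case False
    have "\<eta> (take j J @ drop (Suc j) J) = (\<lambda>q. 0)" if "j < length J" for j
    proof -
      have "0 < length J" using that by linarith
      then show ?thesis using False that by (simp add: \<eta>_def)
    qed
    then have "(\<Sum>j<length J. (-1) ^ j * deriv_along (J ! j) (\<eta> (take j J @ drop (Suc j) J)) q) = 0"
      by (intro sum.neutral) simp
    moreover have "(if J = [1, 2] then \<eta> [3] q else if J = [0, 1, 2] then - \<eta> [0, 3] q else 0) = 0"
      using False by (cases "J = [1, 2]"; cases "J = [0, 1, 2]"; simp add: \<eta>_def)
    ultimately have "diff_coeff \<eta> J q = 0"
      by (simp only: diff_coeff_def)
    then show ?thesis
      using c(2)[OF False] False by (simp add: a_def)
  qed
  have e: "w p vs - const_form a p vs = ext (form_of \<eta>) p vs" for p vs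
  proof -
    have "w p vs - const_form a p vs = (\<Sum>I\<in>basis. c I (straighten p) * cowedge I p vs - a I * cowedge I p vs)"
      unfolding c(3)[symmetric] form_of_def const_form_def by (rule sum_subtractf[symmetric])
    also have "\<dots> = form_of (diff_coeff \<eta>) p vs"
      unfolding form_of_def by (rule sum.cong) (simp_all add: d algebra_simps)
    finally show ?thesis
      using ext_form_of_eq[of \<eta>] s\<eta> by simp
  qed
  have "(\<lambda>p vs. w p vs - const_form a p vs) \<in> exact_forms (osc_lattice k (2 * pi)) n"
  proof (cases n)
    case 0
    then have "form_of \<eta> = (\<lambda>p vs. 0)"
      by (simp add: \<eta>_def form_of_def fun_eq_iff)
    then show ?thesis
      unfolding e using 0 by (simp add: exact_forms_def ext_def)
  next
    case (Suc m)
    have "form_of \<eta> \<in> invariant_forms (osc_lattice k (2 * pi)) m"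
      using \<eta> by (rule form_of_invariant) (simp add: \<eta>_def Suc)
    then show ?thesis
      unfolding e using Suc by (simp add: exact_forms_def eta_contract_eq)
  qed
  moreover have "I \<in> reps_0 \<and> length I = n" if "a I \<noteq> 0" for I
    using that a0 by (auto simp: a_def basis_eq reps_0_def split: if_splits)
  ultimately show thesis
    by (rule that[rotated 1])
qed

section \<open>Averaging over deck translations in the t direction\<close>

definition shift_form :: "real \<Rightarrow> (real4 \<Rightarrow> real4 list \<Rightarrow> real) \<Rightarrow> real4 \<Rightarrow> real4 list \<Rightarrow> real"
  where "shift_form \<theta> w p vs = w (p + (\<theta>, 0, 0, 0)) vs"

text \<open>The form obtained by averaging over the deck group of the twofold cover from the lattice with \<open>t\<close>-period \<open>2 \<theta>\<close> to the one with period \<open>\<theta>\<close>.\<close>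

definition half_sum :: "real \<Rightarrow> (real4 \<Rightarrow> real4 list \<Rightarrow> real) \<Rightarrow> real4 \<Rightarrow> real4 list \<Rightarrow> real"
  where "half_sum \<theta> w p vs = 1/2 * w p vs + 1/2 * shift_form \<theta> w p vs"

lemma smooth_field_shift_form: "smooth_field w \<Longrightarrow> smooth_field (shift_form \<theta> w)"
  using smooth_compose_translation(1)[of "\<lambda>p. w p vs" for vs]
  by (simp add: smooth_field_def shift_form_def)

lemma ext_shift_form: "smooth_field w \<Longrightarrow> ext (shift_form \<theta> w) p vs = ext w (p + (\<theta>, 0, 0, 0)) vs"
  unfolding ext_def shift_form_def
  by (intro sum.cong refl) (simp add: smooth_compose_translation(2)[of "\<lambda>p. w p us" for us] smooth_fieldD)

lemma smooth_field_half_sum: "smooth_field w \<Longrightarrow> smooth_field (half_sum \<theta> w)"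
  unfolding half_sum_def[abs_def]
  by (intro smooth_field_add smooth_field_mult smooth_const smooth_field_shift_form)

lemma ext_half_sum: "smooth_field w \<Longrightarrow> ext (half_sum \<theta> w) = half_sum \<theta> (ext w)"
proof (intro ext)
  fix p vs assume w: "smooth_field w"
  have m: "smooth_field (\<lambda>p vs. 1/2 * u p vs)" if "smooth_field u" for u :: "real4 \<Rightarrow> real4 list \<Rightarrow> real"
    by (intro smooth_field_mult smooth_const that)
  show "ext (half_sum \<theta> w) p vs = half_sum \<theta> (ext w) p vs"
    unfolding half_sum_def[abs_def]
    by (simp only: ext_add m ext_cmult w smooth_field_shift_form ext_shift_form shift_form_def[of \<theta> "ext w"])
qed

text \<open>Translation by \<theta> in \<open>t\<close> normalizes the Heisenberg lattice: an
  integer vector rotated at time \<open>t\<close> is another integer vector rotated at time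
  \<open>t + \<theta>\<close>, the same one for all \<open>t\<close>.\<close>

definition quarter_turn :: "real \<Rightarrow> bool"
  where "quarter_turn \<theta> \<longleftrightarrow> (\<forall>a b :: int. \<exists>a' b' :: int. \<forall>t.
    of_int a' * cos (t + \<theta>) + of_int b' * sin (t + \<theta>) = of_int a * cos t + of_int b * sin t \<and>
    - of_int a' * sin (t + \<theta>) + of_int b' * cos (t + \<theta>) = - of_int a * sin t + of_int b * cos t)"

lemma quarter_turn_pi: "quarter_turn pi"
  unfolding quarter_turn_def
proof (intro allI)
  fix a b :: int
  show "\<exists>a' b' :: int. \<forall>t.
    of_int a' * cos (t + pi) + of_int b' * sin (t + pi) = of_int a * cos t + of_int b * sin t \<and>
    - of_int a' * sin (t + pi) + of_int b' * cos (t + pi) = - of_int a * sin t + of_int b * cos t"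
    by (rule exI[of _ "- a"], rule exI[of _ "- b"]) simp
qed

lemma quarter_turn_pi2: "quarter_turn (pi / 2)"
  unfolding quarter_turn_def
proof (intro allI)
  fix a b :: int
  show "\<exists>a' b' :: int. \<forall>t.
    of_int a' * cos (t + pi / 2) + of_int b' * sin (t + pi / 2) = of_int a * cos t + of_int b * sin t \<and>
    - of_int a' * sin (t + pi / 2) + of_int b' * cos (t + pi / 2) = - of_int a * sin t + of_int b * cos t"
    by (rule exI[of _ "- b"], rule exI[of _ a]) (simp add: cos_add sin_add)
qed

text \<open>Shifting by \<theta> carries one Heisenberg lattice element into another, so the shifted
  form stays invariant under that part. Two shifts make a period of \<open>w\<close>, so a further
  shift merely exchanges the two summands.\<close>

lemma invariant_forms_half_sum:
  assumes \<theta>: "quarter_turn \<theta>" and w: "w \<in> invariant_forms (osc_lattice k (2 * \<theta>)) n"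
  shows "half_sum \<theta> w \<in> invariant_forms (osc_lattice k \<theta>) n"
  unfolding invariant_forms_lattice_iff
proof (intro conjI allI)
  have w': "\<And>p. alt n (w p)" "smooth_field w"
    and inv: "\<And>a b c :: int. \<And>p vs. w (osc_mult p (0, of_int a, of_int b, of_int c / (2 * real k)))
      (map (osc_jac (0, of_int a, of_int b, of_int c / (2 * real k)) p) vs) = w p vs"
    "\<And>p vs. w (p + (2 * \<theta>, 0, 0, 0)) vs = w p vs"
    using w unfolding invariant_forms_lattice_iff by blast+
  show "alt n (half_sum \<theta> w p)" for p
    unfolding half_sum_def[abs_def] shift_form_def by (intro alt_add alt_cmult w')
  show "smooth_field (half_sum \<theta> w)"
    by (intro smooth_field_half_sum w')
  show "half_sum \<theta> w (p + (\<theta>, 0, 0, 0)) vs = half_sum \<theta> w p vs" for p vs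
  proof -
    have "p + (\<theta>, 0, 0, 0) + (\<theta>, 0, 0, 0) = p + (2 * \<theta>, 0, 0, 0)"
      by (cases p) simp
    then show ?thesis
      unfolding half_sum_def shift_form_def by (simp only: inv(2) add.commute)
  qed
  show "half_sum \<theta> w (osc_mult p (0, of_int a, of_int b, of_int c / (2 * real k)))
      (map (osc_jac (0, of_int a, of_int b, of_int c / (2 * real k)) p) vs) = half_sum \<theta> w p vs"
    (is "half_sum \<theta> w (osc_mult p ?l) _ = _") for a b c :: int and p vs
  proof -
    obtain a' b' :: int where ab: "\<And>t. of_int a' * cos (t + \<theta>) + of_int b' * sin (t + \<theta>) = of_int a * cos t + of_int b * sin t"
      "\<And>t. - of_int a' * sin (t + \<theta>) + of_int b' * cos (t + \<theta>) = - of_int a * sin t + of_int b * cos t"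
      using \<theta> unfolding quarter_turn_def by metis
    let ?l' = "(0, of_int a', of_int b', of_int c / (2 * real k)) :: real4"
    let ?q = "p + (\<theta>, 0, 0, 0)"
    obtain t x y z where p: "p = (t, x, y, z)" by (cases p)
    have 1: "osc_mult p ?l + (\<theta>, 0, 0, 0) = osc_mult ?q ?l'"
      using ab[of t] by (simp add: p osc_mult_eq Let_def)
    have 2: "osc_jac ?l p = osc_jac ?l' ?q"
      using ab[of t] by (simp add: p osc_jac_def Let_def fun_eq_iff)
    have "w (osc_mult p ?l + (\<theta>, 0, 0, 0)) (map (osc_jac ?l p) vs) = w ?q vs"
      unfolding 1 2 by (rule inv(1))
    then show ?thesis
      unfolding half_sum_def shift_form_def inv(1) by simp
  qed
qed

lemma invariant_forms_double:
  "invariant_forms (osc_lattice k \<theta>) n \<subseteq> invariant_forms (osc_lattice k (2 * \<theta>)) n"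
proof -
  have "osc_lattice k (2 * \<theta>) \<subseteq> osc_lattice k \<theta>"
    unfolding osc_lattice_def
  proof (rule subsetI)
    fix l assume "l \<in> {(2 * \<theta> * of_int m, of_int a, of_int b, of_int c / (2 * real k)) | m a b c. True}"
    then obtain m a b c :: int where "l = (2 * \<theta> * of_int m, of_int a, of_int b, of_int c / (2 * real k))"
      by blast
    then have "l = (\<theta> * of_int (2 * m), of_int a, of_int b, of_int c / (2 * real k))"
      by simp
    then show "l \<in> {(\<theta> * of_int m, of_int a, of_int b, of_int c / (2 * real k)) | m a b c. True}"
      by blast
  qed
  then show ?thesis
    unfolding invariant_forms_def by blast
qed

lemma exact_forms_double: "exact_forms (osc_lattice k \<theta>) n \<subseteq> exact_forms (osc_lattice k (2 * \<theta>)) n"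
  unfolding exact_forms_def using invariant_forms_double[of k \<theta>] by (auto split: nat.split)

lemma half_sum_fixed:
  assumes "w \<in> invariant_forms (osc_lattice k \<theta>) n"
  shows "half_sum \<theta> w = w"
  using assms unfolding invariant_forms_lattice_iff
  by (simp add: half_sum_def shift_form_def fun_eq_iff)

lemma exact_forms_half_sum:
  assumes \<theta>: "quarter_turn \<theta>" and w: "w \<in> exact_forms (osc_lattice k (2 * \<theta>)) n"
  shows "half_sum \<theta> w \<in> exact_forms (osc_lattice k \<theta>) n"
proof (cases n)
  case 0
  then show ?thesis
    using w by (simp add: exact_forms_def half_sum_def shift_form_def fun_eq_iff)
next
  case (Suc m)
  then obtain \<eta> where \<eta>: "\<eta> \<in> invariant_forms (osc_lattice k (2 * \<theta>)) m" "w = ext \<eta>"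
    using w by (auto simp: exact_forms_def)
  then have "smooth_field \<eta>"
    unfolding invariant_forms_def by blast
  then have "half_sum \<theta> w = ext (half_sum \<theta> \<eta>)"
    using \<eta>(2) by (simp add: ext_half_sum)
  then show ?thesis
    using invariant_forms_half_sum[OF \<theta> \<eta>(1)] Suc by (simp add: exact_forms_def)
qed

lemma half_sum_diff:
  "half_sum \<theta> (\<lambda>p vs. w p vs - u p vs) = (\<lambda>p vs. half_sum \<theta> w p vs - half_sum \<theta> u p vs)"
  by (simp add: half_sum_def shift_form_def fun_eq_iff algebra_simps)

text \<open>Averaging fixes \<open>w\<close>, commutes with \<open>ext\<close>, and turns the
  primitive into one that is invariant under the finer lattice.\<close>

lemma closed_form_halve:
  assumes \<theta>: "quarter_turn \<theta>" and w: "w \<in> invariant_forms (osc_lattice k \<theta>) n"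
    and "(\<lambda>p vs. w p vs - const_form a p vs) \<in> exact_forms (osc_lattice k (2 * \<theta>)) n"
    and "half_sum \<theta> (const_form a) = const_form a'"
  shows "(\<lambda>p vs. w p vs - const_form a' p vs) \<in> exact_forms (osc_lattice k \<theta>) n"
  using exact_forms_half_sum[OF \<theta> assms(3)] assms(4) half_sum_fixed[OF w] by (simp add: half_sum_diff)

lemma coframe_shift_pi:
  "coframe 0 (p + (pi, 0, 0, 0)) = coframe 0 p"
  "coframe 1 (p + (pi, 0, 0, 0)) = (\<lambda>v. - coframe 1 p v)"
  "coframe 2 (p + (pi, 0, 0, 0)) = (\<lambda>v. - coframe 2 p v)"
  "coframe 3 (p + (pi, 0, 0, 0)) = coframe 3 p"
  by (cases p; simp add: coframe_def fun_eq_iff rX_def rY_def algebra_simps)+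

lemma coframe_shift_pi2:
  "coframe 0 (p + (pi / 2, 0, 0, 0)) = coframe 0 p"
  "coframe 1 (p + (pi / 2, 0, 0, 0)) = (\<lambda>v. - coframe 2 p v)"
  "coframe 2 (p + (pi / 2, 0, 0, 0)) = coframe 1 p"
  "coframe 3 (p + (pi / 2, 0, 0, 0)) = coframe 3 p"
  by (cases p; simp add: coframe_def fun_eq_iff rX_def rY_def cos_add sin_add algebra_simps)+

definition reps_pi :: "nat list set" where "reps_pi = {[], [0], [1, 2, 3], [0, 1, 2, 3]}"

lemma w1_minus_left': "w1 (\<lambda>v. - \<theta> v) \<beta> = (\<lambda>vs. - w1 \<theta> \<beta> vs)"
  by (rule ext, rule w1_minus_left)

text \<open>A half turn negates \<open>dX\<close> and \<open>dY\<close> and fixes \<open>dt\<close>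
  and \<zeta>, so exactly the monomials with one of the indices 1 and 2, but not both, cancel
  against their translates.\<close>

lemma half_sum_const_form_pi:
  assumes "\<And>I. a I \<noteq> 0 \<Longrightarrow> I \<in> reps_0"
  shows "half_sum pi (const_form a) = const_form (\<lambda>I. if I \<in> reps_pi then a I else 0)"
proof (intro ext)
  fix p vs
  have "1/2 * (a I * cowedge I p vs) + 1/2 * (a I * cowedge I (p + (pi, 0, 0, 0)) vs) =
      (if I \<in> reps_pi then a I else 0) * cowedge I p vs" for I
  proof (cases "a I = 0")
    case False
    then have "I \<in> reps_0" by (rule assms)
    then show ?thesis
      unfolding reps_0_def reps_pi_def
      by (elim insertE emptyE; simp add: cowedge_Cons coframe_shift_pi w1_minus_left' w1_minus)
  qed simp
  then show "half_sum pi (const_form a) p vs = const_form (\<lambda>I. if I \<in> reps_pi then a I else 0) p vs"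
    unfolding half_sum_def shift_form_def const_form_def sum_distrib_left
    by (subst sum.distrib[symmetric]) simp
qed

text \<open>A quarter turn sends \<open>dX\<close> to \<open>- dY\<close> and \<open>dY\<close> to
  \<open>dX\<close>, hence fixes \<open>dX \<and> dY\<close>; the words in \<open>reps_pi\<close>
  contain 1 and 2 both or neither.\<close>

lemma half_sum_const_form_pi2:
  assumes "\<And>I. a I \<noteq> 0 \<Longrightarrow> I \<in> reps_pi"
  shows "half_sum (pi / 2) (const_form a) = const_form a"
proof (intro ext)
  fix p vs
  have s: "w1 (coframe 2 p) (w1 (coframe 1 p) \<beta>) = (\<lambda>vs. - w1 (coframe 1 p) (w1 (coframe 2 p) \<beta>) vs)" for \<beta>
    by (rule w1_anticommute)
  have "1/2 * (a I * cowedge I p vs) + 1/2 * (a I * cowedge I (p + (pi / 2, 0, 0, 0)) vs) =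
      a I * cowedge I p vs" for I
  proof (cases "a I = 0")
    case False
    then have "I \<in> reps_pi" by (rule assms)
    then show ?thesis
      unfolding reps_pi_def
      by (elim insertE emptyE; simp add: cowedge_Cons coframe_shift_pi2 w1_minus_left' w1_minus s)
  qed simp
  then show "half_sum (pi / 2) (const_form a) p vs = const_form a p vs"
    unfolding half_sum_def shift_form_def const_form_def sum_distrib_left
    by (subst sum.distrib[symmetric]) simp
qed

text \<open>The clause on exact forms leaves out \<open>[1, 2]\<close> and \<open>[0, 1, 2]\<close>, because \<open>dX dY\<close> and \<open>dt dX dY\<close> are exact.\<close>

definition cohomology_basis :: "real4 set \<Rightarrow> nat list set \<Rightarrow> bool"
  where "cohomology_basis L R \<longleftrightarrow> R \<subseteq> reps_0 \<and>
    (\<forall>n w. w \<in> invariant_forms L n \<and> (\<forall>p vs. ext w p vs = 0) \<longrightarrow>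
      (\<exists>a. (\<forall>I. a I \<noteq> 0 \<longrightarrow> I \<in> R \<and> length I = n) \<and>
        (\<lambda>p vs. w p vs - const_form a p vs) \<in> exact_forms L n)) \<and>
    (\<forall>n a J. const_form a \<in> exact_forms L n \<and> J \<in> basis \<and> J \<noteq> [1, 2] \<and> J \<noteq> [0, 1, 2] \<longrightarrow> a J = 0) \<and>
    (\<forall>n a. (\<forall>I. a I \<noteq> 0 \<longrightarrow> I \<in> R \<and> length I = n) \<longrightarrow> const_form a \<in> invariant_forms L n)"

lemma const_form_invariant_2pi:
  assumes "\<And>I. a I \<noteq> 0 \<Longrightarrow> length I = n"
  shows "const_form a \<in> invariant_forms (osc_lattice k (2 * pi)) n"
  unfolding const_form_eq by (rule form_of_invariant) (use assms lattice_fun_const in auto)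

lemma cohomology_basis_2pi:
  assumes "k \<ge> 1"
  shows "cohomology_basis (osc_lattice k (2 * pi)) reps_0"
  unfolding cohomology_basis_def
proof (intro conjI allI impI)
  fix n w assume "w \<in> invariant_forms (osc_lattice k (2 * pi)) n \<and> (\<forall>p vs. ext w p vs = 0)"
  then have w: "w \<in> invariant_forms (osc_lattice k (2 * pi)) n" "\<And>p vs. ext w p vs = 0"
    by blast+
  obtain a where a: "\<And>I. a I \<noteq> 0 \<Longrightarrow> I \<in> reps_0 \<and> length I = n"
    "(\<lambda>p vs. w p vs - const_form a p vs) \<in> exact_forms (osc_lattice k (2 * pi)) n"
    by (rule closed_form_2pi[OF assms w]) (rule that)
  show "\<exists>a. (\<forall>I. a I \<noteq> 0 \<longrightarrow> I \<in> reps_0 \<and> length I = n) \<and>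
        (\<lambda>p vs. w p vs - const_form a p vs) \<in> exact_forms (osc_lattice k (2 * pi)) n"
    by (intro exI[of _ a] conjI allI impI a)
next
  fix n a J
  assume "const_form a \<in> exact_forms (osc_lattice k (2 * pi)) n \<and> J \<in> basis \<and> J \<noteq> [1, 2] \<and> J \<noteq> [0, 1, 2]"
  then show "a J = 0"
    using const_form_exact[OF assms] by blast
next
  fix n and a :: "nat list \<Rightarrow> real" assume "\<forall>I. a I \<noteq> 0 \<longrightarrow> I \<in> reps_0 \<and> length I = n"
  then show "const_form a \<in> invariant_forms (osc_lattice k (2 * pi)) n"
    by (intro const_form_invariant_2pi) auto
qed simp

text \<open>Representatives are obtained by averaging. Independence needs no averaging: a primitive
  on the quotient is in particular one on the twofold cover.\<close>

lemma cohomology_basis_halve: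
  assumes B: "cohomology_basis (osc_lattice k (2 * \<theta>)) R" and \<theta>: "quarter_turn \<theta>" and R': "R' \<subseteq> R"
    and fold: "\<And>a. (\<And>I. a I \<noteq> 0 \<Longrightarrow> I \<in> R) \<Longrightarrow>
      half_sum \<theta> (const_form a) = const_form (\<lambda>I. if I \<in> R' then a I else 0)"
  shows "cohomology_basis (osc_lattice k \<theta>) R'"
proof -
  note B0 = B[unfolded cohomology_basis_def, THEN conjunct1]
    and B1 = B[unfolded cohomology_basis_def, THEN conjunct2, THEN conjunct1, rule_format]
    and B2 = B[unfolded cohomology_basis_def, THEN conjunct2, THEN conjunct2, THEN conjunct1, rule_format]
    and B3 = B[unfolded cohomology_basis_def, THEN conjunct2, THEN conjunct2, THEN conjunct2, rule_format]
  show ?thesis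
  unfolding cohomology_basis_def
proof (intro conjI allI impI)
  show "R' \<subseteq> reps_0"
    using B0 R' by (rule order_trans[rotated])
next
  fix n w assume w: "w \<in> invariant_forms (osc_lattice k \<theta>) n \<and> (\<forall>p vs. ext w p vs = 0)"
  then have "w \<in> invariant_forms (osc_lattice k (2 * \<theta>)) n \<and> (\<forall>p vs. ext w p vs = 0)"
    using invariant_forms_double by auto
  from B1[OF this] obtain a where a': "\<forall>I. a I \<noteq> 0 \<longrightarrow> I \<in> R \<and> length I = n"
    "(\<lambda>p vs. w p vs - const_form a p vs) \<in> exact_forms (osc_lattice k (2 * \<theta>)) n"
    by (elim exE conjE) (rule that)
  note a = a'(1)[rule_format] a'(2)
  let ?a = "\<lambda>I. if I \<in> R' then a I else 0"
  have "(\<lambda>p vs. w p vs - const_form ?a p vs) \<in> exact_forms (osc_lattice k \<theta>) n"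
  proof (rule closed_form_halve[OF \<theta> _ a(2)])
    show "w \<in> invariant_forms (osc_lattice k \<theta>) n"
      using w by simp
    show "half_sum \<theta> (const_form a) = const_form ?a"
      by (rule fold) (use a(1) in simp)
  qed
  then show "\<exists>a. (\<forall>I. a I \<noteq> 0 \<longrightarrow> I \<in> R' \<and> length I = n) \<and>
        (\<lambda>p vs. w p vs - const_form a p vs) \<in> exact_forms (osc_lattice k \<theta>) n"
    using a(1) by (intro exI[of _ ?a]) auto
next
  fix n a J
  assume "const_form a \<in> exact_forms (osc_lattice k \<theta>) n \<and> J \<in> basis \<and> J \<noteq> [1, 2] \<and> J \<noteq> [0, 1, 2]"
  then show "a J = 0"
    using B2[of a n J] exact_forms_double[of k \<theta> n] by auto
next
  fix n and a :: "nat list \<Rightarrow> real" assume a: "\<forall>I. a I \<noteq> 0 \<longrightarrow> I \<in> R' \<and> length I = n"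
  have "(\<lambda>I. if I \<in> R' then a I else 0) = a"
    by (rule ext) (use a in auto)
  moreover have "half_sum \<theta> (const_form a) = const_form (\<lambda>I. if I \<in> R' then a I else 0)"
    by (rule fold) (use a R' in auto)
  ultimately have e: "half_sum \<theta> (const_form a) = const_form a"
    by simp
  have "const_form a \<in> invariant_forms (osc_lattice k (2 * \<theta>)) n"
    by (rule B3) (use a R' in auto)
  from invariant_forms_half_sum[OF \<theta> this] show "const_form a \<in> invariant_forms (osc_lattice k \<theta>) n"
    unfolding e .
qed
qed

lemma cohomology_basis_pi:
  assumes "k \<ge> 1"
  shows "cohomology_basis (osc_lattice k pi) reps_pi"
proof (rule cohomology_basis_halve[OF cohomology_basis_2pi[OF assms] quarter_turn_pi])
  show "reps_pi \<subseteq> reps_0"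
    by (simp add: reps_pi_def reps_0_def)
qed (rule half_sum_const_form_pi)

lemma cohomology_basis_pi2:
  assumes "k \<ge> 1"
  shows "cohomology_basis (osc_lattice k (pi / 2)) reps_pi"
proof (rule cohomology_basis_halve[OF _ quarter_turn_pi2 order_refl])
  show "cohomology_basis (osc_lattice k (2 * (pi / 2))) reps_pi"
    using cohomology_basis_pi[OF assms] by simp
  fix a :: "nat list \<Rightarrow> real" assume a: "\<And>I. a I \<noteq> 0 \<Longrightarrow> I \<in> reps_pi"
  have "(\<lambda>I. if I \<in> reps_pi then a I else 0) = a"
    by (rule ext) (use a in auto)
  then show "half_sum (pi / 2) (const_form a) = const_form (\<lambda>I. if I \<in> reps_pi then a I else 0)"
    using half_sum_const_form_pi2[OF a] by simp
qed

section \<open>The de Rham algebra of the quotient\<close>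

text \<open>What makes cocycles and coboundaries subspaces; the comparison of cohomology classes
  takes place at this linear level.\<close>

definition linear_dga :: "('a::real_vector) dga \<Rightarrow> bool"
  where "linear_dga A \<longleftrightarrow> (\<forall>n. subspace (component A n) \<and>
    (\<forall>a\<in>component A n. \<forall>b\<in>component A n. gdiff A (a + b) = gdiff A a + gdiff A b) \<and>
    (\<forall>a\<in>component A n. \<forall>c. gdiff A (c *\<^sub>R a) = c *\<^sub>R gdiff A a))"

context
  fixes A :: "('a::real_vector) dga"
  assumes A: "linear_dga A"
begin

lemma dga_component: "subspace (component A n)"
  and dga_diff_add: "a \<in> component A n \<Longrightarrow> b \<in> component A n \<Longrightarrow> gdiff A (a + b) = gdiff A a + gdiff A b"
  and dga_diff_scale: "a \<in> component A n \<Longrightarrow> gdiff A (c *\<^sub>R a) = c *\<^sub>R gdiff A a"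
  using A unfolding linear_dga_def by blast+

lemma dga_diff_zero: "gdiff A 0 = 0"
  using dga_diff_scale[OF subspace_0[OF dga_component], of 0] by simp

lemma subspace_cocycles: "subspace (cocycles A j)"
  unfolding subspace_def cocycles_def
  using dga_component[of j, unfolded subspace_def] dga_diff_add dga_diff_scale dga_diff_zero
  by auto

lemma subspace_coboundaries: "subspace (coboundaries A j)"
proof (cases j)
  case 0
  then show ?thesis by (simp add: coboundaries_def subspace_0 subspace_def)
next
  case (Suc i)
  show ?thesis
    unfolding subspace_def coboundaries_def Suc nat.case
  proof (intro conjI ballI allI)
    show "0 \<in> gdiff A ` component A i"
      using subspace_0[OF dga_component] dga_diff_zero by (metis imageI)
  next
    fix x y assume "x \<in> gdiff A ` component A i" "y \<in> gdiff A ` component A i"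
    then obtain a b where "x = gdiff A a" "y = gdiff A b" "a \<in> component A i" "b \<in> component A i"
      by blast
    then show "x + y \<in> gdiff A ` component A i"
      using dga_diff_add subspace_add[OF dga_component] by (metis imageI)
  next
    fix c x assume "x \<in> gdiff A ` component A i"
    then obtain a where "x = gdiff A a" "a \<in> component A i"
      by blast
    then show "c *\<^sub>R x \<in> gdiff A ` component A i"
      using dga_diff_scale subspace_scale[OF dga_component] by (metis imageI)
  qed
qed

lemma equiv_cohomologous: "equiv (cocycles A j) (cohomologous A j)"
proof (rule equivI)
  show "cohomologous A j \<subseteq> cocycles A j \<times> cocycles A j"
    by (auto simp: cohomologous_def)
  show "refl_on (cocycles A j) (cohomologous A j)"
    by (rule refl_onI) (simp add: cohomologous_def subspace_0[OF subspace_coboundaries])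
  show "sym (cohomologous A j)"
  proof (rule symI)
    fix a b assume "(a, b) \<in> cohomologous A j"
    then show "(b, a) \<in> cohomologous A j"
      using subspace_neg[OF subspace_coboundaries, of "a - b" j] by (simp add: cohomologous_def)
  qed
  show "trans (cohomologous A j)"
  proof (rule transI)
    fix a b c assume "(a, b) \<in> cohomologous A j" "(b, c) \<in> cohomologous A j"
    then show "(a, c) \<in> cohomologous A j"
      using subspace_add[OF subspace_coboundaries, of "a - b" j "b - c"] by (simp add: cohomologous_def)
  qed
qed

lemma coh_class_eq_iff:
  "a \<in> cocycles A j \<Longrightarrow> b \<in> cocycles A j \<Longrightarrow>
    coh_class A j a = coh_class A j b \<longleftrightarrow> a - b \<in> coboundaries A j"
  unfolding coh_class_def eq_equiv_class_iff[OF equiv_cohomologous] by (simp add: cohomologous_def)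

lemma cohomology_eq: "cohomology A j = coh_class A j ` cocycles A j"
  unfolding cohomology_def quotient_def coh_class_def by auto

text \<open>Moves from classes to cocycles modulo coboundaries. Uniqueness of the coefficients is
  independence applied to the difference of two expansions.\<close>

lemma cohomology_dimI:
  assumes h: "\<And>i. i < n \<Longrightarrow> h i \<in> cocycles A j"
    and span: "\<And>a. a \<in> cocycles A j \<Longrightarrow> \<exists>c. a - (\<Sum>i<n. c i *\<^sub>R h i) \<in> coboundaries A j"
    and indep: "\<And>c i. (\<Sum>i<n. c i *\<^sub>R h i) \<in> coboundaries A j \<Longrightarrow> i < n \<Longrightarrow> c i = 0"
  shows "cohomology_dim A j n"
  unfolding cohomology_dim_def
proof (intro exI[of _ h] conjI allI impI ballI)
  show "h i \<in> cocycles A j" if "i < n" for i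
    by (rule h[OF that])
  have s: "(\<Sum>i<n. c i *\<^sub>R h i) \<in> cocycles A j" for c
    by (intro subspace_sum[OF subspace_cocycles] subspace_scale[OF subspace_cocycles] h) simp
  fix \<xi> assume "\<xi> \<in> cohomology A j"
  then obtain a where a: "\<xi> = coh_class A j a" "a \<in> cocycles A j"
    unfolding cohomology_eq by blast
  obtain c where c: "a - (\<Sum>i<n. c i *\<^sub>R h i) \<in> coboundaries A j"
    using span[OF a(2)] by blast
  \<comment> \<open>\<open>cohomology_dim\<close> makes coefficients unique by requiring them to
    vanish from \<open>n\<close> on, so the witness is cut off there.\<close>
  define c' where "c' i = (if i < n then c i else 0)" for i
  show "\<exists>!c :: nat \<Rightarrow> real. (\<forall>i\<ge>n. c i = 0) \<and> \<xi> = coh_class A j (\<Sum>i<n. c i *\<^sub>R h i)"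
  proof (rule ex1I[of _ c'])
    show "(\<forall>i\<ge>n. c' i = 0) \<and> \<xi> = coh_class A j (\<Sum>i<n. c' i *\<^sub>R h i)"
      using c a(2) unfolding a(1) by (simp add: c'_def coh_class_eq_iff[OF _ s])
  next
    fix d assume d: "(\<forall>i\<ge>n. d i = 0) \<and> \<xi> = coh_class A j (\<Sum>i<n. d i *\<^sub>R h i)"
    then have "a - (\<Sum>i<n. d i *\<^sub>R h i) \<in> coboundaries A j"
      using a(2) unfolding a(1) by (simp add: coh_class_eq_iff[OF _ s])
    from subspace_diff[OF subspace_coboundaries c this]
    have "(\<Sum>i<n. (d i - c i) *\<^sub>R h i) \<in> coboundaries A j"
      by (simp add: sum_subtractf scaleR_left_diff_distrib)
    then have "d i - c i = 0" if "i < n" for i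
      using indep[of "\<lambda>i. d i - c i" i] that by simp
    then show "d = c'"
      using d by (auto simp: c'_def fun_eq_iff not_less)
  qed
qed

end

lemma quasi_isomorphismI:
  fixes A :: "('a::real_vector) dga" and B :: "('b::real_vector) dga"
  assumes A: "linear_dga A" and B: "linear_dga B" and hom: "dga_hom A B \<phi>"
    and inj: "\<And>j a. a \<in> cocycles A j \<Longrightarrow> \<phi> a \<in> coboundaries B j \<Longrightarrow> a \<in> coboundaries A j"
    and surj: "\<And>j b. b \<in> cocycles B j \<Longrightarrow> \<exists>a\<in>cocycles A j. b - \<phi> a \<in> coboundaries B j"
  shows "quasi_isomorphism A B \<phi>"
  unfolding quasi_isomorphism_def
proof (intro conjI allI hom)
  fix j
  have comp: "\<phi> a \<in> component B n" and add: "b \<in> component A n \<Longrightarrow> \<phi> (a + b) = \<phi> a + \<phi> b"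
    and scale: "\<phi> (c *\<^sub>R a) = c *\<^sub>R \<phi> a" and diff: "\<phi> (gdiff A a) = gdiff B (\<phi> a)"
    if "a \<in> component A n" for a b n c
    using hom that unfolding dga_hom_def by blast+
  have minus: "\<phi> (a - b) = \<phi> a - \<phi> b" if "a \<in> component A n" "b \<in> component A n" for a b n
    using add[OF that(1) subspace_scale[OF dga_component[OF A] that(2), of "-1"]] scale[OF that(2), of "-1"]
    by simp
  have zero: "\<phi> 0 = 0"
    using scale[OF subspace_0[OF dga_component[OF A]], of 0] by simp
  have coc: "\<phi> a \<in> cocycles B j" if "a \<in> cocycles A j" for a
    using that comp diff[of a j] zero by (auto simp: cocycles_def)
  have cob: "\<phi> a \<in> coboundaries B j" if "a \<in> coboundaries A j" for a
    using that comp diff zero by (cases j) (auto simp: coboundaries_def)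
  \<comment> \<open>\<open>cohomology_map\<close> takes a union over all members of a class. All of
    them lead to the same class, so the union collapses to it.\<close>
  have cm: "cohomology_map B j \<phi> (coh_class A j a) = coh_class B j (\<phi> a)" if a: "a \<in> cocycles A j" for a
  proof -
    have self: "a \<in> coh_class A j a"
      using equiv_class_self[OF equiv_cohomologous[OF A] a] by (simp add: coh_class_def)
    have const: "coh_class B j (\<phi> b) = coh_class B j (\<phi> a)" if b: "b \<in> coh_class A j a" for b
    proof -
      have b': "b \<in> cocycles A j" "a - b \<in> coboundaries A j"
        using b by (auto simp: coh_class_def cohomologous_def)
      then have "\<phi> a - \<phi> b \<in> coboundaries B j"
        using cob[OF b'(2)] minus[of a j b] a by (simp add: cocycles_def)
      then show ?thesis
        using coh_class_eq_iff[OF B coc[OF a] coc[OF b'(1)]] by simp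
    qed
    have "(\<Union>b\<in>coh_class A j a. coh_class B j (\<phi> b)) = coh_class B j (\<phi> a)"
      by (rule UN_constant_eq[OF self]) (rule ballI, rule const)
    then show ?thesis
      unfolding cohomology_map_def Image_eq_UN[of _ "\<phi> ` _"] coh_class_def by simp
  qed
  show "bij_betw (cohomology_map B j \<phi>) (cohomology A j) (cohomology B j)"
    unfolding bij_betw_def
  proof
    show "inj_on (cohomology_map B j \<phi>) (cohomology A j)"
    proof (rule inj_onI)
      fix x y assume xy: "x \<in> cohomology A j" "y \<in> cohomology A j"
        "cohomology_map B j \<phi> x = cohomology_map B j \<phi> y"
      obtain a where a: "a \<in> cocycles A j" "x = coh_class A j a"
        using xy(1) unfolding cohomology_eq[OF A] by blast
      obtain b where b: "b \<in> cocycles A j" "y = coh_class A j b"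
        using xy(2) unfolding cohomology_eq[OF A] by blast
      have "\<phi> a - \<phi> b \<in> coboundaries B j"
        using xy(3) coh_class_eq_iff[OF B coc[OF a(1)] coc[OF b(1)]] by (simp add: a b cm)
      then have "\<phi> (a - b) \<in> coboundaries B j"
        using a b minus[of a j b] by (simp add: cocycles_def)
      then have "a - b \<in> coboundaries A j"
        by (rule inj[OF subspace_diff[OF subspace_cocycles[OF A] a(1) b(1)]])
      then show "x = y"
        using coh_class_eq_iff[OF A a(1) b(1)] a b by simp
    qed
    show "cohomology_map B j \<phi> ` cohomology A j = cohomology B j"
    proof
      show "cohomology_map B j \<phi> ` cohomology A j \<subseteq> cohomology B j"
        unfolding cohomology_eq[OF A] cohomology_eq[OF B] using cm coc by auto
      show "cohomology B j \<subseteq> cohomology_map B j \<phi> ` cohomology A j"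
      proof
        fix y assume "y \<in> cohomology B j"
        then obtain b where b: "b \<in> cocycles B j" "y = coh_class B j b"
          unfolding cohomology_eq[OF B] by blast
        obtain a where a: "a \<in> cocycles A j" "b - \<phi> a \<in> coboundaries B j"
          using surj[OF b(1)] by blast
        then have "y = cohomology_map B j \<phi> (coh_class A j a)"
          using coh_class_eq_iff[OF B b(1) coc[OF a(1)]] b by (simp add: cm)
        then show "y \<in> cohomology_map B j \<phi> ` cohomology A j"
          unfolding cohomology_eq[OF A] using a(1) by blast
      qed
    qed
  qed
qed

text \<open>Every parametrization is a restriction of the projection, so the local expression of a
  form is just its pullback to the group, restricted to the patch.\<close>

definition desc :: "real4 set \<Rightarrow> (real4 \<Rightarrow> real4 list \<Rightarrow> real) \<Rightarrow> (real4, real4 set) form"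
  where "desc L w = (\<lambda>c p vs. if c \<in> osc_quotient L \<and> p \<in> fst c then w p vs else 0)"

lemma desc_add: "desc L (\<lambda>p vs. w p vs + w' p vs) = desc L w + desc L w'"
  by (intro ext) (simp add: desc_def)

lemma desc_scale: "desc L (\<lambda>p vs. c * w p vs) = c *\<^sub>R desc L w"
  by (intro ext) (simp add: desc_def)

lemma desc_zero: "desc L (\<lambda>p vs. 0) = 0"
  by (simp add: desc_def fun_eq_iff)

lemma desc_wedge: "wedge (desc L \<alpha>) (desc L \<beta>) = desc L (\<lambda>p. wdg (\<alpha> p) (\<beta> p))"
proof (intro ext)
  fix c p vs
  show "wedge (desc L \<alpha>) (desc L \<beta>) c p vs = desc L (\<lambda>p. wdg (\<alpha> p) (\<beta> p)) c p vs"
    by (cases "c \<in> osc_quotient L \<and> p \<in> fst c")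
      (simp_all add: desc_def wedge_def wdg_def del: de_Morgan_conj)
qed

lemma desc_unit: "unit_form (osc_quotient L) = desc L (\<lambda>p. unit0)"
  by (auto simp: desc_def unit_form_def unit0_def fun_eq_iff)

lemma osc_quotientD:
  assumes "c \<in> osc_quotient L"
  shows "open (fst c)" "snd c = (\<lambda>g. g <#\<^bsub>oscillator\<^esub> L)" "inj_on (snd c) (fst c)"
  using assms unfolding osc_quotient_def by auto

lemma desc_ext:
  assumes w: "smooth_field w"
  shows "exterior_derivative (osc_quotient L) (desc L w) = desc L (ext w)"
proof (intro ext)
  fix c p vs
  show "exterior_derivative (osc_quotient L) (desc L w) c p vs = desc L (ext w) c p vs"
  proof (cases "c \<in> osc_quotient L \<and> p \<in> fst c")
    case True
    have "frechet_derivative (\<lambda>q. desc L w c q us) (at p) = frechet_derivative (\<lambda>q. w q us) (at p)" for us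
      by (rule frechet_derivative_transform_within_open[symmetric, where X = "fst c"])
        (use True osc_quotientD(1)[of c L] smooth_differentiable[OF smooth_fieldD[OF w]] in
          \<open>simp_all add: desc_def\<close>)
    then show ?thesis
      using True by (simp add: exterior_derivative_def desc_def[of L "ext w"] ext_def dird_def)
  next
    case False
    then show ?thesis by (auto simp: exterior_derivative_def desc_def)
  qed
qed

locale osc_lattice_quotient =
  fixes L :: "real4 set"
  assumes L: "subgroup L oscillator"
    and covers: "\<exists>c\<in>osc_quotient L. p \<in> fst c"
begin

lemma zero_in_L: "(0, 0, 0, 0) \<in> L"
  using subgroup.one_closed[OF L] by (simp add: oscillator_def)

lemma coset_eq: "osc_mult p l <#\<^bsub>oscillator\<^esub> L = p <#\<^bsub>oscillator\<^esub> L" if l: "l \<in> L"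
proof -
  have "osc_mult p l \<in> p <#\<^bsub>oscillator\<^esub> L"
    using l unfolding l_coset_def oscillator_def by auto
  from group.l_repr_independence[OF group_oscillator this _ L] show ?thesis
    by (simp add: oscillator_def)
qed

lemma coset_eqD:
  assumes "p <#\<^bsub>oscillator\<^esub> L = p' <#\<^bsub>oscillator\<^esub> L"
  obtains l where "l \<in> L" "p' = osc_mult p l"
proof -
  have "osc_mult p' (0, 0, 0, 0) = p'" by (cases p') simp
  then have "p' \<in> p' <#\<^bsub>oscillator\<^esub> L"
    using zero_in_L unfolding l_coset_def oscillator_def by force
  then have "p' \<in> p <#\<^bsub>oscillator\<^esub> L"
    using assms by simp
  then show thesis
    using that unfolding l_coset_def oscillator_def by auto
qed

text \<open>Near \<open>p\<close> the change of coordinates is right multiplication by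
  \<open>l\<close>: a point and its product with \<open>l\<close> lie in the same coset, and
  \<open>f'\<close> is injective on its patch. This holds on the open set of points that
  multiplication by \<open>l\<close> sends into \<open>U'\<close>.\<close>

lemma transition_derivative:
  assumes c: "(U, f) \<in> osc_quotient L" "p \<in> U" and c': "(U', f') \<in> osc_quotient L" "osc_mult p l \<in> U'"
    and l: "l \<in> L"
  shows "frechet_derivative (inv_into U' f' \<circ> f) (at p) = osc_jac l p"
proof -
  have f: "f = (\<lambda>g. g <#\<^bsub>oscillator\<^esub> L)" "f' = (\<lambda>g. g <#\<^bsub>oscillator\<^esub> L)" "open U'" "inj_on f' U'"
    using osc_quotientD[OF c(1)] osc_quotientD[OF c'(1)] by simp_all
  let ?W = "(\<lambda>q. osc_mult q l) -` U'"
  have "continuous_on UNIV (\<lambda>q. osc_mult q l)"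
    using osc_mult_has_derivative has_derivative_continuous
    by (metis continuous_at_imp_continuous_on)
  then have W: "open ?W"
    using f(3) by (simp add: open_vimage)
  have e: "osc_mult q l = (inv_into U' f' \<circ> f) q" if "q \<in> ?W" for q
  proof -
    have "f q = f' (osc_mult q l)"
      using coset_eq[OF l, of q] by (simp add: f)
    then show ?thesis
      using that f(4) by simp
  qed
  have "((inv_into U' f' \<circ> f) has_derivative osc_jac l p) (at p)"
    by (rule has_derivative_transform_within_open[OF osc_mult_has_derivative W _ e]) (use c' in auto)
  from frechet_derivative_at[OF this] show ?thesis ..
qed

lemma desc_forms:
  assumes "w \<in> invariant_forms L n"
  shows "desc L w \<in> forms (osc_quotient L) n"
proof -
  have w: "\<And>p. alt n (w p)" "smooth_field w"
    and inv: "\<And>l p vs. l \<in> L \<Longrightarrow> w (osc_mult p l) (map (osc_jac l p) vs) = w p vs"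
    using assms unfolding invariant_forms_def by blast+
  have 1: "desc L w (U, f) p = 0" if "\<not> ((U, f) \<in> osc_quotient L \<and> p \<in> U)" for U f p
    using that by (auto simp: desc_def fun_eq_iff)
  have 2: "alternating_multilinear n (desc L w (U, f) p)" if "(U, f) \<in> osc_quotient L" "p \<in> U" for U f p
    using w(1)[of p] that by (simp add: desc_def alt_iff)
  have 3: "smooth_fun_on U (\<lambda>p. desc L w (U, f) p vs)" if "(U, f) \<in> osc_quotient L" for U f vs
  proof (rule smooth_fun_on_cong)
    show "open U" using osc_quotientD(1)[OF that] by simp
    show "smooth_fun_on U (\<lambda>p. w p vs)"
      using smooth_fieldD[OF w(2)] by (rule smooth_fun_on_subset) simp
  qed (use that in \<open>simp add: desc_def\<close>)
  have 4: "desc L w (U, f) p vs =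
      desc L w (U', f') p' (map (frechet_derivative (inv_into U' f' \<circ> f) (at p)) vs)"
    if c: "(U, f) \<in> osc_quotient L" "(U', f') \<in> osc_quotient L" "p \<in> U" "p' \<in> U'" "f p = f' p'"
    for U f U' f' p p' vs
  proof -
    have "p <#\<^bsub>oscillator\<^esub> L = p' <#\<^bsub>oscillator\<^esub> L"
      using c(5) osc_quotientD(2)[OF c(1)] osc_quotientD(2)[OF c(2)] by simp
    then obtain l where l: "l \<in> L" "p' = osc_mult p l"
      by (rule coset_eqD)
    show ?thesis
      using transition_derivative[OF c(1,3,2), of l] inv[OF l(1), of p vs] c l by (simp add: desc_def)
  qed
  show ?thesis
    unfolding forms_def
  proof (intro CollectI conjI)
    show "\<forall>U f p. \<not> ((U, f) \<in> osc_quotient L \<and> p \<in> U) \<longrightarrow> desc L w (U, f) p = 0"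
      by (intro allI impI) (rule 1)
    show "\<forall>(U, f)\<in>osc_quotient L. \<forall>p\<in>U. alternating_multilinear n (desc L w (U, f) p)"
      by clarify (rule 2)
    show "\<forall>(U, f)\<in>osc_quotient L. \<forall>vs. smooth_fun_on U (\<lambda>p. desc L w (U, f) p vs)"
      by clarify (rule 3)
    show "\<forall>(U, f)\<in>osc_quotient L. \<forall>(U', f')\<in>osc_quotient L. \<forall>p\<in>U. \<forall>p'\<in>U'. f p = f' p' \<longrightarrow>
      (\<forall>vs. desc L w (U, f) p vs =
        desc L w (U', f') p' (map (frechet_derivative (inv_into U' f' \<circ> f) (at p)) vs))"
      by clarify (rule 4)
  qed
qed

text \<open>At each point some chart is chosen. The transformation rule with \<open>l\<close> the
  identity shows independence of the choice; with general \<open>l\<close> it gives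
  invariance.\<close>

lemma forms_desc:
  assumes "\<omega> \<in> forms (osc_quotient L) n"
  obtains w where "w \<in> invariant_forms L n" "\<omega> = desc L w"
proof -
  define ch where "ch p = (SOME c. c \<in> osc_quotient L \<and> p \<in> fst c)" for p
  have ch: "ch p \<in> osc_quotient L" "p \<in> fst (ch p)" for p
    using someI_ex[of "\<lambda>c. c \<in> osc_quotient L \<and> p \<in> fst c"] covers[of p] unfolding ch_def by blast+
  define w where "w p = \<omega> (ch p) p" for p
  note F = assms[unfolded forms_def mem_Collect_eq]
  note F2 = F[THEN conjunct2, THEN conjunct1] and F3 = F[THEN conjunct2, THEN conjunct2, THEN conjunct1]
    and F4 = F[THEN conjunct2, THEN conjunct2, THEN conjunct2]
  have 1: "\<omega> (U, f) p = 0" if "\<not> ((U, f) \<in> osc_quotient L \<and> p \<in> U)" for U f p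
    by (rule F[THEN conjunct1, rule_format, OF that])
  have 2: "alternating_multilinear n (\<omega> (U, f) p)" if "(U, f) \<in> osc_quotient L" "p \<in> U" for U f p
    using bspec[OF F2 that(1)] that(2) by simp
  have 3: "smooth_fun_on U (\<lambda>p. \<omega> (U, f) p vs)" if "(U, f) \<in> osc_quotient L" for U f vs
    using bspec[OF F3 that] by simp
  have 4: "\<omega> (U, f) p vs = \<omega> (U', f') p' (map (frechet_derivative (inv_into U' f' \<circ> f) (at p)) vs)"
    if "(U, f) \<in> osc_quotient L" "(U', f') \<in> osc_quotient L" "p \<in> U" "p' \<in> U'" "f p = f' p'"
    for U f U' f' p p' vs
    using bspec[OF bspec[OF F4 that(1), unfolded prod.case] that(2), unfolded prod.case, rule_format, OF that(3-5)]
    by simp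
  have tr: "\<omega> c p vs = \<omega> c' (osc_mult p l) (map (osc_jac l p) vs)"
    if c: "c \<in> osc_quotient L" "c' \<in> osc_quotient L" "p \<in> fst c" "osc_mult p l \<in> fst c'" "l \<in> L"
    for c c' p l vs
  proof -
    obtain U f U' f' where cc: "c = (U, f)" "c' = (U', f')" by (cases c; cases c')
    have "f p = f' (osc_mult p l)"
      using osc_quotientD(2)[OF c(1)] osc_quotientD(2)[OF c(2)] coset_eq[OF c(5)] by (simp add: cc)
    from 4[OF c(1,2)[unfolded cc] _ _ this] show ?thesis
      using transition_derivative[OF c(1)[unfolded cc] _ c(2)[unfolded cc] _ c(5)] c cc by simp
  qed
  have w: "\<omega> c p = w p" if "c \<in> osc_quotient L" "p \<in> fst c" for c p
  proof
    fix vs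
    have "osc_mult p (0, 0, 0, 0) = p" by (cases p) simp
    then show "\<omega> c p vs = w p vs"
      using tr[OF that(1) ch(1)[of p] that(2), of "(0, 0, 0, 0)" vs] zero_in_L ch(2)[of p]
      by (simp add: w_def osc_jac_t[abs_def])
  qed
  have "w \<in> invariant_forms L n"
    unfolding invariant_forms_def
  proof (intro CollectI conjI allI ballI)
    show "alt n (w p)" for p
      using 2[of "fst (ch p)" "snd (ch p)" p] ch[of p] by (simp add: alt_iff w_def)
    show "smooth_field w"
      unfolding smooth_field_def
    proof
      fix vs
      show "smooth (\<lambda>p. w p vs)"
      proof (rule smooth_local)
        fix p
        have "smooth_fun_on (fst (ch p)) (\<lambda>p. w p vs)"
        proof (rule smooth_fun_on_cong)
          show "open (fst (ch p))" using osc_quotientD(1)[OF ch(1)] .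
          show "smooth_fun_on (fst (ch p)) (\<lambda>q. \<omega> (ch p) q vs)"
            using 3[of "fst (ch p)" "snd (ch p)" vs] ch[of p] by simp
        qed (simp add: w ch)
        then show "\<exists>U. open U \<and> p \<in> U \<and> smooth_fun_on U (\<lambda>p. w p vs)"
          using ch(2)[of p] osc_quotientD(1)[OF ch(1)[of p]] by blast
      qed
    qed
    show "w (osc_mult p l) (map (osc_jac l p) vs) = w p vs" if "l \<in> L" for l p vs
      using tr[OF ch(1)[of p] ch(1)[of "osc_mult p l"] ch(2) ch(2) that, of vs] by (simp add: w_def)
  qed
  moreover have "\<omega> = desc L w"
  proof (intro ext)
    fix c p vs
    show "\<omega> c p vs = desc L w c p vs"
      using w[of c p] 1[of "fst c" "snd c" p] by (cases "c \<in> osc_quotient L \<and> p \<in> fst c") (auto simp: desc_def)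
  qed
  ultimately show thesis
    by (rule that)
qed

lemma desc_eqD: "desc L w = desc L w' \<Longrightarrow> w = w'"
proof (intro ext)
  fix p vs assume e: "desc L w = desc L w'"
  obtain c where "c \<in> osc_quotient L" "p \<in> fst c" using covers by blast
  then show "w p vs = w' p vs"
    using fun_cong[OF fun_cong[OF fun_cong[OF e]], of c p vs] by (simp add: desc_def)
qed

lemma forms_eq: "forms (osc_quotient L) n = desc L ` invariant_forms L n"
proof (intro equalityI subsetI)
  fix \<omega> assume "\<omega> \<in> forms (osc_quotient L) n"
  then obtain w where "w \<in> invariant_forms L n" "\<omega> = desc L w"
    by (rule forms_desc)
  then show "\<omega> \<in> desc L ` invariant_forms L n" by simp
next
  fix \<omega> assume "\<omega> \<in> desc L ` invariant_forms L n"
  then show "\<omega> \<in> forms (osc_quotient L) n"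
    by (elim imageE) (simp add: desc_forms)
qed

abbreviation "dR \<equiv> de_Rham (osc_quotient L)"

lemma component_de_Rham: "component dR n = desc L ` invariant_forms L n"
  by (simp add: de_Rham_def forms_eq)

lemma gdiff_desc: "w \<in> invariant_forms L n \<Longrightarrow> gdiff dR (desc L w) = desc L (ext w)"
  by (simp add: de_Rham_def invariant_forms_def desc_ext)

lemma invariant_forms_add:
  "w \<in> invariant_forms L n \<Longrightarrow> w' \<in> invariant_forms L n \<Longrightarrow>
    (\<lambda>p vs. w p vs + w' p vs) \<in> invariant_forms L n"
  by (simp add: invariant_forms_def alt_add smooth_field_add)

lemma invariant_forms_cmult:
  "w \<in> invariant_forms L n \<Longrightarrow> (\<lambda>p vs. c * w p vs) \<in> invariant_forms L n"
  by (simp add: invariant_forms_def alt_cmult smooth_field_mult)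

lemma invariant_forms_zero: "(\<lambda>p vs. 0) \<in> invariant_forms L n"
  by (simp add: invariant_forms_def alt_zero smooth_field_def)

lemma linear_dga_de_Rham: "linear_dga dR"
  unfolding linear_dga_def component_de_Rham
proof (intro allI conjI ballI)
  fix n
  show "subspace (desc L ` invariant_forms L n)"
    unfolding subspace_def
  proof (intro conjI ballI allI)
    show "0 \<in> desc L ` invariant_forms L n"
      using invariant_forms_zero desc_zero[of L] by (metis imageI)
  next
    fix x y assume "x \<in> desc L ` invariant_forms L n" "y \<in> desc L ` invariant_forms L n"
    then show "x + y \<in> desc L ` invariant_forms L n"
      by (elim imageE) (simp add: invariant_forms_add flip: desc_add)
  next
    fix c x assume "x \<in> desc L ` invariant_forms L n"
    then show "c *\<^sub>R x \<in> desc L ` invariant_forms L n"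
      by (elim imageE) (simp add: invariant_forms_cmult flip: desc_scale)
  qed
  fix a assume "a \<in> desc L ` invariant_forms L n"
  then obtain w where w: "a = desc L w" "w \<in> invariant_forms L n" "smooth_field w"
    by (auto simp: invariant_forms_def)
  show "gdiff dR (c *\<^sub>R a) = c *\<^sub>R gdiff dR a" for c
  proof -
    have "ext (\<lambda>p vs. c * w p vs) = (\<lambda>p vs. c * ext w p vs)"
      by (intro ext ext_cmult w)
    then show ?thesis
      unfolding w(1) desc_scale[symmetric] gdiff_desc[OF w(2)]
      by (simp add: gdiff_desc[OF invariant_forms_cmult[OF w(2)]])
  qed
  fix b assume "b \<in> desc L ` invariant_forms L n"
  then obtain u where u: "b = desc L u" "u \<in> invariant_forms L n" "smooth_field u"
    by (auto simp: invariant_forms_def)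
  have "ext (\<lambda>p vs. w p vs + u p vs) = (\<lambda>p vs. ext w p vs + ext u p vs)"
    by (intro ext ext_add w u)
  then show "gdiff dR (a + b) = gdiff dR a + gdiff dR b"
    unfolding w(1) u(1) desc_add[symmetric] gdiff_desc[OF w(2)] gdiff_desc[OF u(2)]
    by (simp add: gdiff_desc[OF invariant_forms_add[OF w(2) u(2)]])
qed

lemma desc_cocycle:
  "w \<in> invariant_forms L n \<Longrightarrow> ext w = (\<lambda>p vs. 0) \<Longrightarrow> desc L w \<in> cocycles dR n"
  by (simp add: cocycles_def component_de_Rham gdiff_desc desc_zero)

lemma cocycle_desc:
  assumes "b \<in> cocycles dR n"
  obtains w where "w \<in> invariant_forms L n" "\<And>p vs. ext w p vs = 0" "b = desc L w"
proof -
  obtain w where w: "w \<in> invariant_forms L n" "b = desc L w" "gdiff dR b = 0"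
    using assms by (auto simp: cocycles_def component_de_Rham)
  then have "desc L (ext w) = desc L (\<lambda>p vs. 0)"
    using gdiff_desc[OF w(1)] by (simp add: desc_zero)
  then have "ext w = (\<lambda>p vs. 0)"
    by (rule desc_eqD)
  then show thesis
    using that[OF w(1) _ w(2)] by simp
qed

lemma coboundaries_de_Rham: "coboundaries dR n = desc L ` exact_forms L n"
proof (cases n)
  case 0
  then show ?thesis by (simp add: coboundaries_def exact_forms_def desc_zero)
next
  case (Suc m)
  then show ?thesis
    unfolding coboundaries_def exact_forms_def Suc nat.case component_de_Rham image_image
    by (intro image_cong refl gdiff_desc)
qed

lemma desc_coboundary_iff: "desc L w \<in> coboundaries dR n \<longleftrightarrow> w \<in> exact_forms L n"
proof
  assume "desc L w \<in> coboundaries dR n"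
  then obtain u where "desc L w = desc L u" "u \<in> exact_forms L n"
    unfolding coboundaries_de_Rham by (elim imageE)
  then show "w \<in> exact_forms L n"
    using desc_eqD[of w u] by simp
qed (simp add: coboundaries_de_Rham)

lemma ext_const_form:
  "ext (const_form a) = form_of (diff_coeff (\<lambda>I q. a I))"
proof -
  have "smooth (\<lambda>q::real4. a I)" for I by (rule smooth_const)
  then have "ext (form_of (\<lambda>I q. a I)) = form_of (diff_coeff (\<lambda>I q. a I))"
    by (rule ext_form_of_eq[of "\<lambda>I q. a I"])
  then show ?thesis
    by (simp only: const_form_eq)
qed

text \<open>For constant coefficients only the contribution of \<open>d\<zeta>\<close> could be
  nonzero, and \<open>[3]\<close> and \<open>[0, 3]\<close> do not belong to
  \<open>reps_0\<close>.\<close>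

lemma desc_const_form_cocycle:
  assumes B: "cohomology_basis L R" and a: "\<And>I. a I \<noteq> 0 \<Longrightarrow> I \<in> R \<and> length I = n"
  shows "desc L (const_form a) \<in> cocycles dR n"
proof (rule desc_cocycle)
  show "const_form a \<in> invariant_forms L n"
    using B[unfolded cohomology_basis_def, THEN conjunct2, THEN conjunct2, THEN conjunct2, rule_format, of a n] a
    by blast
  have "R \<subseteq> reps_0"
    using B[unfolded cohomology_basis_def, THEN conjunct1] .
  moreover have "[3] \<notin> reps_0" "[0, 3] \<notin> reps_0"
    by (simp_all add: reps_0_def)
  ultimately have "a [3] = 0" "a [0, 3] = 0"
    using a[of "[3]"] a[of "[0, 3]"] by blast+
  then have "diff_coeff (\<lambda>I q. a I) J q = 0" for J q
    by (simp add: diff_coeff_def)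
  then show "ext (const_form a) = (\<lambda>p vs. 0)"
    unfolding ext_const_form by (simp add: form_of_def fun_eq_iff)
qed

lemma cohomology_dim_de_Rham:
  assumes B: "cohomology_basis L R" and Is: "distinct Is" "set Is = {I \<in> R. length I = n}"
  shows "cohomology_dim dR n (length Is)"
proof -
  note B0 = B[unfolded cohomology_basis_def, THEN conjunct1]
    and B1 = B[unfolded cohomology_basis_def, THEN conjunct2, THEN conjunct1, rule_format]
    and B2 = B[unfolded cohomology_basis_def, THEN conjunct2, THEN conjunct2, THEN conjunct1, rule_format]
  let ?e = "\<lambda>i I. if I = Is ! i then 1 else (0 :: real)"
  let ?h = "\<lambda>i. desc L (const_form (?e i))"
  let ?a = "\<lambda>c I. \<Sum>i<length Is. c i * ?e i I"
  have nth: "Is ! i \<in> R" "length (Is ! i) = n" if "i < length Is" for i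
    using nth_mem[OF that] unfolding Is(2) by simp_all
  have sum: "(\<Sum>i<m. c i *\<^sub>R ?h i) = desc L (const_form (\<lambda>I. \<Sum>i<m. c i * ?e i I))" for c m
  proof (induction m)
    case 0
    have "const_form (\<lambda>I. 0) = (\<lambda>p vs. 0)" by (simp add: const_form_def fun_eq_iff)
    then show ?case by (simp add: desc_zero)
  next
    case (Suc m)
    have "const_form (\<lambda>I. \<Sum>i<Suc m. c i * ?e i I) =
        (\<lambda>p vs. const_form (\<lambda>I. \<Sum>i<m. c i * ?e i I) p vs + c m * const_form (?e m) p vs)"
      by (intro ext) (simp add: const_form_def sum.distrib sum_distrib_left distrib_right mult.assoc)
    then show ?case
      by (simp only: Suc sum.lessThan_Suc desc_add desc_scale)
  qed
  have coeff: "?a c (Is ! i) = c i" if "i < length Is" for c i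
  proof -
    have "?a c (Is ! i) = (\<Sum>j<length Is. c j * (if j = i then 1 else 0))"
      by (rule sum.cong) (use Is(1) that in \<open>auto simp: nth_eq_iff_index_eq\<close>)
    then show ?thesis
      using that by (simp add: if_distrib cong: if_cong)
  qed
  show ?thesis
  proof (rule cohomology_dimI[OF linear_dga_de_Rham, where h = ?h])
    show "?h i \<in> cocycles dR n" if "i < length Is" for i
      by (rule desc_const_form_cocycle[OF B]) (use nth[OF that] in \<open>auto split: if_splits\<close>)
  next
    fix b assume "b \<in> cocycles dR n"
    then obtain w where w: "w \<in> invariant_forms L n" "\<And>p vs. ext w p vs = 0" "b = desc L w"
      by (rule cocycle_desc) (rule that)
    have "w \<in> invariant_forms L n \<and> (\<forall>p vs. ext w p vs = 0)"
      using w(1,2) by simp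
    from B1[OF this] obtain a where a: "\<forall>I. a I \<noteq> 0 \<longrightarrow> I \<in> R \<and> length I = n"
      "(\<lambda>p vs. w p vs - const_form a p vs) \<in> exact_forms L n"
      by (elim exE conjE) (rule that)
    have "?a (\<lambda>i. a (Is ! i)) = a"
    proof
      fix I
      show "?a (\<lambda>i. a (Is ! i)) I = a I"
      proof (cases "I \<in> set Is")
        case True
        then obtain i where "i < length Is" "I = Is ! i"
          by (auto simp: in_set_conv_nth)
        then show ?thesis using coeff by simp
      next
        case False
        then have "I \<noteq> Is ! i" if "i < length Is" for i
          using that by auto
        moreover have "a I = 0" using False a(1) unfolding Is(2) by auto
        ultimately show ?thesis by (simp add: sum.neutral)
      qed
    qed
    then have "b - (\<Sum>i<length Is. a (Is ! i) *\<^sub>R ?h i) = desc L (\<lambda>p vs. w p vs - const_form a p vs)"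
      using desc_add[of L w "\<lambda>p vs. - 1 * const_form a p vs"] desc_scale[of L "- 1" "const_form a"]
      by (simp add: sum w(3))
    then have "b - (\<Sum>i<length Is. a (Is ! i) *\<^sub>R ?h i) \<in> coboundaries dR n"
      using a(2) by (simp add: desc_coboundary_iff)
    then show "\<exists>c. b - (\<Sum>i<length Is. c i *\<^sub>R ?h i) \<in> coboundaries dR n"
      by (rule exI[of _ "\<lambda>i. a (Is ! i)"])
  next
    fix c i assume c: "(\<Sum>i<length Is. c i *\<^sub>R ?h i) \<in> coboundaries dR n" and i: "i < length Is"
    have "const_form (?a c) \<in> exact_forms L n"
      using c unfolding sum desc_coboundary_iff .
    moreover have "Is ! i \<in> basis" "Is ! i \<noteq> [1, 2]" "Is ! i \<noteq> [0, 1, 2]"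
      using nth(1)[OF i] B0 by (auto simp: reps_0_def basis_eq)
    ultimately have "?a c (Is ! i) = 0"
      using B2[of "?a c" n "Is ! i"] by simp
    then show "c i = 0"
      using coeff[OF i] by simp
  qed
qed

end

section \<open>Homomorphisms from free algebras\<close>

lemma distinct_iff_count_list: "distinct w \<longleftrightarrow> (\<forall>x\<in>set w. count_list w x = 1)"
proof (induction w)
  case (Cons g w)
  have "count_list w g = 0 \<longleftrightarrow> g \<notin> set w" by (rule count_list_0_iff)
  then show ?case
    using Cons by (cases "g \<in> set w") auto
qed simp

lemma monomials_odd:
  "(\<And>g. odd (deg g)) \<Longrightarrow> w \<in> monomials X deg \<longleftrightarrow> set w \<subseteq> X \<and> sorted w \<and> distinct w"
  unfolding monomials_def distinct_iff_count_list by auto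

lemma koszul_sign_Nil: "koszul_sign deg [] v = 1"
  by (simp add: koszul_sign_def)

text \<open>The new first letter has to pass exactly those letters of \<open>v\<close> that are
  smaller than it.\<close>

lemma koszul_sign_Cons:
  assumes odd: "\<And>g. odd (deg g)"
  shows "koszul_sign deg (g # u) v = (-1) ^ length (filter (\<lambda>h. h < g) v) * koszul_sign deg u v"
proof -
  let ?P = "\<lambda>u. {(i, j). i < length u \<and> j < length v \<and> v ! j < u ! i}"
  let ?J = "{j. j < length v \<and> v ! j < g}"
  have "?P (g # u) = (\<lambda>j. (0, j)) ` ?J \<union> map_prod Suc id ` ?P u"
  proof (intro equalityI subsetI)
    fix x assume "x \<in> ?P (g # u)"
    then obtain i j where x: "x = (i, j)" "i < Suc (length u)" "j < length v" "v ! j < (g # u) ! i"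
      by auto
    then show "x \<in> (\<lambda>j. (0, j)) ` ?J \<union> map_prod Suc id ` ?P u"
      by (cases i) (auto simp: image_iff)
  qed auto
  moreover have "finite (?P u)"
    by (rule finite_subset[of _ "{..<length u} \<times> {..<length v}"]) auto
  moreover have "card (map_prod Suc id ` ?P u) = card (?P u)"
    by (rule card_image) (auto intro!: inj_onI)
  ultimately have "card (?P (g # u)) = card ?J + card (?P u)"
    by (simp, subst card_Un_disjoint) (auto simp: card_image inj_on_def)
  then show ?thesis
    using odd by (simp add: koszul_sign_def length_filter_conv_card power_add)
qed

lemma length_filter_sort: "length (filter P (sort xs)) = length (filter P xs)"
proof -
  have "size (filter_mset P (mset (sort xs))) = size (filter_mset P (mset xs))"
    by simp
  then show ?thesis
    by (metis mset_filter size_mset)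
qed

lemma free_mult_superset:
  assumes "finite M" "supp a \<subseteq> M" "supp b \<subseteq> M"
  shows "free_mult deg a b = (\<Sum>u\<in>M. \<Sum>v\<in>M. (a u * b v) *\<^sub>R mono_mult deg u v)"
proof -
  have "free_mult deg a b = (\<Sum>u\<in>supp a. \<Sum>v\<in>M. (a u * b v) *\<^sub>R mono_mult deg u v)"
    unfolding free_mult_def using assms by (intro sum.cong refl sum.mono_neutral_left) (auto simp: supp_def)
  also have "\<dots> = (\<Sum>u\<in>M. \<Sum>v\<in>M. (a u * b v) *\<^sub>R mono_mult deg u v)"
    using assms by (intro sum.mono_neutral_left) (auto simp: supp_def)
  finally show ?thesis .
qed

lemma free_diff_superset:
  assumes "finite M" "supp a \<subseteq> M"
  shows "free_diff deg dg a = (\<Sum>w\<in>M. a w *\<^sub>R mono_diff deg dg w)"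
  unfolding free_diff_def using assms by (intro sum.mono_neutral_left) (auto simp: supp_def)

lemma supp_monomial: "supp (monomial w) = {w}"
  by (auto simp: supp_def monomial_def)

lemma supp_add: "supp (a + b) \<subseteq> supp a \<union> supp b"
  by (auto simp: supp_def)

lemma supp_scale: "supp (c *\<^sub>R a) \<subseteq> supp a"
  by (auto simp: supp_def)

lemma supp_zero: "supp 0 = {}" "supp (\<lambda>w. 0) = {}"
  by (simp_all add: supp_def)

lemma supp_sum: "(\<And>i. i \<in> A \<Longrightarrow> supp (f i) \<subseteq> M) \<Longrightarrow> supp (\<Sum>i\<in>A. f i) \<subseteq> M"
proof (induction A rule: infinite_finite_induct)
  case (insert x A)
  then show ?case
    unfolding sum.insert[OF insert(1,2)] using supp_add[of "f x" "sum f A"] by blast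
qed (simp_all add: supp_zero)

lemma subspace_free_component: "subspace (free_component X deg n)"
  unfolding subspace_def free_component_def
proof (intro conjI ballI allI CollectI)
  fix x y assume xy: "x \<in> {a. finite (supp a) \<and> (\<forall>w\<in>supp a. w \<in> monomials X deg \<and> sum_list (map deg w) = n)}"
    "y \<in> {a. finite (supp a) \<and> (\<forall>w\<in>supp a. w \<in> monomials X deg \<and> sum_list (map deg w) = n)}"
  show "finite (supp (x + y))"
    using finite_subset[OF supp_add[of x y]] xy by simp
  show "w \<in> monomials X deg" "sum_list (map deg w) = n" if "w \<in> supp (x + y)" for w
    using that supp_add[of x y] xy by auto
next
  fix c x assume x: "x \<in> {a. finite (supp a) \<and> (\<forall>w\<in>supp a. w \<in> monomials X deg \<and> sum_list (map deg w) = n)}"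
  show "finite (supp (c *\<^sub>R x))"
    using finite_subset[OF supp_scale[of c x]] x by simp
  show "w \<in> monomials X deg" "sum_list (map deg w) = n" if "w \<in> supp (c *\<^sub>R x)" for w
    using that supp_scale[of c x] x by auto
qed (simp_all add: supp_zero)

text \<open>A generator is realized by the operator of wedging with its form, not by the form.
  Monomials become compositions of operators applied to the unit, and products and signs reduce to
  the rules assumed here. A generator of degree 3 fits in as well, with a composition of three wedge
  operators. Since all degrees are odd, monomials are words without repetition.\<close>

locale odd_model =
  fixes X :: "nat set" and deg :: "nat \<Rightarrow> nat" and dg :: "nat \<Rightarrow> nat list \<Rightarrow> real"
    and W :: "nat \<Rightarrow> real4 \<Rightarrow> (real4 list \<Rightarrow> real) \<Rightarrow> real4 list \<Rightarrow> real"
  assumes finite_X: "finite X" and odd_deg: "\<And>g. odd (deg g)"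
    and supp_dg: "\<And>g. g \<in> X \<Longrightarrow> supp (dg g) \<subseteq> monomials X deg"
    and W_anticommute: "\<And>g h p \<beta>. W g p (W h p \<beta>) = (\<lambda>vs. - W h p (W g p \<beta>) vs)"
    and W_add: "\<And>g p \<beta> \<gamma>. W g p (\<lambda>vs. \<beta> vs + \<gamma> vs) = (\<lambda>vs. W g p \<beta> vs + W g p \<gamma> vs)"
    and W_cmult: "\<And>g p c \<beta>. W g p (\<lambda>vs. c * \<beta> vs) = (\<lambda>vs. c * W g p \<beta> vs)"
    and W_wdg: "\<And>g p \<beta> \<eta>. wdg (W g p \<beta>) \<eta> = W g p (wdg \<beta> \<eta>)"
    and smooth_W: "\<And>g \<beta>. smooth_field \<beta> \<Longrightarrow> smooth_field (\<lambda>p. W g p (\<beta> p))"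
begin

abbreviation "mons \<equiv> monomials X deg"

definition monomial_form :: "nat list \<Rightarrow> real4 \<Rightarrow> real4 list \<Rightarrow> real"
  where "monomial_form w p = foldr (\<lambda>g. W g p) w unit0"

definition realization :: "(nat list \<Rightarrow> real) \<Rightarrow> real4 \<Rightarrow> real4 list \<Rightarrow> real"
  where "realization a p vs = (\<Sum>w\<in>mons. a w * monomial_form w p vs)"

lemma monomial_form_Nil: "monomial_form [] p = unit0"
  and monomial_form_Cons: "monomial_form (g # w) p = W g p (monomial_form w p)"
  by (simp_all add: monomial_form_def)

lemma mons_iff: "w \<in> mons \<longleftrightarrow> set w \<subseteq> X \<and> sorted w \<and> distinct w"
  by (rule monomials_odd) (rule odd_deg)

lemma finite_mons: "finite mons"
  by (rule finite_subset[OF _ finite_subset_distinct[OF finite_X]]) (auto simp: mons_iff)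

lemma W_zero: "W g p (\<lambda>vs. 0) = (\<lambda>vs. 0)"
  using W_cmult[of g p 0 "\<lambda>vs. 0"] by simp

lemma W_same: "W g p (W g p \<beta>) = (\<lambda>vs. 0)"
proof
  show "W g p (W g p \<beta>) vs = 0" for vs
    using fun_cong[OF W_anticommute[of g p g \<beta>], of vs] by simp
qed

lemma smooth_monomial_form: "smooth_field (monomial_form w)"
proof (induction w)
  case Nil
  then show ?case by (simp add: monomial_form_Nil smooth_field_def)
next
  case (Cons g w)
  from smooth_W[OF Cons, of g] show ?case
    unfolding monomial_form_Cons .
qed

lemma wdg_monomial_form: "wdg (monomial_form u p) \<eta> = foldr (\<lambda>g. W g p) u \<eta>"
proof (induction u)
  case Nil
  then show ?case by (simp add: monomial_form_Nil wdg_unit_left fun_eq_iff)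
next
  case (Cons g u)
  then show ?case by (simp add: monomial_form_Cons W_wdg)
qed

lemma wdg_monomial_forms: "wdg (monomial_form u p) (monomial_form v p) = monomial_form (u @ v) p"
  unfolding wdg_monomial_form by (simp add: monomial_form_def)

text \<open>Insertion moves \<open>g\<close> past the smaller letters, each of which costs one sign
  by anticommutation.\<close>

lemma monomial_form_insort:
  "sorted w \<Longrightarrow> monomial_form (g # w) p =
    (\<lambda>vs. (-1) ^ length (filter (\<lambda>h. h < g) w) * monomial_form (insort g w) p vs)"
proof (induction w)
  case (Cons h w)
  show ?case
  proof (cases "g \<le> h")
    case True
    then have "filter (\<lambda>h. h < g) (h # w) = []"
      using Cons.prems by (auto simp: filter_empty_conv)
    then have "length (filter (\<lambda>h. h < g) (h # w)) = 0"
      by simp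
    then show ?thesis
      using True by (simp only: insort_key.simps if_True power_0 mult_1)
  next
    case False
    then have e: "length (filter (\<lambda>h. h < g) (h # w)) = Suc (length (filter (\<lambda>h. h < g) w))"
      "insort g (h # w) = h # insort g w"
      by simp_all
    have "monomial_form (g # h # w) p = (\<lambda>vs. - W h p (monomial_form (g # w) p) vs)"
      unfolding monomial_form_Cons by (rule W_anticommute)
    also have "monomial_form (g # w) p =
        (\<lambda>vs. (-1) ^ length (filter (\<lambda>h. h < g) w) * monomial_form (insort g w) p vs)"
      using Cons by simp
    finally show ?thesis
      unfolding e W_cmult monomial_form_Cons[of h "insort g w"] by simp
  qed
qed simp

text \<open>The letters of \<open>u\<close> are inserted into \<open>v\<close> from right to left.
  As \<open>u\<close> is sorted, an inserted letter never passes another letter of \<open>u\<close>,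
  so the signs add up to the Koszul sign.\<close>

lemma monomial_form_append:
  assumes v: "sorted v"
  shows "sorted u \<Longrightarrow> monomial_form (u @ v) p =
    (\<lambda>vs. koszul_sign deg u v * monomial_form (sort (u @ v)) p vs)"
proof (induction u)
  case Nil
  then show ?case
    using v by (simp add: koszul_sign_Nil sort_key_id_if_sorted[of "\<lambda>x. x"])
next
  case (Cons g u)
  let ?w = "sort (u @ v)"
  have "filter (\<lambda>h. h < g) u = []"
    using Cons.prems by (auto simp: filter_empty_conv)
  then have n: "length (filter (\<lambda>h. h < g) ?w) = length (filter (\<lambda>h. h < g) v)"
    unfolding length_filter_sort by simp
  have "monomial_form ((g # u) @ v) p = W g p (monomial_form (u @ v) p)"
    by (simp add: monomial_form_Cons)
  also have "monomial_form (u @ v) p = (\<lambda>vs. koszul_sign deg u v * monomial_form ?w p vs)"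
    using Cons by simp
  also have "W g p \<dots> = (\<lambda>vs. koszul_sign deg u v * monomial_form (g # ?w) p vs)"
    by (simp add: W_cmult monomial_form_Cons)
  also have "monomial_form (g # ?w) p =
      (\<lambda>vs. (-1) ^ length (filter (\<lambda>h. h < g) v) * monomial_form (sort ((g # u) @ v)) p vs)"
    using monomial_form_insort[of ?w g p] unfolding n by simp
  finally show ?case
    by (simp add: koszul_sign_Cons[OF odd_deg] mult.commute mult.left_commute)
qed

text \<open>In a sorted word equal letters are neighbours, and an operator applied twice is
  zero.\<close>

lemma monomial_form_not_distinct:
  "sorted w \<Longrightarrow> \<not> distinct w \<Longrightarrow> monomial_form w p = (\<lambda>vs. 0)"
proof (induction w)
  case (Cons g w)
  show ?case
  proof (cases "distinct w")
    case False
    then show ?thesis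
      using Cons by (simp add: monomial_form_Cons W_zero)
  next
    case True
    then have "g \<in> set w" using Cons.prems by simp
    then obtain h w' where w: "w = h # w'" by (cases w) auto
    have "g \<le> h" "h \<le> g"
      using Cons.prems \<open>g \<in> set w\<close> w by auto
    then have "h = g" by simp
    then show ?thesis
      by (simp add: w monomial_form_Cons W_same)
  qed
qed simp

lemma realization_add: "realization (a + b) p vs = realization a p vs + realization b p vs"
  by (simp add: realization_def sum.distrib distrib_right)

lemma realization_scale: "realization (c *\<^sub>R a) p vs = c * realization a p vs"
  by (simp add: realization_def sum_distrib_left mult.assoc)

lemma realization_zero: "realization 0 p vs = 0" "realization (\<lambda>w. 0) p vs = 0"
  by (simp_all add: realization_def)

lemma realization_sum: "realization (\<Sum>i\<in>A. f i) p vs = (\<Sum>i\<in>A. realization (f i) p vs)"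
proof (induction A rule: infinite_finite_induct)
  case (insert x A)
  then show ?case
    unfolding sum.insert[OF insert(1,2)] realization_add by simp
qed (simp_all add: realization_zero)

lemma realization_monomial:
  assumes "w \<in> mons"
  shows "realization (monomial w) p vs = monomial_form w p vs"
proof -
  have "realization (monomial w) p vs = (\<Sum>u\<in>mons. if u = w then monomial_form u p vs else 0)"
    unfolding realization_def monomial_def by (intro sum.cong) auto
  then show ?thesis
    using assms finite_mons by simp
qed

lemma mono_mult_cases:
  assumes "u \<in> mons" "v \<in> mons"
  obtains "mono_mult deg u v = 0" "\<not> distinct (u @ v)"
  | "mono_mult deg u v = koszul_sign deg u v *\<^sub>R monomial (sort (u @ v))" "sort (u @ v) \<in> mons"
proof (cases "set u \<inter> set v = {}")
  case True
  then have "sort (u @ v) \<in> mons"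
    using assms by (auto simp: mons_iff)
  then show thesis
    using that(2) True by (simp add: mono_mult_def)
next
  case False
  then have "\<exists>g\<in>set u \<inter> set v. odd (deg g)" using odd_deg by blast
  then show thesis
    using that(1) False by (simp add: mono_mult_def)
qed

lemma realization_mono_mult:
  assumes "u \<in> mons" "v \<in> mons"
  shows "realization (mono_mult deg u v) p vs = wdg (monomial_form u p) (monomial_form v p) vs"
proof -
  have su: "sorted u" and sv: "sorted v" using assms by (simp_all add: mons_iff)
  show ?thesis
    using assms
  proof (cases rule: mono_mult_cases)
    case 1
    then have "monomial_form (sort (u @ v)) p = (\<lambda>vs. 0)"
      by (intro monomial_form_not_distinct) simp_all
    then show ?thesis
      using 1 by (simp add: realization_zero wdg_monomial_forms monomial_form_append[OF sv su])
  next
    case 2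
    then show ?thesis
      by (simp add: realization_scale realization_monomial wdg_monomial_forms monomial_form_append[OF sv su])
  qed
qed

lemma supp_mono_mult:
  assumes "u \<in> mons" "v \<in> mons"
  shows "supp (mono_mult deg u v) \<subseteq> mons"
  using assms
proof (cases rule: mono_mult_cases)
  case 2
  then show ?thesis using supp_scale[of "koszul_sign deg u v" "monomial (sort (u @ v))"]
    by (simp add: supp_monomial) blast
qed (simp add: supp_zero)

lemma supp_free_mult:
  assumes "supp a \<subseteq> mons" "supp b \<subseteq> mons"
  shows "supp (free_mult deg a b) \<subseteq> mons"
  unfolding free_mult_superset[OF finite_mons assms]
proof (intro supp_sum)
  fix u v assume "u \<in> mons" "v \<in> mons"
  from order_trans[OF supp_scale supp_mono_mult[OF this]]
  show "supp ((a u * b v) *\<^sub>R mono_mult deg u v) \<subseteq> mons" .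
qed

lemma realization_mult:
  assumes "supp a \<subseteq> mons" "supp b \<subseteq> mons"
  shows "realization (free_mult deg a b) p vs = wdg (realization a p) (realization b p) vs"
proof -
  have "realization (free_mult deg a b) p vs =
      (\<Sum>u\<in>mons. \<Sum>v\<in>mons. a u * b v * wdg (monomial_form u p) (monomial_form v p) vs)"
    unfolding free_mult_superset[OF finite_mons assms] realization_sum realization_scale
    by (intro sum.cong refl) (simp add: realization_mono_mult)
  also have "\<dots> = wdg (realization a p) (realization b p) vs"
    unfolding realization_def[abs_def]
    by (simp add: wdg_sum_left wdg_sum_right wdg_cmult_left wdg_cmult_right sum_distrib_left mult.assoc)
  finally show ?thesis .
qed

lemma realization_mult_generator:
  assumes "g \<in> X" "supp a \<subseteq> mons"
  shows "realization (free_mult deg (monomial [g]) a) p vs = W g p (realization a p) vs"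
proof -
  have g: "[g] \<in> mons" using assms by (simp add: mons_iff)
  have "realization (monomial [g]) p = monomial_form [g] p"
    by (rule ext) (rule realization_monomial[OF g])
  then show ?thesis
    using realization_mult[of "monomial [g]" a p vs] assms g by (simp add: supp_monomial wdg_monomial_form)
qed

end

text \<open>The Leibniz rule for a single generator; by induction on words it identifies the free
  differential with \<open>ext\<close>.\<close>

locale odd_dga_model = odd_model +
  assumes ext_W: "\<And>g \<beta> p vs. g \<in> X \<Longrightarrow> smooth_field \<beta> \<Longrightarrow>
    ext (\<lambda>p. W g p (\<beta> p)) p vs = wdg (realization (dg g) p) (\<beta> p) vs - W g p (ext \<beta> p) vs"
begin

lemma mons_ConsD: "g # w \<in> mons \<Longrightarrow> g \<in> X \<and> w \<in> mons"
  by (auto simp: mons_iff)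

text \<open>The support is tracked along with the identity, because a product is known to be
  realized correctly when both factors are supported on monomials.\<close>

lemma mono_diff_realization:
  "w \<in> mons \<Longrightarrow> supp (mono_diff deg dg w) \<subseteq> mons \<and>
    realization (mono_diff deg dg w) = ext (monomial_form w)"
proof (induction w)
  case Nil
  then show ?case
    by (simp add: supp_zero fun_eq_iff realization_zero monomial_form_Nil ext_def)
next
  case (Cons g w)
  have gw: "g \<in> X" "w \<in> mons" using mons_ConsD[OF Cons.prems] by simp_all
  then have g: "[g] \<in> mons" by (simp add: mons_iff)
  note IH = Cons.IH[OF gw(2)]
  have s1: "supp (free_mult deg (dg g) (monomial w)) \<subseteq> mons"
    by (rule supp_free_mult[OF supp_dg[OF gw(1)]]) (use gw in \<open>simp add: supp_monomial\<close>)
  have s2: "supp (free_mult deg (monomial [g]) (mono_diff deg dg w)) \<subseteq> mons"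
    by (rule supp_free_mult) (use g IH in \<open>simp_all add: supp_monomial\<close>)
  have "supp (mono_diff deg dg (g # w)) \<subseteq> mons"
    unfolding mono_diff.simps
    by (intro order_trans[OF supp_add] Un_least s1 order_trans[OF supp_scale s2])
  moreover have "realization (mono_diff deg dg (g # w)) p vs = ext (monomial_form (g # w)) p vs" for p vs
  proof -
    have rw: "realization (monomial w) p = monomial_form w p"
      by (rule ext) (rule realization_monomial[OF gw(2)])
    have "ext (monomial_form (g # w)) p vs = ext (\<lambda>p. W g p (monomial_form w p)) p vs"
      unfolding monomial_form_Cons ..
    also have "\<dots> = wdg (realization (dg g) p) (monomial_form w p) vs - W g p (ext (monomial_form w) p) vs"
      by (rule ext_W[OF gw(1) smooth_monomial_form])
    also have "\<dots> = realization (mono_diff deg dg (g # w)) p vs"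
      unfolding mono_diff.simps realization_add realization_scale
      using odd_deg[of g] IH realization_mult[OF supp_dg[OF gw(1)], of "monomial w" p vs] gw
        realization_mult_generator[OF gw(1), of "mono_diff deg dg w" p vs]
      by (simp add: supp_monomial rw)
    finally show ?thesis ..
  qed
  ultimately show ?case by (intro conjI ext)
qed

lemma supp_free_diff:
  assumes "supp a \<subseteq> mons"
  shows "supp (free_diff deg dg a) \<subseteq> mons"
  unfolding free_diff_superset[OF finite_mons assms]
proof (rule supp_sum)
  fix w assume "w \<in> mons"
  from mono_diff_realization[OF this] show "supp (a w *\<^sub>R mono_diff deg dg w) \<subseteq> mons"
    by (intro order_trans[OF supp_scale]) simp
qed

lemma realization_diff:
  assumes "supp a \<subseteq> mons"
  shows "realization (free_diff deg dg a) = ext (realization a)"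
proof (intro ext)
  fix p vs
  have "realization (free_diff deg dg a) p vs = (\<Sum>w\<in>mons. a w * ext (monomial_form w) p vs)"
    unfolding free_diff_superset[OF finite_mons assms] realization_sum realization_scale
    by (intro sum.cong refl) (simp add: mono_diff_realization)
  also have "\<dots> = (\<Sum>w\<in>mons. ext (\<lambda>p vs. a w * monomial_form w p vs) p vs)"
    by (simp add: ext_cmult smooth_monomial_form)
  also have "\<dots> = ext (realization a) p vs"
    unfolding realization_def[abs_def]
    by (rule ext_sum[symmetric]) (intro smooth_field_mult smooth_const smooth_monomial_form)
  finally show "realization (free_diff deg dg a) p vs = ext (realization a) p vs" .
qed

lemma supp_free_component: "a \<in> free_component X deg n \<Longrightarrow> supp a \<subseteq> mons"
  by (auto simp: free_component_def)

lemma linear_free_dga: "linear_dga (free_dga X deg dg)"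
  unfolding linear_dga_def
proof (intro allI conjI ballI)
  fix n
  show "subspace (component (free_dga X deg dg) n)"
    by (simp add: free_dga_def subspace_free_component)
  fix a assume "a \<in> component (free_dga X deg dg) n"
  then have a: "supp a \<subseteq> mons"
    using supp_free_component by (simp add: free_dga_def)
  have sa: "supp (c *\<^sub>R a) \<subseteq> mons" for c
    using supp_scale[of c a] a by blast
  show "gdiff (free_dga X deg dg) (c *\<^sub>R a) = c *\<^sub>R gdiff (free_dga X deg dg) a" for c
    using free_diff_superset[OF finite_mons a] free_diff_superset[OF finite_mons sa]
    by (simp add: free_dga_def scaleR_sum_right)
  fix b assume "b \<in> component (free_dga X deg dg) n"
  then have b: "supp b \<subseteq> mons"
    using supp_free_component by (simp add: free_dga_def)
  have ab: "supp (a + b) \<subseteq> mons"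
    using supp_add[of a b] a b by blast
  show "gdiff (free_dga X deg dg) (a + b) = gdiff (free_dga X deg dg) a + gdiff (free_dga X deg dg) b"
    using free_diff_superset[OF finite_mons a] free_diff_superset[OF finite_mons b]
      free_diff_superset[OF finite_mons ab]
    by (simp add: free_dga_def sum.distrib scaleR_add_left)
qed

lemma dga_hom_realization:
  assumes L: "osc_lattice_quotient L"
    and inv: "\<And>a n. a \<in> free_component X deg n \<Longrightarrow> realization a \<in> invariant_forms L n"
  shows "dga_hom (free_dga X deg dg) (de_Rham (osc_quotient L)) (\<lambda>a. desc L (realization a))"
proof -
  interpret osc_lattice_quotient L by (rule L)
  have add: "realization (a + b) = (\<lambda>p vs. realization a p vs + realization b p vs)" for a b
    by (simp add: fun_eq_iff realization_add)
  have scale: "realization (c *\<^sub>R a) = (\<lambda>p vs. c * realization a p vs)" for a c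
    by (simp add: fun_eq_iff realization_scale)
  have mult: "realization (free_mult deg a b) = (\<lambda>p. wdg (realization a p) (realization b p))"
    if "a \<in> free_component X deg m" "b \<in> free_component X deg n" for a b m n
    using that supp_free_component by (intro ext realization_mult) blast+
  have one: "realization (monomial []) = (\<lambda>p. unit0)"
    by (intro ext) (simp add: realization_monomial mons_iff monomial_form_Nil)
  show ?thesis
    unfolding dga_hom_def
  proof (intro conjI allI ballI)
    show "desc L (realization a) \<in> component dR n" if "a \<in> component (free_dga X deg dg) n" for a n
      using that inv by (simp add: component_de_Rham free_dga_def)
    show "desc L (realization (a + b)) = desc L (realization a) + desc L (realization b)" for a b
      by (simp add: add desc_add)
    show "desc L (realization (c *\<^sub>R a)) = c *\<^sub>R desc L (realization a)" for a c
      by (simp add: scale desc_scale)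
    show "desc L (realization (gmult (free_dga X deg dg) a b)) =
        gmult dR (desc L (realization a)) (desc L (realization b))"
      if "a \<in> component (free_dga X deg dg) m" "b \<in> component (free_dga X deg dg) n" for a b m n
      using mult that by (simp add: free_dga_def de_Rham_def desc_wedge)
    show "desc L (realization (gone (free_dga X deg dg))) = gone dR"
      by (simp add: free_dga_def de_Rham_def desc_unit one)
    show "desc L (realization (gdiff (free_dga X deg dg) a)) = gdiff dR (desc L (realization a))"
      if "a \<in> component (free_dga X deg dg) n" for a n
      using that realization_diff[OF supp_free_component, of a n] gdiff_desc[OF inv]
      by (simp add: free_dga_def)
  qed
qed

end

section \<open>The models\<close>

text \<open>The sign on generator 2 reconciles \<open>dz\<^sub>1 = - x\<^sub>1 y\<^sub>1\<close> with \<open>d\<zeta> = dX \<and> dY\<close>.\<close>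

definition covector_0 :: "nat \<Rightarrow> real4 \<Rightarrow> real4 \<Rightarrow> real"
  where "covector_0 g p = (if g = 0 then coframe 1 p else if g = 1 then coframe 2 p
    else if g = 2 then (\<lambda>v. - coframe 3 p v) else coframe 0 p)"

lemma smooth_covector_0: "smooth_field (covector_0 g)"
proof -
  have "smooth_field (\<lambda>p v. - coframe 3 p v)"
    using smooth_field_mult[OF smooth_const[of "-1"] smooth_field_coframe[of 3]] by simp
  moreover have "covector_0 g = coframe 1 \<or> covector_0 g = coframe 2 \<or>
      covector_0 g = (\<lambda>p v. - coframe 3 p v) \<or> covector_0 g = coframe 0"
    by (auto simp: covector_0_def fun_eq_iff)
  ultimately show ?thesis
    using smooth_field_coframe by metis
qed

definition gen_op_0 :: "nat \<Rightarrow> real4 \<Rightarrow> (real4 list \<Rightarrow> real) \<Rightarrow> real4 list \<Rightarrow> real"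
  where "gen_op_0 g p = w1 (covector_0 g p)"

lemma monomials_model_0: "monomials model_0_gens model_0_deg = basis"
  by (rule Set.set_eqI, subst monomials_odd)
    (auto simp: model_0_deg_def model_0_gens_def basis_iff strict_sorted_iff)

lemma supp_model_0_diff: "supp (model_0_diff g) = (if g = 2 then {[0, 1]} else {})"
  by (auto simp: model_0_diff_def supp_def monomial_def)

interpretation m0: odd_model model_0_gens model_0_deg model_0_diff gen_op_0
proof
  show "supp (model_0_diff g) \<subseteq> monomials model_0_gens model_0_deg" for g
    unfolding monomials_model_0 by (simp add: supp_model_0_diff basis_eq)
  show "gen_op_0 g p (gen_op_0 h p \<beta>) = (\<lambda>vs. - gen_op_0 h p (gen_op_0 g p \<beta>) vs)" for g h p \<beta>
    unfolding gen_op_0_def by (rule w1_anticommute)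
  show "wdg (gen_op_0 g p \<beta>) \<eta> = gen_op_0 g p (wdg \<beta> \<eta>)" for g p \<beta> \<eta>
    unfolding gen_op_0_def by (rule ext) (rule wdg_w1)
qed (simp_all add: gen_op_0_def model_0_gens_def model_0_deg_def w1_add w1_cmult smooth_field_w1
      smooth_covector_0)

interpretation m0: odd_dga_model model_0_gens model_0_deg model_0_diff gen_op_0
proof
  fix g p vs and \<beta> :: "real4 \<Rightarrow> real4 list \<Rightarrow> real" assume g: "g \<in> model_0_gens" and \<beta>: "smooth_field \<beta>"
  show "ext (\<lambda>p. gen_op_0 g p (\<beta> p)) p vs =
    wdg (m0.realization (model_0_diff g) p) (\<beta> p) vs - gen_op_0 g p (ext \<beta> p) vs"
  proof (cases "g = 2")
    case True
    have "m0.realization (model_0_diff 2) p vs = - 1 * w1 (coframe 1 p) (w1 (coframe 2 p) unit0) vs" for vs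
    proof -
      have "model_0_diff 2 = (- 1) *\<^sub>R monomial [0, 1]"
        by (simp add: model_0_diff_def fun_eq_iff)
      moreover have "[0, 1] \<in> monomials model_0_gens model_0_deg"
        by (simp add: monomials_model_0 basis_eq)
      ultimately show ?thesis
        by (simp only: m0.realization_scale m0.realization_monomial)
          (simp add: m0.monomial_form_Cons m0.monomial_form_Nil gen_op_0_def covector_0_def)
    qed
    then have "m0.realization (model_0_diff 2) p =
        (\<lambda>vs. - 1 * w1 (coframe 1 p) (w1 (coframe 2 p) unit0) vs)"
      by (rule ext)
    moreover have "wdg (w1 \<theta> \<gamma>) \<eta> = w1 \<theta> (wdg \<gamma> \<eta>)" "wdg unit0 \<eta> = \<eta>"
      for \<theta> \<gamma> and \<eta> :: "real4 list \<Rightarrow> real"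
      by (rule ext, rule wdg_w1) (rule ext, rule wdg_unit_left)
    ultimately have "wdg (m0.realization (model_0_diff 2) p) (\<beta> p) vs =
        - 1 * w1 (coframe 1 p) (w1 (coframe 2 p) (\<beta> p)) vs"
      by (simp only: wdg_cmult_left)
    moreover have "ext (\<lambda>p. w1 (covector_0 2 p) (\<beta> p)) p vs = - 1 * ext (\<lambda>p. w1 (coframe 3 p) (\<beta> p)) p vs"
    proof -
      have "(\<lambda>p. w1 (covector_0 2 p) (\<beta> p)) = (\<lambda>p vs. - 1 * w1 (coframe 3 p) (\<beta> p) vs)"
        by (intro ext) (simp add: covector_0_def w1_minus_left)
      then show ?thesis
        by (simp only: ext_cmult[OF smooth_field_w1[OF smooth_field_coframe \<beta>]])
    qed
    ultimately show ?thesis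
      using True ext_coframe_3[OF \<beta>, of p] by (simp add: gen_op_0_def covector_0_def w1_minus_left)
  next
    case False
    then have "model_0_diff g = (\<lambda>w. 0)"
      by (simp add: model_0_diff_def fun_eq_iff)
    then have "m0.realization (model_0_diff g) p = (\<lambda>vs. 0)"
      by (intro ext) (simp only: m0.realization_zero)
    moreover obtain i where "i < 3" "covector_0 g = coframe i"
      using g False that[of 1] that[of 2] that[of 0]
      by (auto simp: model_0_gens_def covector_0_def fun_eq_iff)
    ultimately show ?thesis
      using ext_coframe_closed[OF _ \<beta>, of i p] by (simp add: gen_op_0_def)
  qed
qed

text \<open>Coefficients of the realized form in the coframe basis. The generators 0, 1, 2, 3 become
  \<open>dX\<close>, \<open>dY\<close>, \<open>- \<zeta>\<close>, \<open>dt\<close>; one minus sign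
  comes with \<zeta>, and one with each factor that \<open>dt\<close> passes on its way from the
  last place to the first.\<close>

definition coeffs_0 :: "(nat list \<Rightarrow> real) \<Rightarrow> nat list \<Rightarrow> real"
  where "coeffs_0 a = (\<lambda>_. 0)([] := a [], [1] := a [0], [2] := a [1], [3] := - a [2], [0] := a [3],
    [1, 2] := a [0, 1], [1, 3] := - a [0, 2], [0, 1] := - a [0, 3], [2, 3] := - a [1, 2],
    [0, 2] := - a [1, 3], [0, 3] := a [2, 3], [1, 2, 3] := - a [0, 1, 2], [0, 1, 2] := a [0, 1, 3],
    [0, 1, 3] := - a [0, 2, 3], [0, 2, 3] := - a [1, 2, 3], [0, 1, 2, 3] := a [0, 1, 2, 3])"

lemma realization_0: "m0.realization a = const_form (coeffs_0 a)"
proof (intro ext)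
  fix p vs
  note s = w1_anticommute[of "coframe i p" "coframe 0 p" for i]
  show "m0.realization a p vs = const_form (coeffs_0 a) p vs"
    unfolding m0.realization_def const_form_def monomials_model_0 basis_eq
    by (simp add: m0.monomial_form_Cons m0.monomial_form_Nil gen_op_0_def covector_0_def cowedge_Cons coeffs_0_def
      w1_minus_left' w1_minus s[of 1] s[of 2] s[of 3])
qed

text \<open>Up to signs \<open>coeffs_0\<close> permutes the sixteen words, so nothing is
  lost.\<close>

lemma coeffs_0_eqD:
  assumes "supp a \<subseteq> basis" "supp b \<subseteq> basis" "\<And>J. J \<in> basis \<Longrightarrow> coeffs_0 a J = coeffs_0 b J"
  shows "a = b"
proof
  fix w
  show "a w = b w"
  proof (cases "w \<in> basis")
    case True
    then show ?thesis
      using assms(3)[of "[]"] assms(3)[of "[0]"] assms(3)[of "[1]"] assms(3)[of "[2]"] assms(3)[of "[3]"]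
        assms(3)[of "[0, 1]"] assms(3)[of "[0, 2]"] assms(3)[of "[0, 3]"] assms(3)[of "[1, 2]"]
        assms(3)[of "[1, 3]"] assms(3)[of "[2, 3]"] assms(3)[of "[0, 1, 2]"] assms(3)[of "[0, 1, 3]"]
        assms(3)[of "[0, 2, 3]"] assms(3)[of "[1, 2, 3]"] assms(3)[of "[0, 1, 2, 3]"]
      unfolding basis_eq by (elim insertE emptyE; simp add: coeffs_0_def)
  next
    case False
    then have "w \<notin> supp a" "w \<notin> supp b" using assms(1,2) by auto
    then show ?thesis by (simp add: supp_def)
  qed
qed

text \<open>Rather than expanding the Leibniz rule word by word, the differential is read off from
  the realized form with constant coefficients and carried back by injectivity of
  \<open>coeffs_0\<close>.\<close>

lemma free_diff_model_0:
  assumes a: "supp a \<subseteq> basis"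
  shows "free_diff model_0_deg model_0_diff a =
    (\<lambda>w. if w = [0, 1] then - a [2] else if w = [0, 1, 3] then - a [2, 3] else 0)" (is "?d = ?r")
proof (rule coeffs_0_eqD)
  show "supp ?d \<subseteq> basis"
    using m0.supp_free_diff[of a] a by (simp add: monomials_model_0)
  show "supp ?r \<subseteq> basis"
    by (auto simp: supp_def basis_eq)
  have "const_form (coeffs_0 ?d) = ext (const_form (coeffs_0 a))"
    using m0.realization_diff[of a] a by (simp add: monomials_model_0 realization_0)
  also have "\<dots> = form_of (diff_coeff (\<lambda>I q. coeffs_0 a I))"
    unfolding const_form_eq by (rule ext_form_of_eq) (rule smooth_const)
  finally have e: "form_of (\<lambda>I q. coeffs_0 ?d I) = form_of (diff_coeff (\<lambda>I q. coeffs_0 a I))"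
    unfolding const_form_eq .
  fix J assume J: "J \<in> basis"
  have "coeffs_0 ?d J = diff_coeff (\<lambda>I q. coeffs_0 a I) J 0"
    by (rule form_of_eqD[OF e J])
  also have "\<dots> = (if J = [1, 2] then coeffs_0 a [3] else if J = [0, 1, 2] then - coeffs_0 a [0, 3] else 0)"
    by (simp add: diff_coeff_def)
  also have "\<dots> = coeffs_0 ?r J"
    using J unfolding basis_eq by (elim insertE emptyE; hypsubst; simp add: coeffs_0_def)
  finally show "coeffs_0 ?d J = coeffs_0 ?r J" .
qed

lemma minimal_sullivan_model_0: "minimal_sullivan model_0_gens model_0_deg model_0_diff"
  unfolding minimal_sullivan_def
proof (intro conjI ballI allI)
  show "model_0_diff g \<in> free_component model_0_gens model_0_deg (Suc (model_0_deg g))" for g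
    by (simp add: free_component_def supp_model_0_diff monomials_model_0 basis_eq model_0_deg_def)
  show "set w \<subseteq> {..<g}" if "w \<in> supp (model_0_diff g)" for g w
    using that by (auto simp: supp_model_0_diff split: if_splits)
  fix n a assume "a \<in> free_component model_0_gens model_0_deg n"
  then have a: "supp a \<subseteq> basis"
    using m0.supp_free_component monomials_model_0 by simp
  then have d: "supp (free_diff model_0_deg model_0_diff a) \<subseteq> basis"
    using m0.supp_free_diff[of a] by (simp add: monomials_model_0)
  show "free_diff model_0_deg model_0_diff (free_diff model_0_deg model_0_diff a) = 0"
    unfolding free_diff_model_0[OF d] unfolding free_diff_model_0[OF a] by (simp add: fun_eq_iff)
  show "2 \<le> length w" if "w \<in> supp (free_diff model_0_deg model_0_diff a)" for w
    using that unfolding free_diff_model_0[OF a] by (auto simp: supp_def split: if_splits)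
qed (simp add: model_0_deg_def)

lemma free_component_model_0:
  "a \<in> free_component model_0_gens model_0_deg n \<longleftrightarrow> (\<forall>w. a w \<noteq> 0 \<longrightarrow> w \<in> basis \<and> length w = n)"
proof -
  have "sum_list (map model_0_deg w) = length w" for w
    by (induction w) (simp_all add: model_0_deg_def)
  then show ?thesis
    using finite_subset[OF _ finite_basis, of "supp a"]
    by (auto simp: free_component_def monomials_model_0 supp_def)
qed

lemma coeffs_0_length:
  assumes "a \<in> free_component model_0_gens model_0_deg n" "coeffs_0 a I \<noteq> 0"
  shows "length I = n"
  using assms(2) assms(1)[unfolded free_component_model_0, rule_format]
  unfolding coeffs_0_def by (fastforce split: if_splits)

lemma quasi_isomorphism_model_0:
  assumes Q: "osc_lattice_quotient (osc_lattice k (2 * pi))" and k: "k \<ge> 1"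
  shows "quasi_isomorphism (free_dga model_0_gens model_0_deg model_0_diff)
    (de_Rham (osc_quotient (osc_lattice k (2 * pi)))) (\<lambda>a. desc (osc_lattice k (2 * pi)) (m0.realization a))"
    (is "quasi_isomorphism ?A _ _")
proof -
  let ?L = "osc_lattice k (2 * pi)"
  interpret osc_lattice_quotient ?L by (rule Q)
  note B = cohomology_basis_2pi[OF k]
  note B1 = B[unfolded cohomology_basis_def, THEN conjunct2, THEN conjunct1, rule_format]
    and B2 = B[unfolded cohomology_basis_def, THEN conjunct2, THEN conjunct2, THEN conjunct1, rule_format]
  show ?thesis
  proof (rule quasi_isomorphismI[OF m0.linear_free_dga linear_dga_de_Rham])
    show "dga_hom ?A dR (\<lambda>a. desc ?L (m0.realization a))"
    proof (rule m0.dga_hom_realization[OF Q])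
      fix a n assume "a \<in> free_component model_0_gens model_0_deg n"
      then show "m0.realization a \<in> invariant_forms ?L n"
        unfolding realization_0 by (intro const_form_invariant_2pi coeffs_0_length)
    qed
  next
    fix j a assume a: "a \<in> cocycles ?A j" "desc ?L (m0.realization a) \<in> coboundaries dR j"
    have aj: "w \<in> basis \<and> length w = j" if "a w \<noteq> 0" for w
      using a(1) that unfolding cocycles_def by (simp add: free_dga_def free_component_model_0)
    have "coeffs_0 a J = 0" if "J \<in> basis" "J \<noteq> [1, 2]" "J \<noteq> [0, 1, 2]" for J
      using B2[of "coeffs_0 a" j J] a(2) that by (simp add: realization_0 desc_coboundary_iff)
    then have c: "coeffs_0 a [] = 0" "coeffs_0 a [0] = 0" "coeffs_0 a [1] = 0" "coeffs_0 a [2] = 0"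
      "coeffs_0 a [3] = 0" "coeffs_0 a [0, 1] = 0" "coeffs_0 a [0, 2] = 0" "coeffs_0 a [0, 3] = 0"
      "coeffs_0 a [1, 3] = 0" "coeffs_0 a [2, 3] = 0" "coeffs_0 a [0, 1, 3] = 0" "coeffs_0 a [0, 2, 3] = 0"
      "coeffs_0 a [1, 2, 3] = 0" "coeffs_0 a [0, 1, 2, 3] = 0"
      by (simp_all add: basis_eq)
    \<comment> \<open>Only \<open>x_1 y_1\<close> and \<open>x_1 y_1 t_1\<close> can become exact;
      in the model they are the differentials of \<open>- z_1\<close> and
      \<open>- z_1 t_1\<close>.\<close>
    define x :: "nat list \<Rightarrow> real"
      where "x = (\<lambda>w. if w = [2] then - a [0, 1] else if w = [2, 3] then - a [0, 1, 3] else 0)"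
    have xb: "supp x \<subseteq> basis" by (auto simp: x_def supp_def basis_eq)
    have ax: "a = free_diff model_0_deg model_0_diff x"
    proof (rule coeffs_0_eqD)
      show "supp a \<subseteq> basis" using aj by (auto simp: supp_def)
      show "supp (free_diff model_0_deg model_0_diff x) \<subseteq> basis"
        using m0.supp_free_diff[of x] xb by (simp add: monomials_model_0)
      have c': "a [] = 0" "a [0] = 0" "a [1] = 0" "a [2] = 0" "a [3] = 0" "a [0, 2] = 0" "a [0, 3] = 0"
        "a [1, 2] = 0" "a [1, 3] = 0" "a [2, 3] = 0" "a [0, 1, 2] = 0" "a [0, 2, 3] = 0" "a [1, 2, 3] = 0"
        "a [0, 1, 2, 3] = 0"
        using c by (simp_all add: coeffs_0_def)
      have "coeffs_0 a J = coeffs_0 (\<lambda>w. if w = [0, 1] then a [0, 1] else if w = [0, 1, 3] then a [0, 1, 3] else 0) J" for J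
        unfolding coeffs_0_def by (simp add: c' cong: if_cong)
      moreover have "- x [2] = a [0, 1]" "- x [2, 3] = a [0, 1, 3]"
        by (simp_all add: x_def)
      ultimately show "coeffs_0 a J = coeffs_0 (free_diff model_0_deg model_0_diff x) J" for J
        unfolding free_diff_model_0[OF xb] by (simp only:)
    qed
    show "a \<in> coboundaries ?A j"
    proof (cases j)
      \<comment> \<open>Degree 0 is separate because its only coboundary is zero; neither of the two
        words has length 0.\<close>
      case 0
      then have "a [0, 1] = 0" "a [0, 1, 3] = 0"
        using aj[of "[0, 1]"] aj[of "[0, 1, 3]"] by auto
      then have "x = (\<lambda>w. 0)" by (simp add: x_def fun_eq_iff)
      then have "a = 0" using ax free_diff_model_0[OF xb] by (simp add: fun_eq_iff)
      then show ?thesis using 0 by (simp add: coboundaries_def)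
    next
      case (Suc m)
      have "x \<in> free_component model_0_gens model_0_deg m"
        unfolding free_component_model_0 using aj[of "[0, 1]"] aj[of "[0, 1, 3]"] Suc
        by (auto simp: x_def basis_eq split: if_splits)
      then show ?thesis
        using Suc ax by (auto simp: coboundaries_def free_dga_def)
    qed
  next
    fix j b assume "b \<in> cocycles dR j"
    then obtain w where w: "w \<in> invariant_forms ?L j" "\<And>p vs. ext w p vs = 0" "b = desc ?L w"
      by (rule cocycle_desc) (rule that)
    have "w \<in> invariant_forms ?L j \<and> (\<forall>p vs. ext w p vs = 0)"
      using w(1,2) by simp
    from B1[OF this] obtain c where c: "\<forall>I. c I \<noteq> 0 \<longrightarrow> I \<in> reps_0 \<and> length I = j"
      "(\<lambda>p vs. w p vs - const_form c p vs) \<in> exact_forms ?L j"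
      by (elim exE conjE) (rule that)
    \<comment> \<open>The inverse of \<open>coeffs_0\<close> on the words of \<open>reps_0\<close>.
      The words for \<open>z_1\<close>, \<open>z_1 t_1\<close>, \<open>x_1 y_1\<close> and
      \<open>x_1 y_1 t_1\<close> get coefficient 0.\<close>
    define a :: "nat list \<Rightarrow> real" where "a = (\<lambda>_. 0)([] := c [], [0] := c [1], [1] := c [2], [3] := c [0],
      [0, 2] := - c [1, 3], [0, 3] := - c [0, 1], [1, 2] := - c [2, 3], [1, 3] := - c [0, 2],
      [0, 1, 2] := - c [1, 2, 3], [0, 2, 3] := - c [0, 1, 3], [1, 2, 3] := - c [0, 2, 3],
      [0, 1, 2, 3] := c [0, 1, 2, 3])"
    have cr: "c I = 0" if "I \<notin> reps_0" for I using c(1) that by blast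
    have ac: "coeffs_0 a = c"
    proof
      fix I
      show "coeffs_0 a I = c I"
      proof (cases "I \<in> reps_0")
        case True
        then show ?thesis
          unfolding reps_0_def by (elim insertE emptyE; hypsubst; simp add: coeffs_0_def a_def)
      next
        case False
        then show ?thesis
          using cr[OF False] by (simp add: reps_0_def coeffs_0_def a_def)
      qed
    qed
    have aj: "a \<in> free_component model_0_gens model_0_deg j"
      unfolding free_component_model_0
    proof (intro allI impI)
      fix w assume w: "a w \<noteq> 0"
      have len: "c I = 0" if "length I \<noteq> j" for I
        using c(1) that by blast
      let ?M = "{[], [0], [1], [3], [0, 2], [0, 3], [1, 2], [1, 3], [0, 1, 2], [0, 2, 3], [1, 2, 3], [0, 1, 2, 3]}"
      have M: "w \<in> ?M"
        by (rule ccontr) (use w in \<open>simp add: a_def\<close>)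
      have "a w = 0" if "length w \<noteq> j"
        using M that by (elim insertE emptyE; hypsubst; simp add: a_def len)
      moreover have "w \<in> basis"
        using M unfolding basis_eq by blast
      ultimately show "w \<in> basis \<and> length w = j"
        using w by blast
    qed
    have "free_diff model_0_deg model_0_diff a = 0"
    proof -
      have "supp a \<subseteq> basis" using aj unfolding free_component_model_0 by (auto simp: supp_def)
      from free_diff_model_0[OF this] show ?thesis by (simp add: a_def fun_eq_iff)
    qed
    then have "a \<in> cocycles ?A j"
      using aj by (simp add: cocycles_def free_dga_def)
    moreover have "b - desc ?L (m0.realization a) = desc ?L (\<lambda>p vs. w p vs - const_form c p vs)"
      using desc_add[of ?L w "\<lambda>p vs. - 1 * const_form c p vs"] desc_scale[of ?L "- 1" "const_form c"]
      by (simp add: w(3) realization_0 ac)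
    ultimately show "\<exists>a\<in>cocycles ?A j. b - desc ?L (m0.realization a) \<in> coboundaries dR j"
      using c(2) desc_coboundary_iff by (intro bexI[of _ a]) simp_all
  qed
qed

section \<open>The model with generators of degrees 1 and 3\<close>

definition gen_op_pi :: "nat \<Rightarrow> real4 \<Rightarrow> (real4 list \<Rightarrow> real) \<Rightarrow> real4 list \<Rightarrow> real"
  where "gen_op_pi g p \<beta> =
    (if g = 0 then w1 (coframe 0 p) \<beta> else w1 (coframe 1 p) (w1 (coframe 2 p) (w1 (coframe 3 p) \<beta>)))"

lemma monomials_model_pi: "monomials model_pi_gens model_pi_deg = {[], [0], [1], [0, 1]}"
proof (rule Set.set_eqI)
  fix w :: "nat list"
  have "w \<in> monomials model_pi_gens model_pi_deg \<longleftrightarrow> set w \<subseteq> {0, 1} \<and> sorted w \<and> distinct w"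
    by (subst monomials_odd) (simp_all add: model_pi_deg_def model_pi_gens_def)
  also have "\<dots> \<longleftrightarrow> w \<in> basis \<and> set w \<subseteq> {0, 1}"
    by (auto simp: basis_iff strict_sorted_iff)
  also have "\<dots> \<longleftrightarrow> w \<in> {[], [0], [1], [0, 1]}"
    unfolding basis_eq by auto
  finally show "w \<in> monomials model_pi_gens model_pi_deg \<longleftrightarrow> w \<in> {[], [0], [1], [0, 1]}" .
qed

text \<open>The square of the generator of degree 3: anticommutation brings the two copies of
  \<open>a\<close> together.\<close>

lemma w1_triple_same: "w1 a (w1 b (w1 c (w1 a (w1 b (w1 c \<beta>))))) = (\<lambda>vs. 0)"
  using w1_anticommute[of c a] w1_anticommute[of b a] by (simp add: w1_minus w1_same)

interpretation mpi: odd_model model_pi_gens model_pi_deg model_pi_diff gen_op_pi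
proof
  show "gen_op_pi g p (gen_op_pi h p \<beta>) = (\<lambda>vs. - gen_op_pi h p (gen_op_pi g p \<beta>) vs)" for g h p \<beta>
    using w1_anticommute[of "coframe i p" "coframe 0 p" for i]
    by (simp add: gen_op_pi_def w1_minus w1_same w1_triple_same)
  show "wdg (gen_op_pi g p \<beta>) \<eta> = gen_op_pi g p (wdg \<beta> \<eta>)" for g p \<beta> \<eta>
  proof -
    have "wdg (w1 \<theta> \<gamma>) \<eta> = w1 \<theta> (wdg \<gamma> \<eta>)" for \<theta> \<gamma>
      by (rule ext, rule wdg_w1)
    then show ?thesis by (simp add: gen_op_pi_def)
  qed
  show "smooth_field (\<lambda>p. gen_op_pi g p (\<beta> p))" if "smooth_field \<beta>" for g \<beta>
    unfolding gen_op_pi_def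
    by (cases "g = 0"; simp; intro smooth_field_w1 smooth_field_coframe that)
qed (simp_all add: gen_op_pi_def model_pi_gens_def model_pi_deg_def model_pi_diff_def supp_zero w1_add w1_cmult)

interpretation mpi: odd_dga_model model_pi_gens model_pi_deg model_pi_diff gen_op_pi
proof
  fix g p vs and \<beta> :: "real4 \<Rightarrow> real4 list \<Rightarrow> real" assume g: "g \<in> model_pi_gens" and \<beta>: "smooth_field \<beta>"
  have "model_pi_diff g = (\<lambda>w. 0)"
    by (simp add: model_pi_diff_def fun_eq_iff)
  then have r: "mpi.realization (model_pi_diff g) p = (\<lambda>vs. 0)"
    by (intro ext) (simp only: mpi.realization_zero)
  have s: "smooth_field (\<lambda>p. w1 (coframe i p) (\<gamma> p))" if "smooth_field \<gamma>" for i \<gamma>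
    by (intro smooth_field_w1 smooth_field_coframe that)
  have "ext (\<lambda>p. gen_op_pi g p (\<beta> p)) p vs = - gen_op_pi g p (ext \<beta> p) vs"
  proof (cases "g = 0")
    case True
    then show ?thesis
      using ext_coframe_closed[OF _ \<beta>, of 0 p] by (simp add: gen_op_pi_def)
  next
    case False
    \<comment> \<open>The form \<open>dX \<and> dY \<and> \<zeta>\<close> is closed because
      \<open>d\<zeta> = dX \<and> dY\<close> repeats the factors already present; here the repeated
      \<open>dX\<close> is enough.\<close>
    have 1: "w1 (coframe 1 p) (w1 (coframe 2 p) (w1 (coframe 1 p) \<gamma>)) = (\<lambda>vs. 0)" for \<gamma>
      by (simp add: w1_anticommute[of "coframe 2 p" "coframe 1 p"] w1_minus w1_same)
    have "ext (\<lambda>p. w1 (coframe 1 p) (w1 (coframe 2 p) (w1 (coframe 3 p) (\<beta> p)))) p =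
        (\<lambda>vs. - w1 (coframe 1 p) (w1 (coframe 2 p) (w1 (coframe 3 p) (ext \<beta> p))) vs)"
      using ext_coframe_closed[OF _ s[OF s[OF \<beta>]], of 1 2 3 p] ext_coframe_closed[OF _ s[OF \<beta>], of 2 3 p]
        ext_coframe_3[OF \<beta>, of p]
      by (simp add: w1_minus w1_diff 1)
    then show ?thesis
      using False by (simp add: gen_op_pi_def)
  qed
  then show "ext (\<lambda>p. gen_op_pi g p (\<beta> p)) p vs =
    wdg (mpi.realization (model_pi_diff g) p) (\<beta> p) vs - gen_op_pi g p (ext \<beta> p) vs"
    by (simp add: r)
qed

definition coeffs_pi :: "(nat list \<Rightarrow> real) \<Rightarrow> nat list \<Rightarrow> real"
  where "coeffs_pi a = (\<lambda>_. 0)([] := a [], [0] := a [0], [1, 2, 3] := a [1], [0, 1, 2, 3] := a [0, 1])"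

lemma realization_pi: "mpi.realization a = const_form (coeffs_pi a)"
  by (intro ext)
    (simp add: mpi.realization_def const_form_def monomials_model_pi basis_eq mpi.monomial_form_Cons
      mpi.monomial_form_Nil gen_op_pi_def cowedge_Cons coeffs_pi_def)

lemma mono_diff_model_pi: "mono_diff model_pi_deg model_pi_diff w = 0"
  by (induction w) (simp_all add: free_mult_def supp_zero model_pi_diff_def fun_eq_iff)

lemma free_diff_model_pi: "free_diff model_pi_deg model_pi_diff a = 0"
  unfolding free_diff_def mono_diff_model_pi by simp

lemma minimal_sullivan_model_pi: "minimal_sullivan model_pi_gens model_pi_deg model_pi_diff"
  unfolding minimal_sullivan_def free_diff_model_pi
  by (simp add: model_pi_deg_def model_pi_diff_def supp_zero free_component_def)

lemma free_component_model_pi: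
  "a \<in> free_component model_pi_gens model_pi_deg n \<longleftrightarrow>
    (\<forall>w. a w \<noteq> 0 \<longrightarrow> w \<in> {[], [0], [1], [0, 1]} \<and> sum_list (map model_pi_deg w) = n)"
  using finite_subset[of "supp a" "{[], [0], [1], [0, 1]}"]
  by (auto simp: free_component_def monomials_model_pi supp_def)

text \<open>With zero differential the free algebra is its own cohomology, and its four monomials
  are realized by the four words of \<open>reps_pi\<close>, which represent a basis of the de Rham
  classes.\<close>

lemma quasi_isomorphism_model_pi:
  assumes Q: "osc_lattice_quotient L" and B: "cohomology_basis L reps_pi"
  shows "quasi_isomorphism (free_dga model_pi_gens model_pi_deg model_pi_diff)
    (de_Rham (osc_quotient L)) (\<lambda>a. desc L (mpi.realization a))" (is "quasi_isomorphism ?A _ _")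
proof -
  interpret osc_lattice_quotient L by (rule Q)
  note B1 = B[unfolded cohomology_basis_def, THEN conjunct2, THEN conjunct1, rule_format]
    and B2 = B[unfolded cohomology_basis_def, THEN conjunct2, THEN conjunct2, THEN conjunct1, rule_format]
    and B3 = B[unfolded cohomology_basis_def, THEN conjunct2, THEN conjunct2, THEN conjunct2, rule_format]
  have supp: "I \<in> reps_pi \<and> length I = n"
    if a: "a \<in> free_component model_pi_gens model_pi_deg n" and I: "coeffs_pi a I \<noteq> 0" for a n I
  proof -
    have a': "a w \<noteq> 0 \<Longrightarrow> sum_list (map model_pi_deg w) = n" for w
      using a unfolding free_component_model_pi by blast
    consider "I = []" "a [] \<noteq> 0" | "I = [0]" "a [0] \<noteq> 0" | "I = [1, 2, 3]" "a [1] \<noteq> 0"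
      | "I = [0, 1, 2, 3]" "a [0, 1] \<noteq> 0"
      using I unfolding coeffs_pi_def by (auto split: if_splits)
    then show ?thesis
    proof cases
      case 1
      then show ?thesis using a'[OF 1(2)] by (simp add: reps_pi_def model_pi_deg_def)
    next
      case 2
      then show ?thesis using a'[OF 2(2)] by (simp add: reps_pi_def model_pi_deg_def)
    next
      case 3
      then show ?thesis using a'[OF 3(2)] by (simp add: reps_pi_def model_pi_deg_def)
    next
      case 4
      then show ?thesis using a'[OF 4(2)] by (simp add: reps_pi_def model_pi_deg_def)
    qed
  qed
  show ?thesis
  proof (rule quasi_isomorphismI[OF mpi.linear_free_dga linear_dga_de_Rham])
    show "dga_hom ?A dR (\<lambda>a. desc L (mpi.realization a))"
    proof (rule mpi.dga_hom_realization[OF Q])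
      fix a n assume "a \<in> free_component model_pi_gens model_pi_deg n"
      then show "mpi.realization a \<in> invariant_forms L n"
        unfolding realization_pi by (intro B3 supp)
    qed
  next
    fix j a assume a: "a \<in> cocycles ?A j" "desc L (mpi.realization a) \<in> coboundaries dR j"
    have "coeffs_pi a J = 0" if "J \<in> basis" "J \<noteq> [1, 2]" "J \<noteq> [0, 1, 2]" for J
      using B2[of "coeffs_pi a" j J] a(2) that by (simp add: realization_pi desc_coboundary_iff)
    then have "coeffs_pi a [] = 0" "coeffs_pi a [0] = 0" "coeffs_pi a [1, 2, 3] = 0"
      "coeffs_pi a [0, 1, 2, 3] = 0"
      by (simp_all add: basis_eq)
    then have z: "a [] = 0" "a [0] = 0" "a [1] = 0" "a [0, 1] = 0"
      by (simp_all add: coeffs_pi_def)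
    have "a w = 0" for w
    proof (cases "w \<in> {[], [0], [1], [0, 1]}")
      case True
      then show ?thesis using z by auto
    next
      case False
      then show ?thesis
        using a(1) unfolding cocycles_def by (auto simp: free_dga_def free_component_model_pi)
    qed
    then have "a = 0" by (simp add: fun_eq_iff)
    then show "a \<in> coboundaries ?A j"
      using subspace_0[OF subspace_coboundaries[OF mpi.linear_free_dga]] by simp
  next
    fix j b assume "b \<in> cocycles dR j"
    then obtain w where w: "w \<in> invariant_forms L j" "\<And>p vs. ext w p vs = 0" "b = desc L w"
      by (rule cocycle_desc) (rule that)
    have "w \<in> invariant_forms L j \<and> (\<forall>p vs. ext w p vs = 0)"
      using w(1,2) by simp
    from B1[OF this] obtain c where c: "\<forall>I. c I \<noteq> 0 \<longrightarrow> I \<in> reps_pi \<and> length I = j"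
      "(\<lambda>p vs. w p vs - const_form c p vs) \<in> exact_forms L j"
      by (elim exE conjE) (rule that)
    define a :: "nat list \<Rightarrow> real"
      where "a = (\<lambda>_. 0)([] := c [], [0] := c [0], [1] := c [1, 2, 3], [0, 1] := c [0, 1, 2, 3])"
    have cr: "c I = 0" if "I \<notin> reps_pi" for I using c(1) that by blast
    have ac: "coeffs_pi a = c"
    proof
      fix I
      show "coeffs_pi a I = c I"
        using cr[of I] by (auto simp: coeffs_pi_def a_def reps_pi_def)
    qed
    have "a \<in> free_component model_pi_gens model_pi_deg j"
      unfolding free_component_model_pi
    proof (intro allI impI)
      fix w assume w: "a w \<noteq> 0"
      consider "w = []" "c [] \<noteq> 0" | "w = [0]" "c [0] \<noteq> 0" | "w = [1]" "c [1, 2, 3] \<noteq> 0"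
        | "w = [0, 1]" "c [0, 1, 2, 3] \<noteq> 0"
        using w unfolding a_def by (auto split: if_splits)
      then show "w \<in> {[], [0], [1], [0, 1]} \<and> sum_list (map model_pi_deg w) = j"
      proof cases
        case 1
        then show ?thesis using c(1)[rule_format, OF 1(2)] by (simp add: model_pi_deg_def)
      next
        case 2
        then show ?thesis using c(1)[rule_format, OF 2(2)] by (simp add: model_pi_deg_def)
      next
        case 3
        then show ?thesis using c(1)[rule_format, OF 3(2)] by (simp add: model_pi_deg_def)
      next
        case 4
        then show ?thesis using c(1)[rule_format, OF 4(2)] by (simp add: model_pi_deg_def)
      qed
    qed
    then have "a \<in> cocycles ?A j"
      by (simp add: cocycles_def free_dga_def free_diff_model_pi)
    moreover have "b - desc L (mpi.realization a) = desc L (\<lambda>p vs. w p vs - const_form c p vs)"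
      using desc_add[of L w "\<lambda>p vs. - 1 * const_form c p vs"] desc_scale[of L "- 1" "const_form c"]
      by (simp add: w(3) realization_pi ac)
    ultimately show "\<exists>a\<in>cocycles ?A j. b - desc L (mpi.realization a) \<in> coboundaries dR j"
      using c(2) desc_coboundary_iff by (intro bexI[of _ a]) simp_all
  qed
qed

lemma osc_lattice_quotient_quarter:
  assumes k: "k \<ge> 1" and \<theta>: "\<theta> = pi / 2 * of_int n" "n > 0"
  shows "osc_lattice_quotient (osc_lattice k \<theta>)"
proof (rule osc_lattice_quotient.intro)
  show "subgroup (osc_lattice k \<theta>) oscillator"
    by (rule subgroup_osc_lattice[OF k \<theta>(1)])
  have "\<theta> > 0" unfolding \<theta>(1) using \<theta>(2) by simp
  then show "\<exists>c\<in>osc_quotient (osc_lattice k \<theta>). p \<in> fst c" for p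
    using osc_quotient_covers[OF k, of \<theta> p] by (simp add: case_prod_unfold)
qed

theorem theorem1p1:
  fixes k :: nat
  assumes "k \<ge> 1"
  shows
    "cohomology_dim (de_Rham (M_0 k)) 0 1 \<and>
     cohomology_dim (de_Rham (M_0 k)) 1 3 \<and>
     cohomology_dim (de_Rham (M_0 k)) 2 4 \<and>
     cohomology_dim (de_Rham (M_0 k)) 3 3 \<and>
     cohomology_dim (de_Rham (M_0 k)) 4 1 \<and>
     cohomology_dim (de_Rham (M_pi k)) 0 1 \<and>
     cohomology_dim (de_Rham (M_pi k)) 1 1 \<and>
     cohomology_dim (de_Rham (M_pi k)) 2 0 \<and>
     cohomology_dim (de_Rham (M_pi k)) 3 1 \<and>
     cohomology_dim (de_Rham (M_pi k)) 4 1 \<and>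
     cohomology_dim (de_Rham (M_pi2 k)) 0 1 \<and>
     cohomology_dim (de_Rham (M_pi2 k)) 1 1 \<and>
     cohomology_dim (de_Rham (M_pi2 k)) 2 0 \<and>
     cohomology_dim (de_Rham (M_pi2 k)) 3 1 \<and>
     cohomology_dim (de_Rham (M_pi2 k)) 4 1 \<and>
     minimal_model model_0_gens model_0_deg model_0_diff (M_0 k) \<and>
     minimal_model model_pi_gens model_pi_deg model_pi_diff (M_pi k) \<and>
     minimal_model model_pi_gens model_pi_deg model_pi_diff (M_pi2 k)"
proof -
  have Q: "osc_lattice_quotient (osc_lattice k (2 * pi))" "osc_lattice_quotient (osc_lattice k pi)"
    "osc_lattice_quotient (osc_lattice k (pi / 2))"
    using osc_lattice_quotient_quarter[OF assms, of "2 * pi" 4] osc_lattice_quotient_quarter[OF assms, of pi 2]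
      osc_lattice_quotient_quarter[OF assms, of "pi / 2" 1] by simp_all
  \<comment> \<open>The Betti numbers are counts of words by length; listing the representatives
    lets these counts be computed.\<close>
  define r0 rpi :: "nat list list" where r: "r0 = [[], [0], [1], [2], [0, 1], [0, 2], [1, 3], [2, 3],
      [0, 1, 3], [0, 2, 3], [1, 2, 3], [0, 1, 2, 3]]" "rpi = [[], [0], [1, 2, 3], [0, 1, 2, 3]]"
  have set_r: "reps_0 = set r0" "reps_pi = set rpi"
    by (simp_all add: r reps_0_def reps_pi_def)
  have dist_r: "distinct r0" "distinct rpi"
    by (simp_all add: r)
  have len_0: "length (filter (\<lambda>I. length I = 0) r0) = 1" "length (filter (\<lambda>I. length I = 1) r0) = 3"
    "length (filter (\<lambda>I. length I = 2) r0) = 4" "length (filter (\<lambda>I. length I = 3) r0) = 3"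
    "length (filter (\<lambda>I. length I = 4) r0) = 1"
    and len_pi: "length (filter (\<lambda>I. length I = 0) rpi) = 1" "length (filter (\<lambda>I. length I = 1) rpi) = 1"
    "length (filter (\<lambda>I. length I = 2) rpi) = 0" "length (filter (\<lambda>I. length I = 3) rpi) = 1"
    "length (filter (\<lambda>I. length I = 4) rpi) = 1"
    by (simp_all add: r eval_nat_numeral One_nat_def)
  have dim: "cohomology_dim (de_Rham (osc_quotient L)) n (length (filter (\<lambda>I. length I = n) rs))"
    if "osc_lattice_quotient L" "cohomology_basis L (set rs)" "distinct rs" for L rs n
    using that by (intro osc_lattice_quotient.cohomology_dim_de_Rham[OF that(1,2)]) simp_all
  note d0 = dim[OF Q(1) cohomology_basis_2pi[OF assms, unfolded set_r] dist_r(1), folded M_0_def]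
  have dim_0: "cohomology_dim (de_Rham (M_0 k)) 0 1" "cohomology_dim (de_Rham (M_0 k)) 1 3"
    "cohomology_dim (de_Rham (M_0 k)) 2 4" "cohomology_dim (de_Rham (M_0 k)) 3 3"
    "cohomology_dim (de_Rham (M_0 k)) 4 1"
    using d0[of 0] d0[of 1] d0[of 2] d0[of 3] d0[of 4] unfolding len_0 .
  have dim_pi: "cohomology_dim (de_Rham (osc_quotient L)) 0 1 \<and> cohomology_dim (de_Rham (osc_quotient L)) 1 1 \<and>
    cohomology_dim (de_Rham (osc_quotient L)) 2 0 \<and> cohomology_dim (de_Rham (osc_quotient L)) 3 1 \<and>
    cohomology_dim (de_Rham (osc_quotient L)) 4 1"
    if L: "osc_lattice_quotient L" "cohomology_basis L reps_pi" for L
  proof -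
    note d = dim[OF L(1) L(2)[unfolded set_r] dist_r(2)]
    show ?thesis
      using d[of 0] d[of 1] d[of 2] d[of 3] d[of 4] unfolding len_pi by blast
  qed
  have "minimal_model model_0_gens model_0_deg model_0_diff (M_0 k)"
    unfolding minimal_model_def M_0_def
    using minimal_sullivan_model_0 quasi_isomorphism_model_0[OF Q(1) assms] by blast
  moreover have "minimal_model model_pi_gens model_pi_deg model_pi_diff (M_pi k)"
    unfolding minimal_model_def M_pi_def
    using minimal_sullivan_model_pi quasi_isomorphism_model_pi[OF Q(2) cohomology_basis_pi[OF assms]] by blast
  moreover have "minimal_model model_pi_gens model_pi_deg model_pi_diff (M_pi2 k)"
    unfolding minimal_model_def M_pi2_def
    using minimal_sullivan_model_pi quasi_isomorphism_model_pi[OF Q(3) cohomology_basis_pi2[OF assms]] by blast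
  ultimately show ?thesis
    using dim_0 dim_pi[OF Q(2) cohomology_basis_pi[OF assms]] dim_pi[OF Q(3) cohomology_basis_pi2[OF assms]]
    by (simp add: M_pi_def M_pi2_def)
qed

end
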